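(* Let $S(x,y)$ be a smooth phase function on a neighborhood of the origin in $\mathbb{R}^2$ in superadapted coordinates with Newton distance $d=d(S)>1$. Let $\phi\in C_c^\infty(\mathbb{R}^2)$ be real-valued and supported in a sufficiently small neighborhood of the origin, and suppose also that $\phi(0,0)\neq0$. In Case 1 there exists $A_{S,\phi}>0$ such that for $\epsilon>0$ sufficiently small we have $$I_{|S|,\phi}(\epsilon)>A_{S,\phi}\,\epsilon^{1/d}.$$ In Case 2, one similarly has, for some $A_{S,\phi}>0$ and all sufficiently small $\epsilon>0$, $$I_{|S|,\phi}(\epsilon)>A_{S,\phi}\,|\ln(\epsilon)|\,\epsilon^{1/d}.$$ In Case 3, one has analogous almost-sharp lower bounds, at least if $\phi$ is nonnegative. Namely, for any $\delta>0$ there is $A_{S,\phi,\delta}>0$ such that for all sufficiently small $\epsilon>0$ $$I_{|S|,\phi}(\epsilon)>A_{S,\phi,\delta}\,\epsilon^{\frac1d+\delta}.$$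
   Context: Standing assumptions: $S$ is real-valued, $S(0,0)=0$, $\nabla S(0,0)=0$, and the Taylor expansion $\sum_{a,b}s_{ab}x^ay^b$ of $S$ at the origin is not identically zero. Newton polygon: $N(S)$ is the convex hull of the union of the quadrants $\{(t_1,t_2): t_1\ge a,\ t_2\ge b\}$ over all $(a,b)$ with $s_{ab}\neq0$. Its boundary consists of finitely many (possibly zero) compact edges of negative slope together with an unbounded vertical ray and an unbounded horizontal ray. The Newton distance is $d(S)=\inf\{t:(t,t)\in N(S)\}$, and the bisectrix is the line $t_1=t_2$. "The bisectrix intersects $N(S)$" at/in a part of $N(S)$ means that the boundary point $(d(S),d(S))$ lies there. For a compact edge $e$ of $N(S)$ put $S_e(x,y)=\sum_{(a,b)\in e}s_{ab}x^ay^b$. $S$ is in superadapted coordinates if for every compact edge $e$ of $N(S)$ intersecting the bisectrix, neither $S_e(1,y)$ nor $S_e(-1,y)$ has a real zero of order $\ge d(S)$ other than possibly $y=0$. Case 1: the bisectrix intersects $N(S)$ in the interior of a compact edge. Case 2: it intersects $N(S)$ at a vertex $(d,d)$. Case 3: it intersects $N(S)$ in the interior of one of the unbounded rays. $I_{|S|,\phi}(\epsilon)=I_{S,\phi}(\epsilon)+I_{-S,\phi}(\epsilon)=\int_{\{(x,y):|S(x,y)|<\epsilon\}}\phi(x,y)\,dx\,dy$, where $I_{\pm S,\phi}(\epsilon)=\int_{\{(x,y):0<\pm S(x,y)<\epsilon\}}\phi(x,y)\,dx\,dy$.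
   Formalization: In Cases 1 and 2 the integral is multiplied by the sign of φ(0,0), since for φ ≤ 0 with φ(0,0) < 0 the integral is nonpositive and the stated inequality fails; for φ(0,0) > 0 the claim is literal. *)

theory Defs
  imports "HOL-Analysis.Analysis" "HOL-Computational_Algebra.Polynomial"
begin

primrec Ck_on :: "nat \<Rightarrow> 'a::real_normed_vector set \<Rightarrow> ('a \<Rightarrow> 'b::real_normed_vector) \<Rightarrow> bool" where
  "Ck_on 0 U f \<longleftrightarrow> continuous_on U f"
| "Ck_on (Suc k) U f \<longleftrightarrow>
     (\<forall>x\<in>U. f differentiable (at x)) \<and>
     (\<forall>v. Ck_on k U (\<lambda>x. frechet_derivative f (at x) v))"

text \<open>Meaningful for open \<open>U\<close> only: derivatives are taken in the whole space.\<close>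

definition smooth_on :: "'a::real_normed_vector set \<Rightarrow> ('a \<Rightarrow> 'b::real_normed_vector) \<Rightarrow> bool" where
  "smooth_on U f \<longleftrightarrow> (\<forall>k. Ck_on k U f)"

definition supp :: "('a::topological_space \<Rightarrow> real) \<Rightarrow> 'a set" where
  "supp f = closure {x. f x \<noteq> 0}"

text \<open>The coefficient of $x^a y^b$ in the Taylor expansion at the origin,
  $\partial_x^a \partial_y^b S(0,0) / (a!\, b!)$.\<close>

definition taylor_coeff :: "(real \<times> real \<Rightarrow> real) \<Rightarrow> nat \<Rightarrow> nat \<Rightarrow> real" where
  "taylor_coeff S a b =
     (deriv ^^ a) (\<lambda>x. (deriv ^^ b) (\<lambda>y. S (x, y)) 0) 0 / (fact a * fact b)"

definition newton_polygon :: "(real \<times> real \<Rightarrow> real) \<Rightarrow> (real \<times> real) set" where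
  "newton_polygon S = convex hull
     (\<Union>(a, b) \<in> {(a, b). taylor_coeff S a b \<noteq> 0}. {(t1, t2). t1 \<ge> real a \<and> t2 \<ge> real b})"

definition newton_distance :: "(real \<times> real \<Rightarrow> real) \<Rightarrow> real" where
  "newton_distance S = Inf {t. (t, t) \<in> newton_polygon S}"

definition bisectrix_point :: "(real \<times> real \<Rightarrow> real) \<Rightarrow> real \<times> real" where
  "bisectrix_point S = (newton_distance S, newton_distance S)"

text \<open>Edges are the one-dimensional faces; the non-compact ones are the two unbounded rays.\<close>

definition compact_edge :: "(real \<times> real \<Rightarrow> real) \<Rightarrow> (real \<times> real) set \<Rightarrow> bool" where
  "compact_edge S e \<longleftrightarrow> e edge_of newton_polygon S \<and> compact e"

definition unbounded_ray :: "(real \<times> real \<Rightarrow> real) \<Rightarrow> (real \<times> real) set \<Rightarrow> bool" where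
  "unbounded_ray S e \<longleftrightarrow> e edge_of newton_polygon S \<and> \<not> bounded e"

text \<open>For a compact edge \<open>e\<close> both sums below are finite, as \<open>e\<close> lies in the closed first quadrant.\<close>

definition edge_part :: "(real \<times> real \<Rightarrow> real) \<Rightarrow> (real \<times> real) set \<Rightarrow> real \<Rightarrow> real \<Rightarrow> real" where
  "edge_part S e x y =
     (\<Sum>(a, b) \<in> {(a, b). (real a, real b) \<in> e}. taylor_coeff S a b * x ^ a * y ^ b)"

text \<open>$S_e(x,\cdot)$ as a polynomial in the second variable, so that the order of a zero can be
  taken to be the library's root multiplicity \<^const>\<open>order\<close>.\<close>

definition edge_poly :: "(real \<times> real \<Rightarrow> real) \<Rightarrow> (real \<times> real) set \<Rightarrow> real \<Rightarrow> real poly" where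
  "edge_poly S e x =
     (\<Sum>(a, b) \<in> {(a, b). (real a, real b) \<in> e}. monom (taylor_coeff S a b * x ^ a) b)"

lemma poly_edge_poly: "poly (edge_poly S e x) y = edge_part S e x y"
  by (simp add: edge_poly_def edge_part_def poly_sum poly_monom case_prod_beta)

definition superadapted :: "(real \<times> real \<Rightarrow> real) \<Rightarrow> bool" where
  "superadapted S \<longleftrightarrow>
     (\<forall>e. compact_edge S e \<and> bisectrix_point S \<in> e \<longrightarrow>
        (\<forall>x\<in>{1, -1}. \<not> (\<exists>y. y \<noteq> 0 \<and> poly (edge_poly S e x) y = 0 \<and>
            real (order y (edge_poly S e x)) \<ge> newton_distance S)))"

definition bisectrix_in_compact_edge :: "(real \<times> real \<Rightarrow> real) \<Rightarrow> bool" where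
  "bisectrix_in_compact_edge S \<longleftrightarrow>
     (\<exists>e. compact_edge S e \<and> bisectrix_point S \<in> rel_interior e)"

definition bisectrix_at_vertex :: "(real \<times> real \<Rightarrow> real) \<Rightarrow> bool" where
  "bisectrix_at_vertex S \<longleftrightarrow> bisectrix_point S extreme_point_of newton_polygon S"

definition bisectrix_in_unbounded_ray :: "(real \<times> real \<Rightarrow> real) \<Rightarrow> bool" where
  "bisectrix_in_unbounded_ray S \<longleftrightarrow>
     (\<exists>e. unbounded_ray S e \<and> bisectrix_point S \<in> rel_interior e)"

definition level_integral ::
    "(real \<times> real \<Rightarrow> real) \<Rightarrow> (real \<times> real \<Rightarrow> real) \<Rightarrow> real \<Rightarrow> real" where
  "level_integral S \<phi> \<epsilon> = set_lebesgue_integral lborel {p. 0 < S p \<and> S p < \<epsilon>} \<phi>"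

definition abs_level_integral ::
    "(real \<times> real \<Rightarrow> real) \<Rightarrow> (real \<times> real \<Rightarrow> real) \<Rightarrow> real \<Rightarrow> real" where
  "abs_level_integral S \<phi> \<epsilon> = level_integral S \<phi> \<epsilon> + level_integral (\<lambda>p. - S p) \<phi> \<epsilon>"

end

theory Submission
  imports Defs
begin

text \<open>
  Let \<open>a \<alpha> + b \<beta> = 1\<close> be the supporting line of \<open>N(S)\<close> at \<open>(d, d)\<close>. Under the anisotropic dilation
  \<open>(u, v) \<mapsto> (s powr \<alpha> u, s powr \<beta> v)\<close> the rescaled derivatives of \<open>S\<close> converge, as \<open>s\<close> tends to \<open>0\<close>, to
  those of the quasihomogeneous part of \<open>S\<close> on that line. Superadaptedness makes some pure derivative
  of order \<open>< d\<close> of that part nonzero at every point other than the origin (of order \<open>\<le> d\<close> for a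
  vertex), so by compactness the same is true of \<open>S\<close> in a punctured neighbourhood of the origin. Hence
  the van der Corput sublevel estimate bounds the part of the integral away from the origin by
  \<open>O(\<epsilon> powr (1 / K))\<close> with \<open>K < d\<close> (\<open>K = d\<close> for a vertex), which is of lower order, and \<open>\<phi>\<close> may be
  replaced by a positive constant near the origin. There \<open>\<bar>S\<bar> < \<epsilon>\<close> holds on a box of size
  \<open>\<epsilon> powr \<alpha>\<close> by \<open>\<epsilon> powr \<beta>\<close> with \<open>\<alpha> + \<beta> = 1 / d\<close>, up to constants; for a vertex it holds on the part of
  \<open>x y < \<epsilon> powr (1 / d)\<close> between two curves \<open>y = x powr m\<close>, whose area carries the logarithm; for a ray
  one takes a degenerate box with exponents \<open>1 / d\<close> and \<open>\<delta>\<close>.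
\<close>

section \<open>Partial derivatives of smooth functions\<close>

text \<open>Only pure derivatives are controlled, because the one-variable estimate is applied along
  lines parallel to the axes and then integrated over the other variable. On a ray the available
  \<open>K\<close> may exceed d, so the part away from the origin cannot be treated as an error;
  nonnegativity of \<phi> allows it to be discarded instead. Nonvanishing derivatives still serve a
  purpose there: the level integrals omit the set where S = 0, and this set has to be null. S is
  merely smooth and its Taylor series may have infinitely many terms, so nothing is ever summed to
  infinity: the expansion is cut off at an \<open>N\<close> so large that |x|^N and |y|^N are
  negligible in the weighted scale. For the same reason the arguments about N(S) avoid finiteness of
  the set of monomials; convex half-planes, some of them lexicographic, and fractions with bounded
  denominators take its place.\<close>

definition Dx :: "(real \<times> real \<Rightarrow> real) \<Rightarrow> real \<times> real \<Rightarrow> real" where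
  "Dx f p = frechet_derivative f (at p) (1, 0)"

definition Dy :: "(real \<times> real \<Rightarrow> real) \<Rightarrow> real \<times> real \<Rightarrow> real" where
  "Dy f p = frechet_derivative f (at p) (0, 1)"

lemma smooth_on_differentiable: "smooth_on V f \<Longrightarrow> p \<in> V \<Longrightarrow> f differentiable (at p)"
  unfolding smooth_on_def by (metis Ck_on.simps(2))

lemma smooth_on_continuous: "smooth_on V f \<Longrightarrow> continuous_on V f"
  unfolding smooth_on_def by (metis Ck_on.simps(1))

lemma smooth_on_frechet_derivative:
  "smooth_on V f \<Longrightarrow> smooth_on V (\<lambda>p. frechet_derivative f (at p) v)"
  unfolding smooth_on_def by (metis Ck_on.simps(2))

lemma smooth_on_Dx: "smooth_on V f \<Longrightarrow> smooth_on V (Dx f)"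
  unfolding Dx_def[abs_def] by (rule smooth_on_frechet_derivative)

lemma smooth_on_Dy: "smooth_on V f \<Longrightarrow> smooth_on V (Dy f)"
  unfolding Dy_def[abs_def] by (rule smooth_on_frechet_derivative)

lemma smooth_on_Dx_funpow: "smooth_on V f \<Longrightarrow> smooth_on V ((Dx ^^ n) f)"
  by (induction n) (simp_all add: smooth_on_Dx)

lemma smooth_on_Dy_funpow: "smooth_on V f \<Longrightarrow> smooth_on V ((Dy ^^ n) f)"
  by (induction n) (simp_all add: smooth_on_Dy)

lemma Dx_has_derivative:
  assumes "f differentiable (at (x, y))"
  shows "((\<lambda>t. f (t, y)) has_real_derivative Dx f (x, y)) (at x)"
proof -
  let ?f' = "frechet_derivative f (at (x, y))"
  have f': "(f has_derivative ?f') (at (x, y))"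
    using assms frechet_derivative_works by blast
  then interpret bounded_linear ?f'
    by (rule has_derivative_bounded_linear)
  have "((\<lambda>t. (t, y)) has_derivative (\<lambda>h. (h, 0))) (at x)"
    by (auto intro!: derivative_eq_intros)
  from diff_chain_at[OF this f'] have "((\<lambda>t. f (t, y)) has_derivative (\<lambda>h. ?f' (h, 0))) (at x)"
    by (simp add: o_def)
  moreover have "?f' (h, 0) = Dx f (x, y) * h" for h
    using scaleR[of h "(1, 0)"] by (simp add: Dx_def)
  ultimately show ?thesis
    by (simp add: has_field_derivative_def)
qed

lemma Dy_has_derivative:
  assumes "f differentiable (at (x, y))"
  shows "((\<lambda>t. f (x, t)) has_real_derivative Dy f (x, y)) (at y)"
proof -
  let ?f' = "frechet_derivative f (at (x, y))"
  have f': "(f has_derivative ?f') (at (x, y))"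
    using assms frechet_derivative_works by blast
  then interpret bounded_linear ?f'
    by (rule has_derivative_bounded_linear)
  have "((\<lambda>t. (x, t)) has_derivative (\<lambda>h. (0, h))) (at y)"
    by (auto intro!: derivative_eq_intros)
  from diff_chain_at[OF this f'] have "((\<lambda>t. f (x, t)) has_derivative (\<lambda>h. ?f' (0, h))) (at y)"
    by (simp add: o_def)
  moreover have "?f' (0, h) = Dy f (x, y) * h" for h
    using scaleR[of h "(0, 1)"] by (simp add: Dy_def)
  ultimately show ?thesis
    by (simp add: has_field_derivative_def)
qed

lemma frechet_derivative_cong_open:
  assumes "open V" "p \<in> V" "\<And>q. q \<in> V \<Longrightarrow> f q = g q"
  shows "frechet_derivative f (at p) = frechet_derivative g (at p)"
proof -
  have "(f has_derivative D) (at p) \<longleftrightarrow> (g has_derivative D) (at p)" for D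
    using has_derivative_transform_within_open[of f D p UNIV V g]
      has_derivative_transform_within_open[of g D p UNIV V f] assms by auto
  then show ?thesis
    by (simp add: frechet_derivative_def)
qed

text \<open>Two mean value theorems: one in x for the difference of \<open>f\<close> between the
  upper and lower sides of the square, then one in y for \<open>fx\<close>. The left side of the
  identity does not reveal which variable came first.\<close>

lemma second_difference_eq:
  fixes f :: "real \<times> real \<Rightarrow> real"
  assumes "h > 0"
    and dx: "\<And>x y. \<lbrakk>x0 \<le> x; x \<le> x0 + h; y0 \<le> y; y \<le> y0 + h\<rbrakk> \<Longrightarrow>
      ((\<lambda>t. f (t, y)) has_real_derivative fx (x, y)) (at x)"
    and dxy: "\<And>x y. \<lbrakk>x0 \<le> x; x \<le> x0 + h; y0 \<le> y; y \<le> y0 + h\<rbrakk> \<Longrightarrow>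
      ((\<lambda>t. fx (x, t)) has_real_derivative fxy (x, y)) (at y)"
  shows "\<exists>x y. x0 \<le> x \<and> x \<le> x0 + h \<and> y0 \<le> y \<and> y \<le> y0 + h \<and>
    f (x0 + h, y0 + h) - f (x0 + h, y0) - f (x0, y0 + h) + f (x0, y0) = h * h * fxy (x, y)"
proof -
  have "\<exists>x. x0 < x \<and> x < x0 + h \<and>
      (f (x0 + h, y0 + h) - f (x0 + h, y0)) - (f (x0, y0 + h) - f (x0, y0)) =
      (x0 + h - x0) * (fx (x, y0 + h) - fx (x, y0))"
    using \<open>h > 0\<close> by (intro MVT2) (auto intro!: DERIV_diff dx)
  then obtain x where x: "x0 < x" "x < x0 + h" and
    *: "(f (x0 + h, y0 + h) - f (x0 + h, y0)) - (f (x0, y0 + h) - f (x0, y0)) =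
      h * (fx (x, y0 + h) - fx (x, y0))"
    by auto
  have "\<exists>y. y0 < y \<and> y < y0 + h \<and>
      fx (x, y0 + h) - fx (x, y0) = (y0 + h - y0) * fxy (x, y)"
    using \<open>h > 0\<close> x by (intro MVT2) (auto intro!: dxy)
  then obtain y where "y0 < y" "y < y0 + h" "fx (x, y0 + h) - fx (x, y0) = h * fxy (x, y)"
    by auto
  with x * show ?thesis
    by (intro exI[of _ x] exI[of _ y]) (auto simp: algebra_simps)
qed

lemma square_in_open:
  fixes V :: "(real \<times> real) set"
  assumes "open V" "(x0, y0) \<in> V"
  obtains h where "h > 0" "\<And>x y. \<bar>x - x0\<bar> \<le> h \<Longrightarrow> \<bar>y - y0\<bar> \<le> h \<Longrightarrow> (x, y) \<in> V"
proof -
  obtain A B where "open A" "open B" "x0 \<in> A" "y0 \<in> B" and AB: "A \<times> B \<subseteq> V"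
    using open_prod_elim[OF assms] by (metis mem_Sigma_iff)
  obtain a where a: "a > 0" "cball x0 a \<subseteq> A"
    using \<open>open A\<close> \<open>x0 \<in> A\<close> open_contains_cball by blast
  obtain b where b: "b > 0" "cball y0 b \<subseteq> B"
    using \<open>open B\<close> \<open>y0 \<in> B\<close> open_contains_cball by blast
  show ?thesis
  proof
    show "min a b > 0" using a b by simp
    fix x y assume "\<bar>x - x0\<bar> \<le> min a b" "\<bar>y - y0\<bar> \<le> min a b"
    then have "x \<in> cball x0 a" "y \<in> cball y0 b" by (auto simp: dist_real_def)
    then show "(x, y) \<in> V" using a b AB by blast
  qed
qed

text \<open>The second difference over a small square is h^2 times either mixed derivative, each at
  some point of the square. By continuity both values stay within \<open>e\<close> of those at
  \<open>p\<close>, and \<open>e\<close> is half the supposed discrepancy.\<close>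

lemma Dx_Dy_commute:
  assumes V: "open V" and f: "smooth_on V f" and p: "p \<in> V"
  shows "Dy (Dx f) p = Dx (Dy f) p"
proof (rule ccontr)
  assume neq: "Dy (Dx f) p \<noteq> Dx (Dy f) p"
  obtain x0 y0 where p_eq: "p = (x0, y0)" by fastforce
  define e where "e = \<bar>Dy (Dx f) p - Dx (Dy f) p\<bar> / 2"
  have "e > 0" using neq by (simp add: e_def)
  have cont: "isCont (Dy (Dx f)) p" "isCont (Dx (Dy f)) p"
    using smooth_on_continuous smooth_on_Dx smooth_on_Dy f V p
    by (metis continuous_on_eq_continuous_at)+
  have "\<forall>\<^sub>F q in nhds p. \<bar>Dy (Dx f) q - Dy (Dx f) p\<bar> < e \<and> \<bar>Dx (Dy f) q - Dx (Dy f) p\<bar> < e \<and> q \<in> V"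
    using cont \<open>e > 0\<close> eventually_nhds_in_open[OF V p]
    by (intro eventually_conj)
       (auto simp: continuous_at tendsto_at_iff_tendsto_nhds dist_real_def dest!: tendstoD[where e=e])
  then obtain W' where "open W'" "p \<in> W'" and W': "\<And>q. q \<in> W' \<Longrightarrow>
      \<bar>Dy (Dx f) q - Dy (Dx f) p\<bar> < e \<and> \<bar>Dx (Dy f) q - Dx (Dy f) p\<bar> < e \<and> q \<in> V"
    unfolding eventually_nhds by blast
  obtain h where "h > 0" and h: "\<And>x y. \<bar>x - x0\<bar> \<le> h \<Longrightarrow> \<bar>y - y0\<bar> \<le> h \<Longrightarrow> (x, y) \<in> W'"
    using square_in_open[of W' x0 y0] \<open>open W'\<close> \<open>p \<in> W'\<close> p_eq by metis
  have diff: "f differentiable (at q)" "Dx f differentiable (at q)" "Dy f differentiable (at q)"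
    if "q \<in> W'" for q
    using that W' smooth_on_differentiable smooth_on_Dx smooth_on_Dy f by metis+
  have box: "(x, y) \<in> W'" if "x0 \<le> x" "x \<le> x0 + h" "y0 \<le> y" "y \<le> y0 + h" for x y
    using that by (intro h) auto
  have "\<exists>x y. x0 \<le> x \<and> x \<le> x0 + h \<and> y0 \<le> y \<and> y \<le> y0 + h \<and>
    f (x0 + h, y0 + h) - f (x0 + h, y0) - f (x0, y0 + h) + f (x0, y0) = h * h * Dy (Dx f) (x, y)"
    using \<open>h > 0\<close> by (intro second_difference_eq)
      (auto intro!: Dx_has_derivative Dy_has_derivative diff box)
  then obtain x y where q: "(x, y) \<in> W'" and xy:
    "f (x0 + h, y0 + h) - f (x0 + h, y0) - f (x0, y0 + h) + f (x0, y0) = h * h * Dy (Dx f) (x, y)"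
    using box by auto
  \<comment> \<open>The same identity with the coordinates exchanged, so that differentiation in y
    comes first.\<close>
  have "\<exists>y x. y0 \<le> y \<and> y \<le> y0 + h \<and> x0 \<le> x \<and> x \<le> x0 + h \<and>
    (f \<circ> prod.swap) (y0 + h, x0 + h) - (f \<circ> prod.swap) (y0 + h, x0) - (f \<circ> prod.swap) (y0, x0 + h)
      + (f \<circ> prod.swap) (y0, x0) = h * h * (Dx (Dy f) \<circ> prod.swap) (y, x)"
    using \<open>h > 0\<close> by (intro second_difference_eq[where fx = "Dy f \<circ> prod.swap"])
      (auto intro!: Dx_has_derivative Dy_has_derivative diff box)
  then obtain y' x' where q': "(x', y') \<in> W'" and
    "f (x0 + h, y0 + h) - f (x0, y0 + h) - f (x0 + h, y0) + f (x0, y0) = h * h * Dx (Dy f) (x', y')"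
    using box by auto
  with xy have "h * h * Dy (Dx f) (x, y) = h * h * Dx (Dy f) (x', y')"
    by argo
  then have "Dy (Dx f) (x, y) = Dx (Dy f) (x', y')" using \<open>h > 0\<close> by simp
  with W'[OF q] W'[OF q'] show False
    unfolding e_def by argo
qed

lemma Dy_Dx_funpow:
  assumes V: "open V" and f: "smooth_on V f" and "p \<in> V"
  shows "Dy ((Dx ^^ n) f) p = (Dx ^^ n) (Dy f) p"
  using \<open>p \<in> V\<close>
proof (induction n arbitrary: p)
  case (Suc n)
  have "Dy ((Dx ^^ Suc n) f) p = Dx (Dy ((Dx ^^ n) f)) p"
    using Dx_Dy_commute[OF V smooth_on_Dx_funpow[OF f] Suc.prems] by simp
  \<comment> \<open>The induction hypothesis equates the two functions on \<open>V\<close> only;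
    this is enough, as \<open>V\<close> is open and the derivative is local.\<close>
  also have "\<dots> = Dx ((Dx ^^ n) (Dy f)) p"
    unfolding Dx_def
    using frechet_derivative_cong_open[OF V Suc.prems, of "Dy ((Dx ^^ n) f)" "(Dx ^^ n) (Dy f)"] Suc.IH
    by (simp add: Dx_def[abs_def])
  finally show ?case by simp
qed simp

text \<open>\<open>F i j\<close> plays the role of \<partial>x^i \<partial>y^j S. With the
  derivatives as a family closed under index shifts, every later argument differentiates along
  axis-parallel lines and Frechet derivatives no longer appear. Nothing is known about
  \<open>F\<close> outside \<open>V\<close>.\<close>

locale jet =
  fixes V :: "(real \<times> real) set" and F :: "nat \<Rightarrow> nat \<Rightarrow> real \<times> real \<Rightarrow> real"
  assumes open_V: "open V" and zero_V: "(0, 0) \<in> V"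
    and F_cont: "continuous_on V (F i j)"
    and F_dx: "(x, y) \<in> V \<Longrightarrow> ((\<lambda>t. F i j (t, y)) has_real_derivative F (Suc i) j (x, y)) (at x)"
    and F_dy: "(x, y) \<in> V \<Longrightarrow> ((\<lambda>t. F i j (x, t)) has_real_derivative F i (Suc j) (x, y)) (at y)"

lemma jet_smooth_on:
  assumes V: "open V" "(0, 0) \<in> V" and S: "smooth_on V S"
  shows "jet V (\<lambda>i j. (Dx ^^ i) ((Dy ^^ j) S))"
proof (unfold_locales)
  have sm: "smooth_on V ((Dx ^^ i) ((Dy ^^ j) S))" for i j
    by (intro smooth_on_Dx_funpow smooth_on_Dy_funpow S)
  show "continuous_on V ((Dx ^^ i) ((Dy ^^ j) S))" for i j
    by (rule smooth_on_continuous[OF sm])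
  fix x y i j assume xy: "(x, y) \<in> V"
  note diff = smooth_on_differentiable[OF sm xy]
  show "((\<lambda>t. (Dx ^^ i) ((Dy ^^ j) S) (t, y)) has_real_derivative
      (Dx ^^ Suc i) ((Dy ^^ j) S) (x, y)) (at x)"
    using Dx_has_derivative[OF diff] by simp
  show "((\<lambda>t. (Dx ^^ i) ((Dy ^^ j) S) (x, t)) has_real_derivative
      (Dx ^^ i) ((Dy ^^ Suc j) S) (x, y)) (at y)"
    using Dy_has_derivative[OF diff] Dy_Dx_funpow[OF V(1) smooth_on_Dy_funpow[OF S] xy] by simp
qed (use V in auto)

lemma deriv_funpow_eqI:
  fixes g :: "nat \<Rightarrow> real \<Rightarrow> real"
  assumes "open T"
    and "\<And>n t. t \<in> T \<Longrightarrow> (g n has_real_derivative g (Suc n) t) (at t)"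
    and "\<And>t. t \<in> T \<Longrightarrow> f t = g 0 t"
    and "t \<in> T"
  shows "(deriv ^^ n) f t = g n t"
  using \<open>t \<in> T\<close>
proof (induction n arbitrary: t)
  case (Suc n)
  have "((deriv ^^ n) f has_real_derivative g (Suc n) t) (at t)"
    using has_field_derivative_transform_within_open[OF assms(2)[OF Suc.prems] \<open>open T\<close> Suc.prems]
      Suc.IH by metis
  then show ?case by (simp add: DERIV_imp_deriv)
qed (simp add: assms(3))

lemma (in jet) taylor_coeff_eq:
  "taylor_coeff (F 0 0) a b = F a b (0, 0) / (fact a * fact b)"
proof -
  have slice: "open {y. (x, y) \<in> V}" "open {x. (x, y) \<in> V}" for x y
    using open_V by (auto intro!: open_vimage[unfolded vimage_def] continuous_intros)
  have inner: "(deriv ^^ b) (\<lambda>y. F 0 0 (x, y)) 0 = F 0 b (x, 0)" if "(x, 0) \<in> V" for x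
    using deriv_funpow_eqI[where T = "{y. (x, y) \<in> V}" and g = "\<lambda>n y. F 0 n (x, y)"]
      slice that F_dy by auto
  have "(deriv ^^ a) (\<lambda>x. (deriv ^^ b) (\<lambda>y. F 0 0 (x, y)) 0) 0 = F a b (0, 0)"
    by (rule deriv_funpow_eqI[where T = "{x. (x, 0) \<in> V}" and g = "\<lambda>n x. F n b (x, 0)"])
       (use slice F_dx inner zero_V in auto)
  then show ?thesis
    by (simp add: taylor_coeff_def)
qed

section \<open>Taylor expansion and boxes in sublevel sets\<close>

lemma square_compact_bound:
  fixes f :: "real \<times> real \<Rightarrow> real"
  assumes "continuous_on V f" and "\<And>x y. \<bar>x\<bar> \<le> r \<Longrightarrow> \<bar>y\<bar> \<le> r \<Longrightarrow> (x, y) \<in> V"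
  shows "\<exists>M\<ge>0. \<forall>x y. \<bar>x\<bar> \<le> r \<longrightarrow> \<bar>y\<bar> \<le> r \<longrightarrow> \<bar>f (x, y)\<bar> \<le> M"
proof -
  have "{-r..r} \<times> {-r..r} \<subseteq> V"
    using assms(2) by (auto simp: abs_le_iff)
  then have "compact (f ` ({-r..r} \<times> {-r..r}))"
    using assms(1) by (intro compact_continuous_image compact_Times) (auto intro: continuous_on_subset)
  then obtain M where "\<forall>z\<in>f ` ({-r..r} \<times> {-r..r}). \<bar>z\<bar> \<le> M"
    using compact_imp_bounded bounded_real by metis
  then have "\<bar>f (x, y)\<bar> \<le> max M 0" if "\<bar>x\<bar> \<le> r" "\<bar>y\<bar> \<le> r" for x y
    using that by (intro max.coboundedI1, drule_tac bspec[of _ _ "f (x, y)"]) (auto simp: abs_le_iff)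
  then show ?thesis by (intro exI[of _ "max M 0"]) auto
qed

section \<open>Taylor's formula in two variables and domination by monomials\<close>

context jet
begin

definition coef :: "nat \<Rightarrow> nat \<Rightarrow> real" where
  "coef a b = F a b (0, 0)"

lemma square_in_V:
  obtains r where "0 < r" "r \<le> 1" "\<And>x y. \<bar>x\<bar> \<le> r \<Longrightarrow> \<bar>y\<bar> \<le> r \<Longrightarrow> (x, y) \<in> V"
proof -
  obtain h where "h > 0" "\<And>x y. \<bar>x\<bar> \<le> h \<Longrightarrow> \<bar>y\<bar> \<le> h \<Longrightarrow> (x, y) \<in> V"
    using square_in_open[OF open_V zero_V] by auto
  then show ?thesis by (intro that[of "min h 1"]) auto
qed

text \<open>Maclaurin's formula in y, and then in x for each of its coefficients. Truncating over
  the square a, b < N leaves an error in pure powers of x and y only. General \<open>i\<close> and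
  \<open>j\<close> are allowed because the rescaling argument expands the derivatives too.\<close>

lemma taylor_remainder:
  obtains r C where "0 < r" "r \<le> 1" "0 \<le> C"
    "\<And>x y. \<bar>x\<bar> \<le> r \<Longrightarrow> \<bar>y\<bar> \<le> r \<Longrightarrow> (x, y) \<in> V"
    "\<And>x y. \<bar>x\<bar> \<le> r \<Longrightarrow> \<bar>y\<bar> \<le> r \<Longrightarrow>
      \<bar>F i j (x, y) - (\<Sum>b<N. \<Sum>a<N. coef (i + a) (j + b) / (fact a * fact b) * x ^ a * y ^ b)\<bar>
        \<le> C * (\<bar>x\<bar> ^ N + \<bar>y\<bar> ^ N)"
proof -
  obtain r where r: "0 < r" "r \<le> 1" "\<And>x y. \<bar>x\<bar> \<le> r \<Longrightarrow> \<bar>y\<bar> \<le> r \<Longrightarrow> (x, y) \<in> V"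
    using square_in_V by blast
  have "\<forall>i j. \<exists>M\<ge>0. \<forall>x y. \<bar>x\<bar> \<le> r \<longrightarrow> \<bar>y\<bar> \<le> r \<longrightarrow> \<bar>F i j (x, y)\<bar> \<le> M"
    using square_compact_bound[OF F_cont r(3)] by blast
  then obtain M where M0: "\<And>i j. M i j \<ge> 0"
    and M: "\<And>i j x y. \<bar>x\<bar> \<le> r \<Longrightarrow> \<bar>y\<bar> \<le> r \<Longrightarrow> \<bar>F i j (x, y)\<bar> \<le> M i j"
    by metis
  \<comment> \<open>The remainder in y, plus one remainder in x for each coefficient b < N; the
    factors |y|^b are at most 1 since \<open>r\<close> is at most 1.\<close>
  define C where "C = M i (j + N) + (\<Sum>b<N. M (i + N) (j + b))"
  have quot: "\<bar>z / fact n * w ^ n\<bar> \<le> m * \<bar>w\<bar> ^ n" if "\<bar>z\<bar> \<le> m" for z w m :: real and n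
  proof -
    have "\<bar>z\<bar> / fact n \<le> m / 1"
      using that by (intro frac_le) (auto simp: fact_ge_1)
    then have "\<bar>z\<bar> / fact n * \<bar>w\<bar> ^ n \<le> m * \<bar>w\<bar> ^ n"
      by (intro mult_right_mono) auto
    then show ?thesis by (simp add: abs_mult power_abs)
  qed
  show ?thesis
  proof (rule that[of r C])
    show "0 \<le> C" unfolding C_def by (intro add_nonneg_nonneg sum_nonneg M0)
    fix x y :: real assume x: "\<bar>x\<bar> \<le> r" and y: "\<bar>y\<bar> \<le> r"
    let ?T = "\<lambda>b. \<Sum>a<N. coef (i + a) (j + b) / fact a * x ^ a"
    have "\<exists>t. \<bar>t\<bar> \<le> \<bar>y\<bar> \<and> F i j (x, y) =
        (\<Sum>m<N. F i (j + m) (x, 0) / fact m * y ^ m) + F i (j + N) (x, t) / fact N * y ^ N"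
      by (rule Maclaurin_bi_le) (use x y r(3) F_dy in auto)
    then obtain t where "\<bar>t\<bar> \<le> \<bar>y\<bar>" and Fy: "F i j (x, y) =
        (\<Sum>m<N. F i (j + m) (x, 0) / fact m * y ^ m) + F i (j + N) (x, t) / fact N * y ^ N"
      by blast
    then have ry: "\<bar>F i (j + N) (x, t) / fact N * y ^ N\<bar> \<le> M i (j + N) * \<bar>y\<bar> ^ N"
      using x y by (intro quot M) auto
    have rx: "\<bar>F i (j + b) (x, 0) - ?T b\<bar> \<le> M (i + N) (j + b) * \<bar>x\<bar> ^ N" for b
    proof -
      have "\<exists>t. \<bar>t\<bar> \<le> \<bar>x\<bar> \<and> F i (j + b) (x, 0) =
        (\<Sum>m<N. F (i + m) (j + b) (0, 0) / fact m * x ^ m) + F (i + N) (j + b) (t, 0) / fact N * x ^ N"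
        by (rule Maclaurin_bi_le) (use x y r F_dx in auto)
      then obtain t where "\<bar>t\<bar> \<le> \<bar>x\<bar>" "F i (j + b) (x, 0) =
        (\<Sum>m<N. F (i + m) (j + b) (0, 0) / fact m * x ^ m) + F (i + N) (j + b) (t, 0) / fact N * x ^ N"
        by blast
      moreover from this(1) have "\<bar>F (i + N) (j + b) (t, 0) / fact N * x ^ N\<bar> \<le> M (i + N) (j + b) * \<bar>x\<bar> ^ N"
        using x r by (intro quot M) auto
      ultimately show ?thesis by (simp add: coef_def)
    qed
    have summand: "\<bar>(F i (j + b) (x, 0) - ?T b) / fact b * y ^ b\<bar> \<le> M (i + N) (j + b) * \<bar>x\<bar> ^ N" for b
    proof -
      have "\<bar>(F i (j + b) (x, 0) - ?T b) / fact b * y ^ b\<bar> \<le> (M (i + N) (j + b) * \<bar>x\<bar> ^ N) * \<bar>y\<bar> ^ b"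
        by (intro quot rx)
      also have "\<dots> \<le> (M (i + N) (j + b) * \<bar>x\<bar> ^ N) * 1"
        using y r M0 by (intro mult_left_mono power_le_one) auto
      finally show ?thesis by simp
    qed
    have split: "(F i (j + b) (x, 0) - ?T b) / fact b * y ^ b = F i (j + b) (x, 0) / fact b * y ^ b -
        (\<Sum>a<N. coef (i + a) (j + b) / (fact a * fact b) * x ^ a * y ^ b)" for b
      by (simp add: diff_divide_distrib left_diff_distrib right_diff_distrib sum_divide_distrib
          sum_distrib_left sum_distrib_right mult_ac)
    have "F i j (x, y) - (\<Sum>b<N. \<Sum>a<N. coef (i + a) (j + b) / (fact a * fact b) * x ^ a * y ^ b) =
        (\<Sum>b<N. (F i (j + b) (x, 0) - ?T b) / fact b * y ^ b) + F i (j + N) (x, t) / fact N * y ^ N"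
      unfolding Fy split sum_subtractf by simp
    also have "\<bar>\<dots>\<bar> \<le> (\<Sum>b<N. M (i + N) (j + b) * \<bar>x\<bar> ^ N) + M i (j + N) * \<bar>y\<bar> ^ N"
      by (intro order.trans[OF abs_triangle_ineq] add_mono ry
          order.trans[OF sum_abs] sum_mono summand)
    also have "\<dots> \<le> C * \<bar>x\<bar> ^ N + C * \<bar>y\<bar> ^ N"
      unfolding sum_distrib_right[symmetric] C_def
      by (intro add_mono mult_right_mono) (auto intro!: sum_nonneg M0)
    finally show "\<bar>F i j (x, y) - (\<Sum>b<N. \<Sum>a<N. coef (i + a) (j + b) / (fact a * fact b) * x ^ a * y ^ b)\<bar>
        \<le> C * (\<bar>x\<bar> ^ N + \<bar>y\<bar> ^ N)"
      by (simp add: algebra_simps)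
  qed (use r in auto)
qed

text \<open>Reduces the inclusion of a region in a sublevel set to inequalities between monomials:
  it suffices to bound the monomials that occur, together with the two powers coming from the
  remainder.\<close>

lemma monomial_domination:
  obtains r C where "0 < r" "r \<le> 1" "0 < C"
    "\<And>x y. \<bar>x\<bar> \<le> r \<Longrightarrow> \<bar>y\<bar> \<le> r \<Longrightarrow> (x, y) \<in> V"
    "\<And>x y t. \<lbrakk>\<bar>x\<bar> \<le> r; \<bar>y\<bar> \<le> r; \<And>a b. coef a b \<noteq> 0 \<Longrightarrow> \<bar>x\<bar> ^ a * \<bar>y\<bar> ^ b \<le> t; \<bar>x\<bar> ^ N \<le> t; \<bar>y\<bar> ^ N \<le> t\<rbrakk>
      \<Longrightarrow> \<bar>F 0 0 (x, y)\<bar> \<le> C * t"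
proof -
  obtain r C where r: "0 < r" "r \<le> 1" "0 \<le> C"
    and V: "\<And>x y. \<bar>x\<bar> \<le> r \<Longrightarrow> \<bar>y\<bar> \<le> r \<Longrightarrow> (x, y) \<in> V"
    and rem: "\<And>x y. \<bar>x\<bar> \<le> r \<Longrightarrow> \<bar>y\<bar> \<le> r \<Longrightarrow>
      \<bar>F 0 0 (x, y) - (\<Sum>b<N. \<Sum>a<N. coef (0 + a) (0 + b) / (fact a * fact b) * x ^ a * y ^ b)\<bar>
        \<le> C * (\<bar>x\<bar> ^ N + \<bar>y\<bar> ^ N)"
    using taylor_remainder[of 0 0 N thesis] by blast
  define s where "s a b = coef a b / (fact a * fact b)" for a b
  define D where "D = (\<Sum>b<N. \<Sum>a<N. \<bar>s a b\<bar>) + 2 * C + 1"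
  have D: "D > 0" using r unfolding D_def by (intro add_nonneg_pos add_nonneg_nonneg sum_nonneg) auto
  show ?thesis
  proof (rule that[of r D])
    fix x y t assume x: "\<bar>x\<bar> \<le> r" and y: "\<bar>y\<bar> \<le> r"
      and t: "\<And>a b. coef a b \<noteq> 0 \<Longrightarrow> \<bar>x\<bar> ^ a * \<bar>y\<bar> ^ b \<le> t" "\<bar>x\<bar> ^ N \<le> t" "\<bar>y\<bar> ^ N \<le> t"
    have t0: "t \<ge> 0" using t(2) by (meson order.trans abs_ge_zero zero_le_power)
    have mon: "\<bar>s a b * x ^ a * y ^ b\<bar> \<le> \<bar>s a b\<bar> * t" for a b
    proof (cases "coef a b = 0")
      case False
      then have "\<bar>s a b\<bar> * (\<bar>x\<bar> ^ a * \<bar>y\<bar> ^ b) \<le> \<bar>s a b\<bar> * t"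
        by (intro mult_left_mono t) auto
      then show ?thesis by (simp add: abs_mult power_abs mult.assoc)
    qed (simp add: s_def)
    have "\<bar>F 0 0 (x, y)\<bar> \<le> \<bar>\<Sum>b<N. \<Sum>a<N. s a b * x ^ a * y ^ b\<bar> + C * (\<bar>x\<bar> ^ N + \<bar>y\<bar> ^ N)"
      using rem[OF x y] by (simp add: s_def)
    also have "\<dots> \<le> (\<Sum>b<N. \<Sum>a<N. \<bar>s a b\<bar> * t) + C * (t + t)"
      using r by (intro add_mono mult_left_mono t order.trans[OF sum_abs] sum_mono mon) auto
    also have "\<dots> \<le> D * t"
      using t0 by (simp add: D_def algebra_simps sum_distrib_left sum_distrib_right)
    finally show "\<bar>F 0 0 (x, y)\<bar> \<le> D * t" .
  qed (use r V D in auto)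
qed

section \<open>Sublevel sets near the origin and the boxes they contain\<close>

definition sublevel :: "real \<Rightarrow> real \<Rightarrow> (real \<times> real) set" where
  "sublevel \<rho> \<epsilon> = {p \<in> V. norm p < \<rho> \<and> \<bar>F 0 0 p\<bar> < \<epsilon>}"

lemma open_sublevel: "open (sublevel \<rho> \<epsilon>)"
proof -
  have "open (V \<inter> F 0 0 -` {-\<epsilon><..<\<epsilon>})"
    using F_cont open_V by (intro continuous_open_preimage) auto
  then have "open (V \<inter> F 0 0 -` {-\<epsilon><..<\<epsilon>} \<inter> ball 0 \<rho>)"
    by auto
  moreover have "V \<inter> F 0 0 -` {-\<epsilon><..<\<epsilon>} \<inter> ball 0 \<rho> = sublevel \<rho> \<epsilon>"
    by (auto simp: sublevel_def abs_less_iff)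
  ultimately show ?thesis by simp
qed

lemma sublevel_measurable [measurable]: "sublevel \<rho> \<epsilon> \<in> sets lborel"
  using open_sublevel by simp

lemma norm_Pair_lt: "\<bar>x\<bar> < \<rho> / 2 \<Longrightarrow> \<bar>y\<bar> < \<rho> / 2 \<Longrightarrow> norm (x, y) < (\<rho>::real)" for x y :: real
  using norm_Pair_le[of x y] by simp

lemma ev_powr_less: "(0::real) < e \<Longrightarrow> 0 < \<alpha> \<Longrightarrow> 0 < h \<Longrightarrow> \<forall>\<^sub>F \<epsilon> in at_right 0. (h * \<epsilon>) powr \<alpha> < e"
proof -
  assume "0 < e" "0 < \<alpha>" "0 < h"
  have "((\<lambda>\<epsilon>. (h * \<epsilon>) powr \<alpha>) \<longlongrightarrow> (h * 0) powr \<alpha>) (at_right 0)"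
    using \<open>0 < \<alpha>\<close> \<open>0 < h\<close> eventually_at_right_less[of 0]
    by (intro tendsto_intros tendsto_powr') (auto elim!: eventually_mono)
  then show ?thesis using order_tendstoD(2)[of _ 0 "at_right 0" e] \<open>0 < e\<close> by simp
qed

text \<open>With t proportional to \<epsilon>, a monomial on the box |x| \<le> t^\<alpha>, |y| \<le>
  t^\<beta> is at most t^(a \<alpha> + b \<beta>), hence at most t. The weights need not come from a
  supporting line at (d, d); for a ray one of them will be an arbitrary \<delta>.\<close>

lemma rectangle_lower_bound:
  fixes \<alpha> \<beta> \<rho> :: real
  assumes "\<alpha> > 0" "\<beta> > 0" and supp: "\<And>a b. coef a b \<noteq> 0 \<Longrightarrow> a * \<alpha> + b * \<beta> \<ge> 1" and "\<rho> > 0"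
  shows "\<exists>A>0. \<forall>\<^sub>F \<epsilon> in at_right 0. ennreal (A * \<epsilon> powr (\<alpha> + \<beta>)) \<le> emeasure lborel (sublevel \<rho> \<epsilon>)"
proof -
  \<comment> \<open>Large enough that x^N and y^N, as monomials, also satisfy the weight
    condition.\<close>
  obtain N :: nat where N: "N > 1 / \<alpha> + 1 / \<beta>"
    using reals_Archimedean2 by blast
  have "1 / \<alpha> \<le> N" "1 / \<beta> \<le> N" using assms N by (auto intro: order.trans[of _ "1 / \<alpha> + 1 / \<beta>"])
  then have N: "1 \<le> N * \<alpha>" "1 \<le> N * \<beta>"
    using assms by (auto simp: field_simps)
  obtain r C where r: "0 < r" "r \<le> 1" "0 < C"
    and V: "\<And>x y. \<bar>x\<bar> \<le> r \<Longrightarrow> \<bar>y\<bar> \<le> r \<Longrightarrow> (x, y) \<in> V"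
    and dom: "\<And>x y t. \<lbrakk>\<bar>x\<bar> \<le> r; \<bar>y\<bar> \<le> r; \<And>a b. coef a b \<noteq> 0 \<Longrightarrow> \<bar>x\<bar> ^ a * \<bar>y\<bar> ^ b \<le> t;
        \<bar>x\<bar> ^ N \<le> t; \<bar>y\<bar> ^ N \<le> t\<rbrakk> \<Longrightarrow> \<bar>F 0 0 (x, y)\<bar> \<le> C * t"
    using monomial_domination[of N thesis] by blast
  \<comment> \<open>Then C t = \<epsilon> / 2, which leaves room for the strict inequality in the
    sublevel set.\<close>
  define h where "h = 1 / (2 * C)"
  have h: "h > 0" using r by (simp add: h_def)
  let ?m = "min r (\<rho> / 2)"
  have m: "?m > 0" using r \<open>\<rho> > 0\<close> by simp
  have "\<forall>\<^sub>F \<epsilon> in at_right 0. ennreal (4 * h powr (\<alpha> + \<beta>) * \<epsilon> powr (\<alpha> + \<beta>)) \<le> emeasure lborel (sublevel \<rho> \<epsilon>)"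
    using ev_powr_less[OF m \<open>\<alpha> > 0\<close> h] ev_powr_less[OF m \<open>\<beta> > 0\<close> h]
      ev_powr_less[OF zero_less_one zero_less_one h] eventually_at_right_less[of 0]
  proof eventually_elim
    case (elim \<epsilon>)
    define t where "t = h * \<epsilon>"
    have t: "0 < t" "t < 1" using elim h by (auto simp: t_def)
    let ?R = "{- (t powr \<alpha>)..t powr \<alpha>} \<times> {- (t powr \<beta>)..t powr \<beta>}"
    have pow: "\<bar>x\<bar> ^ a * \<bar>y\<bar> ^ b \<le> t powr (a * \<alpha> + b * \<beta>)" if "(x, y) \<in> ?R" for x y a b
    proof -
      have "\<bar>x\<bar> ^ a \<le> (t powr \<alpha>) ^ a" "\<bar>y\<bar> ^ b \<le> (t powr \<beta>) ^ b"
        using that by (auto intro!: power_mono)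
      then have "\<bar>x\<bar> ^ a * \<bar>y\<bar> ^ b \<le> (t powr \<alpha>) ^ a * (t powr \<beta>) ^ b"
        by (intro mult_mono) auto
      also have "\<dots> = t powr (a * \<alpha> + b * \<beta>)"
        using t by (simp add: powr_add powr_powr mult.commute flip: powr_realpow[of "t powr _"])
      finally show ?thesis .
    qed
    have le_t: "t powr z \<le> t" if "z \<ge> 1" for z
      using powr_mono'[OF that, of t] t by simp
    have "?R \<subseteq> sublevel \<rho> \<epsilon>"
    proof clarify
      fix x y assume "x \<in> {- (t powr \<alpha>)..t powr \<alpha>}" "y \<in> {- (t powr \<beta>)..t powr \<beta>}"
      then have R: "(x, y) \<in> ?R" and xy: "\<bar>x\<bar> < ?m" "\<bar>y\<bar> < ?m"
        using elim by (auto simp: t_def)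
      have "\<bar>F 0 0 (x, y)\<bar> \<le> C * t"
      proof (rule dom)
        show "\<bar>x\<bar> ^ a * \<bar>y\<bar> ^ b \<le> t" if "coef a b \<noteq> 0" for a b
          using pow[OF R, of a b] le_t[OF supp[OF that]] by linarith
        show "\<bar>x\<bar> ^ N \<le> t" "\<bar>y\<bar> ^ N \<le> t"
          using pow[OF R, of N 0] pow[OF R, of 0 N] le_t[OF N(1)] le_t[OF N(2)] by simp_all
      qed (use xy in auto)
      also have "\<dots> < \<epsilon>" using r elim by (simp add: t_def h_def)
      finally show "(x, y) \<in> sublevel \<rho> \<epsilon>"
        using V[of x y] xy norm_Pair_lt by (auto simp: sublevel_def)
    qed
    then have "emeasure lborel ?R \<le> emeasure lborel (sublevel \<rho> \<epsilon>)"
      by (rule emeasure_mono[OF _ sublevel_measurable])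
    moreover have "emeasure lborel ?R = ennreal (2 * t powr \<alpha>) * ennreal (2 * t powr \<beta>)"
      by (subst lborel_prod[symmetric], subst lborel.emeasure_pair_measure_Times) auto
    also have "\<dots> = ennreal (4 * h powr (\<alpha> + \<beta>) * \<epsilon> powr (\<alpha> + \<beta>))"
      using h elim by (subst ennreal_mult[symmetric]) (auto simp: t_def powr_mult powr_add)
    ultimately show ?case by simp
  qed
  then show ?thesis using h by (intro exI[of _ "4 * h powr (\<alpha> + \<beta>)"]) auto
qed

end

section \<open>The logarithmic lower bound at a vertex\<close>

text \<open>The slice over x has length \<tau> / (2 x), and integrating 1 / x produces the
  logarithm. Cutting at \<tau> / 2 from below keeps y bounded away from 0 in terms of x, which is
  what later places the strip above a curve y = x^m.\<close>

lemma emeasure_hyperbolic_strip: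
  fixes l u \<tau> :: real
  assumes "0 < l" "l \<le> u" "0 < \<tau>"
  shows "emeasure lborel {(x, y). l \<le> x \<and> x \<le> u \<and> \<tau> / 2 \<le> x * y \<and> x * y \<le> \<tau>}
    = ennreal (\<tau> / 2 * (ln u - ln l))"
proof -
  let ?G = "{(x, y). l \<le> x \<and> x \<le> u \<and> \<tau> / 2 \<le> x * y \<and> x * y \<le> \<tau>}"
  have "closed ?G"
    unfolding case_prod_beta by (intro closed_Collect_conj closed_Collect_le continuous_intros)
  then have G: "?G \<in> sets (lborel \<Otimes>\<^sub>M lborel)"
    by (simp only: lborel_prod sets_lborel borel_closed)
  have slice: "emeasure lborel (Pair x -` ?G) = ennreal (\<tau> / 2 * (1 / x)) * indicator {l..u} x" for x
  proof (cases "x \<in> {l..u}")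
    case True
    then have "x > 0" using assms by auto
    then have "Pair x -` ?G = {\<tau> / 2 / x..\<tau> / x}"
      using True by (auto simp: field_simps)
    then show ?thesis
      using True \<open>x > 0\<close> assms by (simp add: divide_right_mono) (simp add: field_simps)
  qed (auto simp: vimage_def)
  have "emeasure lborel ?G = (\<integral>\<^sup>+x. ennreal (\<tau> / 2 * (1 / x)) * indicator {l..u} x \<partial>lborel)"
    using lborel.emeasure_pair_measure_alt[OF G] by (simp only: lborel_prod slice)
  also have "\<dots> = ennreal (\<tau> / 2 * ln u - \<tau> / 2 * ln l)"
  proof (rule nn_integral_FTC_Icc)
    fix x assume "x \<in> {l..u}"
    with assms show "((\<lambda>x. \<tau> / 2 * ln x) has_real_derivative \<tau> / 2 * (1 / x)) (at x)"
      "0 \<le> \<tau> / 2 * (1 / x)"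
      by (auto intro!: derivative_eq_intros)
  qed (use assms in auto)
  finally show ?thesis by (simp only: right_diff_distrib)
qed

lemma affine_nonneg_between:
  fixes p q \<mu> l m :: real
  assumes "p + l * q \<ge> 0" "p + m * q \<ge> 0" "m \<le> \<mu>" "\<mu> \<le> l"
  shows "p + \<mu> * q \<ge> 0"
proof (cases "q \<ge> 0")
  case True
  then have "m * q \<le> \<mu> * q" using assms by (intro mult_right_mono)
  with assms show ?thesis by linarith
next
  case False
  then have "l * q \<le> \<mu> * q" using assms by (intro mult_right_mono_neg) auto
  with assms show ?thesis by linarith
qed

text \<open>Writing y = x^\<mu> turns both sides into powers of x, and the claim becomes a + \<mu> b
  \<ge> d (1 + \<mu>). This is affine in \<mu>, so it follows from the two endpoint
  conditions.\<close>

lemma monomial_le_at_vertex: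
  fixes x y m1 m2 d :: real and a b :: nat
  assumes "a + m1 * b \<ge> d * (1 + m1)" "a + m2 * b \<ge> d * (1 + m2)"
    and x: "0 < x" "x < 1" and y: "x powr m1 \<le> y" "y \<le> x powr m2"
  shows "x ^ a * y ^ b \<le> (x * y) powr d"
proof -
  define \<mu> where "\<mu> = ln y / ln x"
  have "x powr m1 > 0" using x by simp
  with y have "y > 0" by linarith
  have "ln x < 0" using x by simp
  have y_eq: "y = x powr \<mu>"
    using \<open>y > 0\<close> \<open>ln x < 0\<close> x by (simp add: \<mu>_def powr_def)
  have "\<mu> \<le> m1" "m2 \<le> \<mu>"
    using y x powr_less_mono'[of x m1 \<mu>] powr_less_mono'[of x \<mu> m2] unfolding y_eq
    by (auto simp: not_less[symmetric])
  moreover have "0 \<le> (real a - d) + m1 * (real b - d)" "0 \<le> (real a - d) + m2 * (real b - d)"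
    using assms(1,2) by (simp_all add: algebra_simps)
  ultimately have "0 \<le> (real a - d) + \<mu> * (real b - d)"
    using affine_nonneg_between by blast
  then have "d + d * \<mu> \<le> a + \<mu> * b" by (simp add: algebra_simps)
  then have "x powr (a + \<mu> * b) \<le> x powr (d + d * \<mu>)"
    using x by (intro powr_mono') auto
  then show ?thesis
    using x \<open>y > 0\<close> unfolding y_eq
    by (simp add: powr_add powr_mult powr_powr mult.commute flip: powr_realpow)
qed

context jet
begin

text \<open>Two distinct lines through (d, d) support the monomials. Between the corresponding
  curves every monomial is at most (x y)^d, so the bound depends on the product x y alone and a
  whole hyperbolic strip fits into the sublevel set.\<close>

lemma vertex_lower_bound:
  fixes d m1 m2 \<rho> :: real
  assumes d: "d > 0" and m: "0 < m2" "m2 < m1"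
    and supp: "\<And>a b. coef a b \<noteq> 0 \<Longrightarrow> a + m1 * b \<ge> d * (1 + m1)"
      "\<And>a b. coef a b \<noteq> 0 \<Longrightarrow> a + m2 * b \<ge> d * (1 + m2)"
    and "\<rho> > 0"
  shows "\<exists>A>0. \<forall>\<^sub>F \<epsilon> in at_right 0.
    ennreal (A * (\<bar>ln \<epsilon>\<bar> * \<epsilon> powr (1 / d))) \<le> emeasure lborel (sublevel \<rho> \<epsilon>)"
proof -
  \<comment> \<open>Makes (N, 0) and (0, N) satisfy both support conditions, so that the remainder
    powers are also at most (x y)^d.\<close>
  obtain N :: nat where N: "N > d * (1 + m1) + d * (1 + m1) / m2"
    using reals_Archimedean2 by blast
  have *: "d * (1 + m1) > 0" "d * (1 + m1) / m2 > 0" using d m by auto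
  then have N1: "d * (1 + m1) \<le> N" and "d * (1 + m1) / m2 \<le> N"
    using N by linarith+
  then have N2: "d * (1 + m1) \<le> m2 * N" using m by (simp add: field_simps)
  obtain r C where r: "0 < r" "r \<le> 1" "0 < C"
    and V: "\<And>x y. \<bar>x\<bar> \<le> r \<Longrightarrow> \<bar>y\<bar> \<le> r \<Longrightarrow> (x, y) \<in> V"
    and dom: "\<And>x y t. \<lbrakk>\<bar>x\<bar> \<le> r; \<bar>y\<bar> \<le> r; \<And>a b. coef a b \<noteq> 0 \<Longrightarrow> \<bar>x\<bar> ^ a * \<bar>y\<bar> ^ b \<le> t;
        \<bar>x\<bar> ^ N \<le> t; \<bar>y\<bar> ^ N \<le> t\<rbrakk> \<Longrightarrow> \<bar>F 0 0 (x, y)\<bar> \<le> C * t"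
    using monomial_domination[of N thesis] by blast
  define h where "h = 1 / (2 * C)"
  have h: "h > 0" using r by (simp add: h_def)
  let ?m = "min r (\<rho> / 2)"
  have pos: "?m > 0" "?m powr (1 / m2) > 0" using r \<open>\<rho> > 0\<close> by auto
  \<comment> \<open>The difference of the exponents of \<tau> in \<open>l\<close> and
    \<open>u\<close>; up to bounded terms, ln u - ln l is \<kappa> |ln \<tau>|.\<close>
  define \<kappa> where "\<kappa> = 1 / (1 + m2) - 1 / (1 + m1)"
  have "1 / (1 + m1) < 1 / (1 + m2)"
    using m by (intro divide_strict_left_mono mult_pos_pos) auto
  then have "\<kappa> > 0" by (simp add: \<kappa>_def)
  define A where "A = h powr (1 / d) * \<kappa> / (4 * d)"
  have "A > 0" using h \<open>\<kappa> > 0\<close> d by (simp add: A_def)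
  \<comment> \<open>Chosen so that the terms with ln h and ln 2 cost at most half of \<kappa> |ln
    \<epsilon>| / d; the final 1 makes \<open>X\<close> positive and hence ln \<epsilon>
    negative.\<close>
  define X where "X = \<bar>ln h\<bar> * 2 + ln 2 * (2 * d) / (\<kappa> * (1 + m1)) + 1"
  have "filterlim (\<lambda>\<epsilon>::real. ln \<epsilon>) at_bot (at_right 0)"
    by (rule ln_at_0)
  then have ln_small: "\<forall>\<^sub>F \<epsilon> in at_right 0. ln \<epsilon> \<le> - X"
    by (simp add: filterlim_at_bot)
  have d': "1 / d * (1 / (1 + m1)) > 0" using d m by simp
  have "\<forall>\<^sub>F \<epsilon> in at_right 0.
    ennreal (A * (\<bar>ln \<epsilon>\<bar> * \<epsilon> powr (1 / d))) \<le> emeasure lborel (sublevel \<rho> \<epsilon>)"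
    using ev_powr_less[OF pos(1) d' h] ev_powr_less[OF pos(2) d' h] ln_small
      eventually_at_right_less[of 0]
  proof eventually_elim
    case (elim \<epsilon>)
    define \<tau> where "\<tau> = (h * \<epsilon>) powr (1 / d)"
    have \<tau>: "\<tau> > 0" using h elim by (auto simp: \<tau>_def)
    \<comment> \<open>\<open>l\<close> is the abscissa where x y = \<tau> meets y = x^m2, and
      \<open>u\<close> the one where x y = \<tau> / 2 meets y = x^m1. Between them the strip lies
      between the two curves.\<close>
    define l where "l = \<tau> powr (1 / (1 + m2))"
    define u where "u = (\<tau> / 2) powr (1 / (1 + m1))"
    have lu: "l > 0" "u > 0" using \<tau> by (auto simp: l_def u_def)
    have "u \<le> \<tau> powr (1 / (1 + m1))"
      unfolding u_def using \<tau> m by (intro powr_mono2) auto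
    also have "\<dots> = (h * \<epsilon>) powr (1 / d * (1 / (1 + m1)))"
      unfolding \<tau>_def by (simp add: powr_powr)
    \<comment> \<open>The first bound keeps x in the square where the expansion is valid; the second
      does so for y, because y is at most u^m2.\<close>
    finally have u_small: "u < ?m" "u < ?m powr (1 / m2)"
      using elim by linarith+
    have ln\<tau>: "ln \<tau> = (ln h + ln \<epsilon>) / d"
      using h elim by (simp add: \<tau>_def ln_powr ln_mult)
    have ln_diff: "ln u - ln l = - ln \<tau> * \<kappa> - ln 2 / (1 + m1)"
      using \<tau> by (simp add: u_def l_def ln_powr ln_div \<kappa>_def algebra_simps diff_divide_distrib)
    have ln2: "ln 2 / (1 + m1) > 0" using m by simp
    have neg: "ln \<epsilon> < 0"
    proof -
      have "X > 0" unfolding X_def using d \<open>\<kappa> > 0\<close> m by (intro add_nonneg_pos add_nonneg_nonneg) auto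
      with elim show ?thesis by linarith
    qed
    have ln_ge: "ln u - ln l \<ge> \<bar>ln \<epsilon>\<bar> * (\<kappa> / (2 * d))"
    proof -
      have "\<bar>ln h\<bar> * 2 + ln 2 * (2 * d) / (\<kappa> * (1 + m1)) \<le> \<bar>ln \<epsilon>\<bar>"
        using elim neg by (simp add: X_def)
      then have h1: "(\<bar>ln h\<bar> * 2 + ln 2 * (2 * d) / (\<kappa> * (1 + m1))) * (\<kappa> / (2 * d)) \<le> \<bar>ln \<epsilon>\<bar> * (\<kappa> / (2 * d))"
        using d \<open>\<kappa> > 0\<close> by (intro mult_right_mono) auto
      have "(A * 2 + B * (2 * d) / (\<kappa> * e)) * (\<kappa> / (2 * d)) = A * (\<kappa> / d) + B / e"
        if "e > 0" for A B e
        using d \<open>\<kappa> > 0\<close> that by (simp add: field_simps)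
      from this[of "1 + m1" "\<bar>ln h\<bar>" "ln 2"]
      have h2: "(\<bar>ln h\<bar> * 2 + ln 2 * (2 * d) / (\<kappa> * (1 + m1))) * (\<kappa> / (2 * d))
          = \<bar>ln h\<bar> * (\<kappa> / d) + ln 2 / (1 + m1)"
        using m by simp
      have h3: "ln h * (\<kappa> / d) \<le> \<bar>ln h\<bar> * (\<kappa> / d)"
        using d \<open>\<kappa> > 0\<close> by (intro mult_right_mono) auto
      have h4: "- ln \<tau> * \<kappa> = \<bar>ln \<epsilon>\<bar> * (\<kappa> / (2 * d)) + \<bar>ln \<epsilon>\<bar> * (\<kappa> / (2 * d)) - ln h * (\<kappa> / d)"
        using d neg by (simp add: ln\<tau> field_simps)
      show ?thesis unfolding ln_diff h4 using h1 h2 h3 by linarith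
    qed
    have "0 \<le> \<bar>ln \<epsilon>\<bar> * (\<kappa> / (2 * d))" using d \<open>\<kappa> > 0\<close> by simp
    then have "ln l \<le> ln u" using ln_ge by linarith
    then have "l \<le> u" using lu by simp
    let ?G = "{(x, y). l \<le> x \<and> x \<le> u \<and> \<tau> / 2 \<le> x * y \<and> x * y \<le> \<tau>}"
    have "?G \<subseteq> sublevel \<rho> \<epsilon>"
    proof clarify
      fix x y assume x: "l \<le> x" "x \<le> u" and xy: "\<tau> / 2 \<le> x * y" "x * y \<le> \<tau>"
      have "x > 0" using x lu by linarith
      have x1: "x < 1" using x u_small r by auto
      have "x powr m2 * x \<ge> \<tau>"
      proof -
        have "l powr (1 + m2) \<le> x powr (1 + m2)" using x lu m by (intro powr_mono2) auto
        moreover have "l powr (1 + m2) = \<tau>" using m \<tau> by (simp add: l_def powr_powr)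
        ultimately show ?thesis using \<open>x > 0\<close> by (simp add: powr_add mult.commute)
      qed
      then have "x * y \<le> x * x powr m2" using xy by (simp add: mult.commute)
      then have y2: "y \<le> x powr m2" using \<open>x > 0\<close> by simp
      have "x powr m1 * x \<le> \<tau> / 2"
      proof -
        have "x powr (1 + m1) \<le> u powr (1 + m1)" using x lu m by (intro powr_mono2) auto
        moreover have "u powr (1 + m1) = \<tau> / 2" using m \<tau> by (simp add: u_def powr_powr)
        ultimately show ?thesis using \<open>x > 0\<close> by (simp add: powr_add mult.commute)
      qed
      then have "x * x powr m1 \<le> x * y" using xy by (simp add: mult.commute)
      then have y1: "x powr m1 \<le> y" using \<open>x > 0\<close> by simp
      have "x powr m1 > 0" using \<open>x > 0\<close> by simp
      with y1 have "y > 0" by linarith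
      have "y < ?m"
      proof -
        have "y \<le> u powr m2" using x m \<open>x > 0\<close> by (intro order.trans[OF y2] powr_mono2) auto
        also have "\<dots> < (?m powr (1 / m2)) powr m2"
          using u_small lu m by (intro powr_less_mono2) auto
        also have "\<dots> = ?m" using m pos by (simp add: powr_powr)
        finally show ?thesis .
      qed
      then have small: "\<bar>x\<bar> < ?m" "\<bar>y\<bar> < ?m" using x u_small \<open>x > 0\<close> \<open>y > 0\<close> by auto
      note mon = monomial_le_at_vertex[OF _ _ \<open>x > 0\<close> x1 y1 y2]
      have "d * (1 + m2) \<le> d * (1 + m1)" using d m by simp
      moreover have "m2 * N \<le> m1 * N" using m by (intro mult_right_mono) auto
      ultimately have N3: "d * (1 + m2) \<le> N" "d * (1 + m1) \<le> m1 * N"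
        using N1 N2 by linarith+
      have N4: "d * (1 + m2) \<le> m2 * N"
        by (rule order.trans[OF mult_left_mono N2]) (use d m in auto)
      have "\<bar>F 0 0 (x, y)\<bar> \<le> C * (x * y) powr d"
      proof (rule dom)
        show "\<bar>x\<bar> ^ a * \<bar>y\<bar> ^ b \<le> (x * y) powr d" if "coef a b \<noteq> 0" for a b
          using mon[OF supp(1)[OF that] supp(2)[OF that]] \<open>x > 0\<close> \<open>y > 0\<close> by simp
        show "\<bar>x\<bar> ^ N \<le> (x * y) powr d"
          using mon[of d N 0] N1 N3 \<open>x > 0\<close> by simp
        show "\<bar>y\<bar> ^ N \<le> (x * y) powr d"
          using mon[of d 0 N] N2 N3 N4 \<open>y > 0\<close> by simp
      qed (use small in auto)
      also have "\<dots> \<le> C * \<tau> powr d"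
        using xy r d \<open>x > 0\<close> \<open>y > 0\<close> by (intro mult_left_mono powr_mono2) auto
      also have "\<dots> = C * (h * \<epsilon>)" using d h elim by (simp add: \<tau>_def powr_powr)
      also have "\<dots> < \<epsilon>" using r elim by (simp add: h_def)
      finally show "(x, y) \<in> sublevel \<rho> \<epsilon>"
        using V[of x y] small norm_Pair_lt by (auto simp: sublevel_def)
    qed
    then have "emeasure lborel ?G \<le> emeasure lborel (sublevel \<rho> \<epsilon>)"
      by (rule emeasure_mono[OF _ sublevel_measurable])
    moreover have "ennreal (A * (\<bar>ln \<epsilon>\<bar> * \<epsilon> powr (1 / d))) \<le> ennreal (\<tau> / 2 * (ln u - ln l))"
    proof (rule ennreal_leI)
      have "A * (\<bar>ln \<epsilon>\<bar> * \<epsilon> powr (1 / d)) = \<tau> / 2 * (\<bar>ln \<epsilon>\<bar> * (\<kappa> / (2 * d)))"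
        using h elim by (simp add: A_def \<tau>_def powr_mult)
      also have "\<dots> \<le> \<tau> / 2 * (ln u - ln l)"
        using \<tau> ln_ge by (intro mult_left_mono) auto
      finally show "A * (\<bar>ln \<epsilon>\<bar> * \<epsilon> powr (1 / d)) \<le> \<tau> / 2 * (ln u - ln l)" .
    qed
    ultimately show ?case
      using emeasure_hyperbolic_strip[OF lu(1) \<open>l \<le> u\<close> \<tau>] by simp
  qed
  then show ?thesis using \<open>A > 0\<close> by blast
qed

end

section \<open>Sublevel estimates in one variable\<close>

text \<open>\<open>f\<close> increases at rate at least \<open>L\<close>, so it crosses the band
  from -\<delta> to \<delta> within length 2 \<delta> / L. The interval is longer only because it is
  padded around the supremum \<open>c\<close> of the points where \<open>f\<close> is at most
  -\<delta>.\<close>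

lemma expanding_split:
  fixes f :: "real \<Rightarrow> real"
  assumes "a \<le> b" "\<delta> > 0" "L > 0"
    and deriv: "\<And>t. a \<le> t \<Longrightarrow> t \<le> b \<Longrightarrow> (f has_real_derivative f' t) (at t)"
    and f': "\<And>t. a \<le> t \<Longrightarrow> t \<le> b \<Longrightarrow> f' t \<ge> L"
  obtains c d where "c \<le> d" "d - c = 4 * (\<delta> / L)"
    "\<And>t. a \<le> t \<Longrightarrow> t \<le> b \<Longrightarrow> t \<le> c \<Longrightarrow> f t \<le> - \<delta>"
    "\<And>t. a \<le> t \<Longrightarrow> t \<le> b \<Longrightarrow> d \<le> t \<Longrightarrow> f t \<ge> \<delta>"
proof -
  have expand: "f t - f s \<ge> L * (t - s)" if st: "a \<le> s" "s < t" "t \<le> b" for s t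
  proof -
    obtain z where "s < z" "z < t" "f t - f s = (t - s) * f' z"
      using MVT2[of s t f f'] deriv st by force
    moreover have "(t - s) * L \<le> (t - s) * f' z"
      using f'[of z] st \<open>s < z\<close> \<open>z < t\<close> by (intro mult_left_mono) auto
    ultimately show ?thesis by (simp add: mult.commute)
  qed
  have mono: "f s \<le> f t" if "a \<le> s" "s \<le> t" "t \<le> b" for s t
  proof (cases "s = t")
    case False
    then have "f t - f s \<ge> L * (t - s)" using that by (intro expand) auto
    moreover have "L * (t - s) \<ge> 0" using that \<open>L > 0\<close> by simp
    ultimately show ?thesis by linarith
  qed simp
  \<comment> \<open>Including \<open>a\<close> keeps the set nonempty when f > -\<delta> throughout;
    the first claim is then vacuous.\<close>
  let ?L = "insert a {t \<in> {a..b}. f t \<le> - \<delta>}"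
  define c where "c = Sup ?L"
  have bdd: "bdd_above ?L" by (rule bdd_aboveI[of _ b]) (use \<open>a \<le> b\<close> in auto)
  have ac: "a \<le> c" unfolding c_def by (rule cSup_upper[OF _ bdd]) simp
  have above: "f t > - \<delta>" if "c < t" "t \<le> b" for t
    using cSup_upper[OF _ bdd, of t] that ac unfolding c_def[symmetric] by (auto simp: not_le[symmetric])
  \<comment> \<open>Padding by \<delta> / L on the left makes a point strictly smaller than the
    supremum. On the right one unit reaches a point with f > -\<delta> and two more units gain 2
    \<delta>.\<close>
  show ?thesis
  proof (rule that[of "c - \<delta> / L" "c + 3 * (\<delta> / L)"])
    have "\<delta> / L > 0" using assms by simp
    then show "c - \<delta> / L \<le> c + 3 * (\<delta> / L)" by linarith
    show "f t \<le> - \<delta>" if "a \<le> t" "t \<le> b" "t \<le> c - \<delta> / L" for t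
    proof -
      have "t < c" using that \<open>\<delta> / L > 0\<close> by linarith
      then obtain t' where "t' \<in> ?L" "t < t'"
        using less_cSup_iff[OF _ bdd, of t] by (auto simp: c_def)
      then show ?thesis using that mono[of t t'] by auto
    qed
    show "f t \<ge> \<delta>" if t: "a \<le> t" "t \<le> b" "c + 3 * (\<delta> / L) \<le> t" for t
    proof -
      have "f (c + \<delta> / L) > - \<delta>"
        using t \<open>\<delta> / L > 0\<close> by (intro above) auto
      moreover have "f t - f (c + \<delta> / L) \<ge> L * (t - (c + \<delta> / L))"
        using t ac \<open>\<delta> / L > 0\<close> by (intro expand) auto
      moreover have "L * (t - (c + \<delta> / L)) \<ge> L * (2 * (\<delta> / L))"
        using t \<open>L > 0\<close> by (intro mult_left_mono) auto
      ultimately show ?thesis using \<open>L > 0\<close> by simp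
    qed
  qed (use assms in simp)
qed

text \<open>The van der Corput sublevel estimate. The induction removes an interval of length
  \<open>4 \<delta> / L\<close> off which the derivative of order \<open>k\<close> exceeds \<open>\<delta>\<close>; the choice
  \<open>\<delta> = L (\<epsilon> / L) powr (1 / (k + 1))\<close> balances both contributions.\<close>

lemma sublevel_cover_1d:
  assumes "k \<ge> 1"
  shows "\<exists>C>0. \<forall>(G :: nat \<Rightarrow> real \<Rightarrow> real) a b L \<epsilon>. 
    L > 0 \<longrightarrow> \<epsilon> > 0 \<longrightarrow>
    (\<forall>i<k. \<forall>t\<in>{a..b}. (G i has_real_derivative G (Suc i) t) (at t)) \<longrightarrow>
    (\<forall>t\<in>{a..b}. G k t \<ge> L) \<or> (\<forall>t\<in>{a..b}. G k t \<le> - L) \<longrightarrow>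
    (\<exists>B\<in>sets lborel. {t\<in>{a..b}. \<bar>G 0 t\<bar> < \<epsilon>} \<subseteq> B \<and>
      emeasure lborel B \<le> ennreal (C * (\<epsilon> / L) powr (1 / k)))"
    (is "\<exists>C>0. ?P k C")
proof -
  \<comment> \<open>Replacing \<open>G\<close> by its negative handles a derivative bounded above by
    -L, and a > b is an empty interval. Admitting a > b lets the induction hypothesis be applied to
    both leftover pieces without asking whether they are empty.\<close>
  have pos_case: "?P k C" if pos: "\<And>(G :: nat \<Rightarrow> real \<Rightarrow> real) a b L \<epsilon>. 
    L > 0 \<Longrightarrow> \<epsilon> > 0 \<Longrightarrow> a \<le> b \<Longrightarrow>
    (\<forall>i<k. \<forall>t\<in>{a..b}. (G i has_real_derivative G (Suc i) t) (at t)) \<Longrightarrow>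
    (\<forall>t\<in>{a..b}. G k t \<ge> L) \<Longrightarrow>
    (\<exists>B\<in>sets lborel. {t\<in>{a..b}. \<bar>G 0 t\<bar> < \<epsilon>} \<subseteq> B \<and>
      emeasure lborel B \<le> ennreal (C * (\<epsilon> / L) powr (1 / k)))" for C k
  proof (intro allI impI, goal_cases)
    case (1 G a b L \<epsilon>)
    show ?case
    proof (cases "a \<le> b")
      case False
      then show ?thesis by (intro bexI[of _ "{}"]) auto
    next
      case True
      from 1(4) show ?thesis
      proof
        assume "\<forall>t\<in>{a..b}. L \<le> G k t"
        then show ?thesis using pos 1 True by blast
      next
        assume "\<forall>t\<in>{a..b}. G k t \<le> - L"
        then have "\<forall>t\<in>{a..b}. L \<le> - G k t" by force
        moreover have "\<forall>i<k. \<forall>t\<in>{a..b}. ((\<lambda>t. - G i t) has_real_derivative - G (Suc i) t) (at t)"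
          using 1(3) by (auto intro: DERIV_minus)
        ultimately show ?thesis using pos[of L \<epsilon> a b "\<lambda>i t. - G i t"] 1 True by simp
      qed
    qed
  qed
  show ?thesis
    using \<open>k \<ge> 1\<close>
  proof (induction k rule: dec_induct)
    case base
    have "?P 1 4"
    proof (rule pos_case, goal_cases)
      case (1 G a b L \<epsilon>)
      obtain c d where cd: "c \<le> d" "d - c = 4 * (\<epsilon> / L)"
        "\<And>t. a \<le> t \<Longrightarrow> t \<le> b \<Longrightarrow> t \<le> c \<Longrightarrow> G 0 t \<le> - \<epsilon>"
        "\<And>t. a \<le> t \<Longrightarrow> t \<le> b \<Longrightarrow> d \<le> t \<Longrightarrow> G 0 t \<ge> \<epsilon>"
        using expanding_split[of a b \<epsilon> L "G 0" "G 1" thesis] 1 by auto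
      have "{t \<in> {a..b}. \<bar>G 0 t\<bar> < \<epsilon>} \<subseteq> {c..d}"
        using cd(3,4) by (force simp: not_le[symmetric])
      moreover have "emeasure lborel {c..d} \<le> ennreal (4 * (\<epsilon> / L) powr (1 / real 1))"
        using cd 1 by simp
      ultimately show ?case by (intro bexI[of _ "{c..d}"]) auto
    qed
    then show ?case by (intro exI[of _ 4]) auto
  next
    case (step k)
    from step.IH obtain C where C: "C > 0" "?P k C" by blast
    have "?P (Suc k) (4 + 2 * C)"
    proof (rule pos_case, goal_cases)
      case (1 G a b L \<epsilon>)
      define z where "z = \<epsilon> / L"
      have z: "z > 0" using 1 by (simp add: z_def)
      define w where "w = z powr (1 / Suc k)"
      have w: "w > 0" using z by (simp add: w_def)
      define \<delta> where "\<delta> = L * w"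
      have \<delta>: "\<delta> > 0" using w 1 by (simp add: \<delta>_def)
      have "\<epsilon> / \<delta> = z / w" using 1 by (simp add: \<delta>_def z_def)
      also have "\<dots> = z powr (1 - 1 / Suc k)" using z by (simp add: w_def powr_diff)
      \<comment> \<open>The balance: (1 - 1 / (k + 1)) / k = 1 / (k + 1), so the outer pieces and
        the removed interval all have size of order \<open>w\<close>.\<close>
      also have "\<dots> powr (1 / k) = w"
        using step.hyps by (simp add: w_def powr_powr field_simps)
      finally have \<delta>w: "(\<epsilon> / \<delta>) powr (1 / k) = w" .
      obtain c d where cd: "c \<le> d" "d - c = 4 * (\<delta> / L)"
        "\<And>t. a \<le> t \<Longrightarrow> t \<le> b \<Longrightarrow> t \<le> c \<Longrightarrow> G k t \<le> - \<delta>"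
        "\<And>t. a \<le> t \<Longrightarrow> t \<le> b \<Longrightarrow> d \<le> t \<Longrightarrow> G k t \<ge> \<delta>"
        using expanding_split[of a b \<delta> L "G k" "G (Suc k)" thesis] 1 \<delta> by auto
      have "\<exists>B\<in>sets lborel. {t\<in>{a..min b c}. \<bar>G 0 t\<bar> < \<epsilon>} \<subseteq> B \<and> emeasure lborel B \<le> ennreal (C * w)"
        unfolding \<delta>w[symmetric] using 1 \<delta> cd(3) by (intro C(2)[rule_format]) auto
      then obtain B1 where B1: "B1 \<in> sets lborel" "{t\<in>{a..min b c}. \<bar>G 0 t\<bar> < \<epsilon>} \<subseteq> B1"
        "emeasure lborel B1 \<le> ennreal (C * w)" by blast
      have "\<exists>B\<in>sets lborel. {t\<in>{max a d..b}. \<bar>G 0 t\<bar> < \<epsilon>} \<subseteq> B \<and> emeasure lborel B \<le> ennreal (C * w)"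
        unfolding \<delta>w[symmetric] using 1 \<delta> cd(4) by (intro C(2)[rule_format]) auto
      then obtain B2 where B2: "B2 \<in> sets lborel" "{t\<in>{max a d..b}. \<bar>G 0 t\<bar> < \<epsilon>} \<subseteq> B2"
        "emeasure lborel B2 \<le> ennreal (C * w)" by blast
      let ?B = "{c..d} \<union> B1 \<union> B2"
      have "{t\<in>{a..b}. \<bar>G 0 t\<bar> < \<epsilon>} \<subseteq> ?B"
      proof
        fix t assume "t \<in> {t\<in>{a..b}. \<bar>G 0 t\<bar> < \<epsilon>}"
        then show "t \<in> ?B" using subsetD[OF B1(2), of t] subsetD[OF B2(2), of t]
          by (cases "t \<le> c"; cases "d \<le> t") auto
      qed
      moreover have "emeasure lborel ?B \<le> ennreal ((4 + 2 * C) * (\<epsilon> / L) powr (1 / Suc k))"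
      proof -
        have "emeasure lborel ?B \<le> emeasure lborel ({c..d} \<union> B1) + emeasure lborel B2"
          using B1 B2 by (intro emeasure_subadditive) auto
        also have "\<dots> \<le> (emeasure lborel {c..d} + emeasure lborel B1) + emeasure lborel B2"
          using B1 by (intro add_right_mono emeasure_subadditive) auto
        also have "\<dots> \<le> (ennreal (4 * w) + ennreal (C * w)) + ennreal (C * w)"
          using B1 B2 cd 1 by (intro add_mono) (auto simp: \<delta>_def)
        also have "\<dots> = ennreal ((4 + 2 * C) * w)"
          using C w by (simp add: ennreal_plus[symmetric] algebra_simps del: ennreal_plus)
        finally show ?thesis by (simp add: w_def z_def)
      qed
      ultimately show ?case using B1 B2 by (intro bexI[of _ ?B]) auto
    qed
    then show ?case using C by (intro exI[of _ "4 + 2 * C"]) auto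
  qed
qed

section \<open>Quasihomogeneous rescaling\<close>

context jet
begin

definition leading :: "real \<Rightarrow> real \<Rightarrow> nat \<Rightarrow> nat \<Rightarrow> real" where
  "leading \<alpha> \<beta> a b = (if real a * \<alpha> + real b * \<beta> = 1 then coef a b else 0)"

text \<open>The partial derivative \<open>\<partial>\<^sub>u\<^sup>i \<partial>\<^sub>v\<^sup>j\<close> of the part of the Taylor series supported on the line
  \<open>a \<alpha> + b \<beta> = 1\<close>; the cut-off \<open>N\<close> is harmless once \<open>N \<alpha> > 1\<close> and \<open>N \<beta> > 1\<close>.\<close>

definition qhom :: "real \<Rightarrow> real \<Rightarrow> nat \<Rightarrow> nat \<Rightarrow> nat \<Rightarrow> real \<Rightarrow> real \<Rightarrow> real" where
  "qhom \<alpha> \<beta> N i j u v =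
    (\<Sum>b<N. \<Sum>a<N. leading \<alpha> \<beta> (i + a) (j + b) / (fact a * fact b) * u ^ a * v ^ b)"

text \<open>After rescaling, a monomial carries s to the power (i + a) \<alpha> + (j + b) \<beta> -
  1, which is nonnegative wherever the coefficient survives and zero exactly on the line. The limit
  is taken along sequences with moving u and v, since this is the form that the compactness argument
  needs.\<close>

lemma qhom_limit:
  fixes \<alpha> \<beta> :: real and s u v :: "nat \<Rightarrow> real"
  assumes \<alpha>\<beta>: "\<alpha> > 0" "\<beta> > 0" and N: "N * \<alpha> > 1" "N * \<beta> > 1"
    and supp: "\<And>a b. coef a b \<noteq> 0 \<Longrightarrow> a * \<alpha> + b * \<beta> \<ge> 1"
    and s: "\<And>n. s n > 0" "s \<longlonglongrightarrow> 0" and u: "u \<longlonglongrightarrow> u0" and v: "v \<longlonglongrightarrow> v0"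
  shows "(\<lambda>n. s n powr (i * \<alpha> + j * \<beta> - 1) * F i j (s n powr \<alpha> * u n, s n powr \<beta> * v n))
    \<longlonglongrightarrow> qhom \<alpha> \<beta> N i j u0 v0"
proof -
  obtain r C where r: "0 < r" "r \<le> 1" "0 \<le> C"
    and rem: "\<And>x y. \<bar>x\<bar> \<le> r \<Longrightarrow> \<bar>y\<bar> \<le> r \<Longrightarrow>
      \<bar>F i j (x, y) - (\<Sum>b<N. \<Sum>a<N. coef (i + a) (j + b) / (fact a * fact b) * x ^ a * y ^ b)\<bar>
        \<le> C * (\<bar>x\<bar> ^ N + \<bar>y\<bar> ^ N)"
    using taylor_remainder[of i j N thesis] by blast
  define e where "e = i * \<alpha> + j * \<beta> - 1"
  define x where "x n = s n powr \<alpha> * u n" for n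
  define y where "y n = s n powr \<beta> * v n" for n
  define T where "T n = (\<Sum>b<N. \<Sum>a<N. coef (i + a) (j + b) / (fact a * fact b) * x n ^ a * y n ^ b)" for n
  have spow: "(\<lambda>n. s n powr z) \<longlonglongrightarrow> 0" if "z > 0" for z
    using tendsto_powr'[OF s(2) tendsto_const[of z]] that s(1) by (auto simp: less_imp_le)
  have x0: "x \<longlonglongrightarrow> 0" and y0: "y \<longlonglongrightarrow> 0"
    using tendsto_mult[OF spow[OF \<alpha>\<beta>(1)] u] tendsto_mult[OF spow[OF \<alpha>\<beta>(2)] v]
    by (simp_all add: x_def[abs_def] y_def[abs_def])
  have ij: "i * \<alpha> \<ge> 0" "j * \<beta> \<ge> 0" using \<alpha>\<beta> by auto
  \<comment> \<open>The powers of s carried by the rescaled remainder; positivity makes the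
    remainder disappear in the limit.\<close>
  have eN: "e + N * \<alpha> > 0" "e + N * \<beta> > 0"
    using N ij unfolding e_def by linarith+
  have xn: "s n powr e * \<bar>x n\<bar> ^ N = s n powr (e + N * \<alpha>) * \<bar>u n\<bar> ^ N" for n
    using s(1)[of n] by (simp add: x_def abs_mult power_mult_distrib powr_add powr_powr mult.commute
        flip: powr_realpow[of "s n powr _"])
  have yn: "s n powr e * \<bar>y n\<bar> ^ N = s n powr (e + N * \<beta>) * \<bar>v n\<bar> ^ N" for n
    using s(1)[of n] by (simp add: y_def abs_mult power_mult_distrib powr_add powr_powr mult.commute
        flip: powr_realpow[of "s n powr _"])
  have "(\<lambda>n. C * (s n powr e * \<bar>x n\<bar> ^ N + s n powr e * \<bar>y n\<bar> ^ N)) \<longlonglongrightarrow> C * (0 * \<bar>u0\<bar> ^ N + 0 * \<bar>v0\<bar> ^ N)"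
    unfolding xn yn by (intro tendsto_intros spow eN u v)
  then have bound0: "(\<lambda>n. C * (s n powr e * \<bar>x n\<bar> ^ N + s n powr e * \<bar>y n\<bar> ^ N)) \<longlonglongrightarrow> 0"
    by simp
  have "\<forall>\<^sub>F n in sequentially. \<bar>x n\<bar> < r" "\<forall>\<^sub>F n in sequentially. \<bar>y n\<bar> < r"
    using tendstoD[OF x0 r(1)] tendstoD[OF y0 r(1)] by simp_all
  then have "\<forall>\<^sub>F n in sequentially. norm (s n powr e * F i j (x n, y n) - s n powr e * T n)
      \<le> C * (s n powr e * \<bar>x n\<bar> ^ N + s n powr e * \<bar>y n\<bar> ^ N)"
  proof eventually_elim
    case (elim n)
    have "\<bar>F i j (x n, y n) - T n\<bar> \<le> C * (\<bar>x n\<bar> ^ N + \<bar>y n\<bar> ^ N)"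
      unfolding T_def by (rule rem) (use elim in auto)
    then have "s n powr e * \<bar>F i j (x n, y n) - T n\<bar> \<le> s n powr e * (C * (\<bar>x n\<bar> ^ N + \<bar>y n\<bar> ^ N))"
      by (intro mult_left_mono) auto
    moreover have "norm (s n powr e * F i j (x n, y n) - s n powr e * T n)
        = s n powr e * \<bar>F i j (x n, y n) - T n\<bar>"
      by (simp add: abs_mult flip: right_diff_distrib)
    ultimately show ?case by (simp only: distrib_left mult.left_commute)
  qed
  then have diff: "(\<lambda>n. s n powr e * F i j (x n, y n) - s n powr e * T n) \<longlonglongrightarrow> 0"
    using bound0 by (rule Lim_null_comparison)
  have mono: "(\<lambda>n. coef (i + a) (j + b) / (fact a * fact b) * s n powr ((i + a) * \<alpha> + (j + b) * \<beta> - 1) * u n ^ a * v n ^ b)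
      \<longlonglongrightarrow> leading \<alpha> \<beta> (i + a) (j + b) / (fact a * fact b) * u0 ^ a * v0 ^ b" for a b
  proof -
    let ?z = "(i + a) * \<alpha> + (j + b) * \<beta> - 1"
    consider "coef (i + a) (j + b) = 0" | "?z = 0" | "?z > 0"
      using supp[of "i + a" "j + b"] by linarith
    then have "(\<lambda>n. coef (i + a) (j + b) / (fact a * fact b) * s n powr ?z)
        \<longlonglongrightarrow> leading \<alpha> \<beta> (i + a) (j + b) / (fact a * fact b)"
    proof cases
      case 3
      have "(\<lambda>n. coef (i + a) (j + b) / (fact a * fact b) * s n powr ?z) \<longlonglongrightarrow>
          coef (i + a) (j + b) / (fact a * fact b) * 0"
        by (intro tendsto_intros spow 3)
      with 3 show ?thesis by (simp add: leading_def)
    next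
      case 2
      have "s n powr ?z = 1" for n using s(1)[of n] unfolding 2 by simp
      with 2 show ?thesis by (simp add: leading_def)
    qed (simp add: leading_def)
    then show ?thesis by (intro tendsto_intros u v)
  qed
  have "s n powr e * T n = (\<Sum>b<N. \<Sum>a<N. coef (i + a) (j + b) / (fact a * fact b) *
      s n powr ((i + a) * \<alpha> + (j + b) * \<beta> - 1) * u n ^ a * v n ^ b)" for n
  proof -
    have "s n powr ((i + a) * \<alpha> + (j + b) * \<beta> - 1) =
        s n powr e * (s n powr \<alpha>) ^ a * (s n powr \<beta>) ^ b" for a b
    proof -
      have "(i + a) * \<alpha> + (j + b) * \<beta> - 1 = e + \<alpha> * a + \<beta> * b"
        by (simp add: e_def algebra_simps)
      then show ?thesis
        using s(1)[of n] by (simp add: powr_add powr_powr flip: powr_realpow[of "s n powr _"])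
    qed
    then show ?thesis
      unfolding T_def sum_distrib_left
      by (intro sum.cong refl) (simp only: x_def y_def power_mult_distrib mult_ac)
  qed
  then have "(\<lambda>n. s n powr e * T n) \<longlonglongrightarrow> qhom \<alpha> \<beta> N i j u0 v0"
    unfolding qhom_def using mono by (auto intro!: tendsto_sum)
  from tendsto_add[OF diff this] show ?thesis
    by (simp add: e_def x_def y_def)
qed

text \<open>Bad points tending to the origin are rescaled to the boundary of the unit square and
  have a limit point there. By \<open>qhom_limit\<close> all the pure derivatives of the leading
  part up to order \<open>K\<close> vanish at that limit, against \<open>nz\<close>.\<close>

lemma derivatives_nonvanishing_near_0:
  fixes \<alpha> \<beta> :: real
  assumes \<alpha>\<beta>: "\<alpha> > 0" "\<beta> > 0" and N: "N * \<alpha> > 1" "N * \<beta> > 1"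
    and supp: "\<And>a b. coef a b \<noteq> 0 \<Longrightarrow> a * \<alpha> + b * \<beta> \<ge> 1"
    and nz: "\<And>u v. (u, v) \<noteq> (0, 0) \<Longrightarrow> \<exists>k\<le>K. qhom \<alpha> \<beta> N k 0 u v \<noteq> 0 \<or> qhom \<alpha> \<beta> N 0 k u v \<noteq> 0"
  shows "\<exists>R>0. \<forall>p. norm p \<le> R \<longrightarrow> p \<noteq> 0 \<longrightarrow> p \<in> V \<and> (\<exists>k\<le>K. F k 0 p \<noteq> 0 \<or> F 0 k p \<noteq> 0)"
proof (rule ccontr)
  assume contr: "\<not> ?thesis"
  obtain r where r: "0 < r" "\<And>x y. \<bar>x\<bar> \<le> r \<Longrightarrow> \<bar>y\<bar> \<le> r \<Longrightarrow> (x, y) \<in> V"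
    using square_in_V[of thesis] by blast
  have rV: "p \<in> V" if "norm p \<le> r" for p
    using r(2)[of "fst p" "snd p"] that norm_fst_le[of "fst p" "snd p"] norm_snd_le[of "snd p" "fst p"] by simp
  have "\<exists>p. norm p \<le> min r (1 / Suc n) \<and> p \<noteq> 0 \<and> (\<forall>k\<le>K. F k 0 p = 0 \<and> F 0 k p = 0)" for n
  proof -
    have "min r (1 / Suc n) > 0" using r(1) by simp
    with contr obtain q where "norm q \<le> min r (1 / Suc n)" "q \<noteq> 0"
      "\<not> (q \<in> V \<and> (\<exists>k\<le>K. F k 0 q \<noteq> 0 \<or> F 0 k q \<noteq> 0))" by blast
    moreover from this(1) have "q \<in> V" by (intro rV) simp
    ultimately show ?thesis by blast
  qed
  then obtain p where p: "\<And>n. norm (p n) \<le> min r (1 / Suc n)" "\<And>n. p n \<noteq> 0"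
    and pz: "\<And>n k. k \<le> K \<Longrightarrow> F k 0 (p n) = 0" "\<And>n k. k \<le> K \<Longrightarrow> F 0 k (p n) = 0"
    by metis
  define x where "x n = fst (p n)" for n
  define y where "y n = snd (p n)" for n
  \<comment> \<open>A quasinorm adapted to the dilation; dividing it out makes |u| = 1 or |v| = 1,
    so the limit cannot be the origin.\<close>
  define s where "s n = max (\<bar>x n\<bar> powr (1 / \<alpha>)) (\<bar>y n\<bar> powr (1 / \<beta>))" for n
  define u where "u n = x n / s n powr \<alpha>" for n
  define v where "v n = y n / s n powr \<beta>" for n
  have "p \<longlonglongrightarrow> 0"
  proof (rule Lim_null_comparison)
    show "\<forall>\<^sub>F n in sequentially. norm (p n) \<le> inverse (real (Suc n))"
      using p(1) by (auto simp: divide_inverse)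
  qed (rule LIMSEQ_inverse_real_of_nat)
  then have xy0: "x \<longlonglongrightarrow> 0" "y \<longlonglongrightarrow> 0"
    using tendsto_fst[of p 0] tendsto_snd[of p 0] by (simp_all add: x_def[abs_def] y_def[abs_def])
  have s_pos: "s n > 0" for n
    using p(2)[of n] by (cases "p n") (auto simp: s_def x_def y_def less_max_iff_disj zero_prod_def)
  have "(\<lambda>n. \<bar>x n\<bar> powr (1 / \<alpha>)) \<longlonglongrightarrow> \<bar>0\<bar> powr (1 / \<alpha>)"
    by (rule tendsto_powr'[OF tendsto_rabs[OF xy0(1)] tendsto_const]) (use \<alpha>\<beta> in auto)
  moreover have "(\<lambda>n. \<bar>y n\<bar> powr (1 / \<beta>)) \<longlonglongrightarrow> \<bar>0\<bar> powr (1 / \<beta>)"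
    by (rule tendsto_powr'[OF tendsto_rabs[OF xy0(2)] tendsto_const]) (use \<alpha>\<beta> in auto)
  ultimately have s0: "s \<longlonglongrightarrow> 0"
    using tendsto_max \<alpha>\<beta> unfolding s_def[abs_def] by fastforce
  let ?K = "({-1, 1} \<times> {-1..1}) \<union> ({-1..1} \<times> {-1, 1}) :: (real \<times> real) set"
  have "compact ?K"
    by (intro compact_Un compact_Times finite_imp_compact compact_Icc) auto
  moreover have "(u n, v n) \<in> ?K" for n
  proof -
    have sx: "\<bar>x n\<bar> \<le> s n powr \<alpha>" "\<bar>y n\<bar> \<le> s n powr \<beta>"
      using powr_mono2[of \<alpha> "\<bar>x n\<bar> powr (1 / \<alpha>)" "s n"] powr_mono2[of \<beta> "\<bar>y n\<bar> powr (1 / \<beta>)" "s n"] \<alpha>\<beta>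
      by (auto simp: s_def powr_powr)
    have "\<bar>x n\<bar> = s n powr \<alpha> \<or> \<bar>y n\<bar> = s n powr \<beta>"
      using \<alpha>\<beta> by (auto simp: s_def max_def powr_powr)
    then show ?thesis
      using sx s_pos[of n] by (auto simp: u_def v_def divide_simps abs_le_iff abs_if split: if_splits)
  qed
  ultimately obtain l \<sigma> where l: "l \<in> ?K" and \<sigma>: "strict_mono \<sigma>"
    and lim: "((\<lambda>n. (u n, v n)) \<circ> \<sigma>) \<longlonglongrightarrow> l"
    unfolding compact_def by (metis (no_types, lifting))
  obtain u0 v0 where l_eq: "l = (u0, v0)" by fastforce
  have ul: "(u \<circ> \<sigma>) \<longlonglongrightarrow> u0" and vl: "(v \<circ> \<sigma>) \<longlonglongrightarrow> v0"
    using tendsto_fst[OF lim] tendsto_snd[OF lim] by (simp_all add: l_eq o_def)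
  have sl: "(s \<circ> \<sigma>) \<longlonglongrightarrow> 0" by (rule LIMSEQ_subseq_LIMSEQ[OF s0 \<sigma>])
  have p_eq: "(s n powr \<alpha> * u n, s n powr \<beta> * v n) = p n" for n
    using s_pos[of n] by (simp add: u_def v_def x_def y_def)
  have "qhom \<alpha> \<beta> N k 0 u0 v0 = 0 \<and> qhom \<alpha> \<beta> N 0 k u0 v0 = 0" if "k \<le> K" for k
  proof -
    note qhom_limit[OF \<alpha>\<beta> N supp, of "s \<circ> \<sigma>" "u \<circ> \<sigma>" u0 "v \<circ> \<sigma>" v0]
    from this[of k 0] this[of 0 k] s_pos sl ul vl pz[OF that] show ?thesis
      by (simp add: p_eq LIMSEQ_const_iff)
  qed
  moreover have "(u0, v0) \<noteq> (0, 0)" using l by (auto simp: l_eq)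
  ultimately show False using nz by blast
qed

end

section \<open>Sublevel estimates in the plane\<close>

lemma emeasure_le_vertical_slices:
  fixes E :: "(real \<times> real) set"
  assumes E: "E \<in> sets lborel" and "h \<ge> 0"
    and slices: "\<And>x. x \<in> {x0 - h..x0 + h} \<Longrightarrow> emeasure lborel (Pair x -` E) \<le> ennreal m"
    and outside: "\<And>x y. (x, y) \<in> E \<Longrightarrow> x \<in> {x0 - h..x0 + h}"
  shows "emeasure lborel E \<le> ennreal (2 * h) * ennreal m"
proof -
  have E': "E \<in> sets (lborel \<Otimes>\<^sub>M lborel)" using E by (simp only: lborel_prod)
  have "emeasure lborel E = (\<integral>\<^sup>+x. emeasure lborel (Pair x -` E) \<partial>lborel)"
    using lborel.emeasure_pair_measure_alt[OF E'] by (simp only: lborel_prod)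
  also have "\<dots> \<le> (\<integral>\<^sup>+x. ennreal m * indicator {x0 - h..x0 + h} x \<partial>lborel)"
  proof (rule nn_integral_mono)
    fix x
    show "emeasure lborel (Pair x -` E) \<le> ennreal m * indicator {x0 - h..x0 + h} x"
    proof (cases "x \<in> {x0 - h..x0 + h}")
      case False
      then have "Pair x -` E = {}" using outside by blast
      then show ?thesis by simp
    qed (use slices in simp)
  qed
  also have "\<dots> = ennreal m * ennreal (2 * h)"
    using \<open>h \<ge> 0\<close> by (simp add: nn_integral_cmult)
  finally show ?thesis by (simp add: mult.commute)
qed

lemma emeasure_le_horizontal_slices:
  fixes E :: "(real \<times> real) set"
  assumes E: "E \<in> sets lborel" and "h \<ge> 0"
    and slices: "\<And>y. y \<in> {y0 - h..y0 + h} \<Longrightarrow> emeasure lborel ((\<lambda>x. (x, y)) -` E) \<le> ennreal m"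
    and outside: "\<And>x y. (x, y) \<in> E \<Longrightarrow> y \<in> {y0 - h..y0 + h}"
  shows "emeasure lborel E \<le> ennreal (2 * h) * ennreal m"
proof -
  have E': "E \<in> sets (lborel \<Otimes>\<^sub>M lborel)" using E by (simp only: lborel_prod)
  have "emeasure lborel E = (\<integral>\<^sup>+y. emeasure lborel ((\<lambda>x. (x, y)) -` E) \<partial>lborel)"
    using lborel_pair.emeasure_pair_measure_alt2[OF E'] by (simp only: lborel_prod)
  also have "\<dots> \<le> (\<integral>\<^sup>+y. ennreal m * indicator {y0 - h..y0 + h} y \<partial>lborel)"
  proof (rule nn_integral_mono)
    fix y
    show "emeasure lborel ((\<lambda>x. (x, y)) -` E) \<le> ennreal m * indicator {y0 - h..y0 + h} y"
    proof (cases "y \<in> {y0 - h..y0 + h}")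
      case False
      then have "(\<lambda>x. (x, y)) -` E = {}" using outside by blast
      then show ?thesis by simp
    qed (use slices in simp)
  qed
  also have "\<dots> = ennreal m * ennreal (2 * h)"
    using \<open>h \<ge> 0\<close> by (simp add: nn_integral_cmult)
  finally show ?thesis by (simp add: mult.commute)
qed

lemma nonzero_on_square:
  fixes f :: "real \<times> real \<Rightarrow> real"
  assumes "open V" "continuous_on V f" "(x0, y0) \<in> V" "f (x0, y0) \<noteq> 0"
  obtains h L where "h > 0" "L > 0" "\<And>x y. \<bar>x - x0\<bar> \<le> h \<Longrightarrow> \<bar>y - y0\<bar> \<le> h \<Longrightarrow> (x, y) \<in> V"
    "(\<forall>x y. \<bar>x - x0\<bar> \<le> h \<longrightarrow> \<bar>y - y0\<bar> \<le> h \<longrightarrow> f (x, y) \<ge> L) \<or>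
     (\<forall>x y. \<bar>x - x0\<bar> \<le> h \<longrightarrow> \<bar>y - y0\<bar> \<le> h \<longrightarrow> f (x, y) \<le> - L)"
proof -
  define L where "L = \<bar>f (x0, y0)\<bar> / 2"
  have L: "L > 0" using assms by (simp add: L_def)
  let ?W = "V \<inter> f -` {f (x0, y0) - L<..<f (x0, y0) + L}"
  have "open ?W" using assms by (intro continuous_open_preimage) auto
  moreover have "(x0, y0) \<in> ?W" using assms L by auto
  ultimately obtain h where h: "h > 0" "\<And>x y. \<bar>x - x0\<bar> \<le> h \<Longrightarrow> \<bar>y - y0\<bar> \<le> h \<Longrightarrow> (x, y) \<in> ?W"
    using square_in_open[of ?W x0 y0 thesis] by blast
  have near: "f (x0, y0) - L < f (x, y) \<and> f (x, y) < f (x0, y0) + L"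
    if "\<bar>x - x0\<bar> \<le> h" "\<bar>y - y0\<bar> \<le> h" for x y
    using h(2)[OF that] by simp
  show ?thesis
  proof (rule that[OF h(1) L])
    show "(\<forall>x y. \<bar>x - x0\<bar> \<le> h \<longrightarrow> \<bar>y - y0\<bar> \<le> h \<longrightarrow> f (x, y) \<ge> L) \<or>
     (\<forall>x y. \<bar>x - x0\<bar> \<le> h \<longrightarrow> \<bar>y - y0\<bar> \<le> h \<longrightarrow> f (x, y) \<le> - L)"
    proof (cases "f (x0, y0) > 0")
      case True
      then have "f (x0, y0) - L = L" by (simp add: L_def)
      with near show ?thesis by fastforce
    next
      case False
      then have "f (x0, y0) + L = - L" by (simp add: L_def)
      with near show ?thesis by fastforce
    qed
  qed (use h in blast)
qed

context jet
begin

text \<open>The sublevel estimate as a property of open sets, with constants depending on the set.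
  In this form it passes to finite unions, hence from points to compact sets.\<close>

definition thin :: "nat \<Rightarrow> (real \<times> real) set \<Rightarrow> bool" where
  "thin K W \<longleftrightarrow> open W \<and> W \<subseteq> V \<and> (\<exists>C\<ge>0. \<exists>\<epsilon>0>0. \<forall>\<epsilon>. 0 < \<epsilon> \<longrightarrow> \<epsilon> < \<epsilon>0 \<longrightarrow>
     emeasure lborel {q \<in> W. \<bar>F 0 0 q\<bar> < \<epsilon>} \<le> ennreal (C * \<epsilon> powr (1 / K)))"

lemma open_sublevel_in: "open W \<Longrightarrow> W \<subseteq> V \<Longrightarrow> open {q \<in> W. \<bar>F 0 0 q\<bar> < \<epsilon>}"
proof -
  assume W: "open W" "W \<subseteq> V"
  then have "open (W \<inter> F 0 0 -` {-\<epsilon><..<\<epsilon>})"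
    using F_cont by (intro continuous_open_preimage) (auto intro: continuous_on_subset)
  moreover have "W \<inter> F 0 0 -` {-\<epsilon><..<\<epsilon>} = {q \<in> W. \<bar>F 0 0 q\<bar> < \<epsilon>}"
    by (auto simp: abs_less_iff)
  ultimately show ?thesis by simp
qed

text \<open>A pure derivative that is nonzero at \<open>p\<close> keeps its sign and stays away from
  0 on a square. The one-variable estimate holds uniformly on the lines in that direction, and
  Tonelli's theorem integrates it over the other variable.\<close>

lemma thin_neighbourhood:
  assumes p: "p \<in> V" and "k \<le> K" "K \<ge> 1" and nz: "F k 0 p \<noteq> 0 \<or> F 0 k p \<noteq> 0"
  shows "\<exists>W. p \<in> W \<and> thin K W"
proof -
  obtain x0 y0 where p_eq: "p = (x0, y0)" by fastforce
  obtain i j where ij: "F i j p \<noteq> 0" "(i = k \<and> j = 0) \<or> (i = 0 \<and> j = k)"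
    using nz by blast
  obtain h L where h: "h > 0" "L > 0" and V: "\<And>x y. \<bar>x - x0\<bar> \<le> h \<Longrightarrow> \<bar>y - y0\<bar> \<le> h \<Longrightarrow> (x, y) \<in> V"
    and L: "(\<forall>x y. \<bar>x - x0\<bar> \<le> h \<longrightarrow> \<bar>y - y0\<bar> \<le> h \<longrightarrow> F i j (x, y) \<ge> L) \<or>
     (\<forall>x y. \<bar>x - x0\<bar> \<le> h \<longrightarrow> \<bar>y - y0\<bar> \<le> h \<longrightarrow> F i j (x, y) \<le> - L)"
    using nonzero_on_square[OF open_V F_cont p[unfolded p_eq] ij(1)[unfolded p_eq], of thesis] by blast
  define W where "W = {x0 - h<..<x0 + h} \<times> {y0 - h<..<y0 + h}"
  have W: "open W" "p \<in> W" using h by (auto simp: W_def p_eq open_Times)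
  have W_sub: "\<bar>x - x0\<bar> \<le> h \<and> \<bar>y - y0\<bar> \<le> h" if "(x, y) \<in> W" for x y
    using that by (auto simp: W_def)
  then have "W \<subseteq> V" using V by auto
  let ?E = "\<lambda>\<epsilon>. {q \<in> W. \<bar>F 0 0 q\<bar> < \<epsilon>}"
  have E: "?E \<epsilon> \<in> sets lborel" for \<epsilon>
    using open_sublevel_in[OF W(1) \<open>W \<subseteq> V\<close>] by simp
  show ?thesis
  \<comment> \<open>For order 0 the function itself is bounded away from 0 on the square, and small
    sublevel sets are empty there.\<close>
  proof (cases "k = 0")
    case True
    then have "i = 0" "j = 0" using ij by auto
    have empty: "?E \<epsilon> = {}" if "\<epsilon> < L" for \<epsilon>
      using L W_sub that h unfolding \<open>i = 0\<close> \<open>j = 0\<close> by fastforce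
    then have "thin K W"
      unfolding thin_def using W \<open>W \<subseteq> V\<close> h
      by (intro conjI exI[of _ 0] exI[of _ L] allI impI) (simp_all only: empty, simp_all)
    with W show ?thesis by blast
  next
    case False
    then have "k \<ge> 1" by simp
    then obtain C where "C > 0" and C: "\<forall>(G :: nat \<Rightarrow> real \<Rightarrow> real) a b L \<epsilon>.
      L > 0 \<longrightarrow> \<epsilon> > 0 \<longrightarrow>
      (\<forall>i<k. \<forall>t\<in>{a..b}. (G i has_real_derivative G (Suc i) t) (at t)) \<longrightarrow>
      (\<forall>t\<in>{a..b}. G k t \<ge> L) \<or> (\<forall>t\<in>{a..b}. G k t \<le> - L) \<longrightarrow>
      (\<exists>B\<in>sets lborel. {t\<in>{a..b}. \<bar>G 0 t\<bar> < \<epsilon>} \<subseteq> B \<and>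
        emeasure lborel B \<le> ennreal (C * (\<epsilon> / L) powr (1 / k)))"
      using sublevel_cover_1d[of k] by blast
    have bound: "emeasure lborel (?E \<epsilon>) \<le> ennreal (2 * h) * ennreal (C * (\<epsilon> / L) powr (1 / k))"
      if "\<epsilon> > 0" for \<epsilon>
      using ij(2)
    proof
      assume k: "i = 0 \<and> j = k"
      show ?thesis
      proof (rule emeasure_le_vertical_slices[OF E])
        fix x assume x: "x \<in> {x0 - h..x0 + h}"
        then have xh: "\<bar>x - x0\<bar> \<le> h" by auto
        have "\<exists>B\<in>sets lborel. {t\<in>{y0 - h..y0 + h}. \<bar>F 0 0 (x, t)\<bar> < \<epsilon>} \<subseteq> B \<and>
          emeasure lborel B \<le> ennreal (C * (\<epsilon> / L) powr (1 / k))"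
        proof (rule C[THEN spec, THEN spec, THEN spec, THEN spec, THEN spec, THEN mp, THEN mp, THEN mp, THEN mp,
              of L \<epsilon> _ _ "\<lambda>i t. F 0 i (x, t)", OF h(2) that])
          show "\<forall>i<k. \<forall>t\<in>{y0 - h..y0 + h}. ((\<lambda>t. F 0 i (x, t)) has_real_derivative F 0 (Suc i) (x, t)) (at t)"
            using V[OF xh] by (auto intro!: F_dy)
          show "(\<forall>t\<in>{y0 - h..y0 + h}. L \<le> F 0 k (x, t)) \<or> (\<forall>t\<in>{y0 - h..y0 + h}. F 0 k (x, t) \<le> - L)"
            using L k xh by (auto simp: abs_le_iff)
        qed
        then obtain B where B: "B \<in> sets lborel" "{t\<in>{y0 - h..y0 + h}. \<bar>F 0 0 (x, t)\<bar> < \<epsilon>} \<subseteq> B"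
          "emeasure lborel B \<le> ennreal (C * (\<epsilon> / L) powr (1 / k))" by blast
        have "Pair x -` ?E \<epsilon> \<subseteq> B" using B(2) by (auto simp: W_def)
        then show "emeasure lborel (Pair x -` ?E \<epsilon>) \<le> ennreal (C * (\<epsilon> / L) powr (1 / k))"
          using emeasure_mono[OF _ B(1)] B(3) order.trans by blast
      qed (use h W_sub in \<open>auto simp: W_def\<close>)
    next
      assume k: "i = k \<and> j = 0"
      show ?thesis
      proof (rule emeasure_le_horizontal_slices[OF E])
        fix y assume y: "y \<in> {y0 - h..y0 + h}"
        then have yh: "\<bar>y - y0\<bar> \<le> h" by auto
        have "\<exists>B\<in>sets lborel. {t\<in>{x0 - h..x0 + h}. \<bar>F 0 0 (t, y)\<bar> < \<epsilon>} \<subseteq> B \<and>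
          emeasure lborel B \<le> ennreal (C * (\<epsilon> / L) powr (1 / k))"
        proof (rule C[THEN spec, THEN spec, THEN spec, THEN spec, THEN spec, THEN mp, THEN mp, THEN mp, THEN mp,
              of L \<epsilon> _ _ "\<lambda>i t. F i 0 (t, y)", OF h(2) that])
          show "\<forall>i<k. \<forall>t\<in>{x0 - h..x0 + h}. ((\<lambda>t. F i 0 (t, y)) has_real_derivative F (Suc i) 0 (t, y)) (at t)"
            using V[OF _ yh] by (auto intro!: F_dx)
          show "(\<forall>t\<in>{x0 - h..x0 + h}. L \<le> F k 0 (t, y)) \<or> (\<forall>t\<in>{x0 - h..x0 + h}. F k 0 (t, y) \<le> - L)"
            using L k yh by (auto simp: abs_le_iff)
        qed
        then obtain B where B: "B \<in> sets lborel" "{t\<in>{x0 - h..x0 + h}. \<bar>F 0 0 (t, y)\<bar> < \<epsilon>} \<subseteq> B"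
          "emeasure lborel B \<le> ennreal (C * (\<epsilon> / L) powr (1 / k))" by blast
        have "(\<lambda>x. (x, y)) -` ?E \<epsilon> \<subseteq> B" using B(2) by (auto simp: W_def)
        then show "emeasure lborel ((\<lambda>x. (x, y)) -` ?E \<epsilon>) \<le> ennreal (C * (\<epsilon> / L) powr (1 / k))"
          using emeasure_mono[OF _ B(1)] B(3) order.trans by blast
      qed (use h W_sub in \<open>auto simp: W_def\<close>)
    qed
    define C' where "C' = 2 * h * C / L powr (1 / k)"
    have "C' \<ge> 0" using h \<open>C > 0\<close> by (simp add: C'_def)
    have "emeasure lborel (?E \<epsilon>) \<le> ennreal (C' * \<epsilon> powr (1 / K))" if "0 < \<epsilon>" "\<epsilon> < 1" for \<epsilon>
    proof -
      have "1 / real K \<le> 1 / real k" using \<open>k \<le> K\<close> \<open>k \<ge> 1\<close> by (simp add: frac_le)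
      \<comment> \<open>For \<epsilon> < 1 a lower order of differentiation gives a better bound, so
        every order up to \<open>K\<close> may be recorded as \<open>K\<close>.\<close>
      then have "\<epsilon> powr (1 / k) \<le> \<epsilon> powr (1 / K)" using that by (intro powr_mono') auto
      then have le: "C' * \<epsilon> powr (1 / k) \<le> C' * \<epsilon> powr (1 / K)"
        using \<open>C' \<ge> 0\<close> by (rule mult_left_mono)
      have "emeasure lborel (?E \<epsilon>) \<le> ennreal (2 * h) * ennreal (C * (\<epsilon> / L) powr (1 / k))"
        by (rule bound[OF that(1)])
      also have "\<dots> = ennreal (C' * \<epsilon> powr (1 / k))"
        using h \<open>C > 0\<close> that by (subst ennreal_mult[symmetric]) (auto simp: C'_def powr_divide)
      also have "\<dots> \<le> ennreal (C' * \<epsilon> powr (1 / K))"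
        by (rule ennreal_leI[OF le])
      finally show ?thesis .
    qed
    then have "thin K W"
      unfolding thin_def using W \<open>W \<subseteq> V\<close> \<open>C' \<ge> 0\<close> by (intro conjI exI[of _ C'] exI[of _ 1]) auto
    with W show ?thesis by blast
  qed
qed

lemma thin_empty: "thin K {}"
  by (auto simp: thin_def intro!: exI[of _ 0] exI[of _ 1])

lemma thin_Un:
  assumes "thin K W" "thin K W'"
  shows "thin K (W \<union> W')"
proof -
  obtain C e where C: "C \<ge> 0" "e > 0" "\<And>\<epsilon>. 0 < \<epsilon> \<Longrightarrow> \<epsilon> < e \<Longrightarrow>
     emeasure lborel {q \<in> W. \<bar>F 0 0 q\<bar> < \<epsilon>} \<le> ennreal (C * \<epsilon> powr (1 / K))"
    using assms(1) unfolding thin_def by blast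
  obtain C' e' where C': "C' \<ge> 0" "e' > 0" "\<And>\<epsilon>. 0 < \<epsilon> \<Longrightarrow> \<epsilon> < e' \<Longrightarrow>
     emeasure lborel {q \<in> W'. \<bar>F 0 0 q\<bar> < \<epsilon>} \<le> ennreal (C' * \<epsilon> powr (1 / K))"
    using assms(2) unfolding thin_def by blast
  have W: "open W" "W \<subseteq> V" "open W'" "W' \<subseteq> V" using assms by (auto simp: thin_def)
  have "emeasure lborel {q \<in> W \<union> W'. \<bar>F 0 0 q\<bar> < \<epsilon>} \<le> ennreal ((C + C') * \<epsilon> powr (1 / K))"
    if "0 < \<epsilon>" "\<epsilon> < min e e'" for \<epsilon>
  proof -
    have "{q \<in> W \<union> W'. \<bar>F 0 0 q\<bar> < \<epsilon>} = {q \<in> W. \<bar>F 0 0 q\<bar> < \<epsilon>} \<union> {q \<in> W'. \<bar>F 0 0 q\<bar> < \<epsilon>}"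
      by auto
    also have "emeasure lborel \<dots> \<le> emeasure lborel {q \<in> W. \<bar>F 0 0 q\<bar> < \<epsilon>} + emeasure lborel {q \<in> W'. \<bar>F 0 0 q\<bar> < \<epsilon>}"
      using W by (intro emeasure_subadditive) (simp_all add: open_sublevel_in)
    also have "\<dots> \<le> ennreal (C * \<epsilon> powr (1 / K)) + ennreal (C' * \<epsilon> powr (1 / K))"
      using that by (intro add_mono C C') auto
    also have "\<dots> = ennreal ((C + C') * \<epsilon> powr (1 / K))"
      using C C' by (simp add: ennreal_plus[symmetric] algebra_simps del: ennreal_plus)
    finally show ?thesis .
  qed
  then show ?thesis
    unfolding thin_def using W C C' by (intro conjI exI[of _ "C + C'"] exI[of _ "min e e'"]) auto
qed

lemma thin_compact_cover:
  assumes "compact Z" and "\<And>p. p \<in> Z \<Longrightarrow> \<exists>W. p \<in> W \<and> thin K W"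
  shows "\<exists>W. Z \<subseteq> W \<and> thin K W"
proof -
  let ?C = "{W. thin K W}"
  have "\<And>W. W \<in> ?C \<Longrightarrow> open W" by (simp add: thin_def)
  moreover have "Z \<subseteq> \<Union>?C" using assms(2) by auto
  ultimately obtain D where D: "D \<subseteq> ?C" "finite D" "Z \<subseteq> \<Union>D"
    using compactE[OF assms(1)] by metis
  have "thin K (\<Union>D)" using D(2,1)
    by (induction D rule: finite_induct) (auto intro: thin_empty thin_Un)
  with D show ?thesis by blast
qed

text \<open>The zero set lies in every sublevel set, whose measure tends to 0 with
  \<epsilon>.\<close>

lemma thin_zero_set:
  assumes "thin K W" "K \<ge> 1"
  shows "{q \<in> W. F 0 0 q = 0} \<in> null_sets lborel"
proof -
  obtain C e where C: "C \<ge> 0" "e > 0" "\<And>\<epsilon>. 0 < \<epsilon> \<Longrightarrow> \<epsilon> < e \<Longrightarrow>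
     emeasure lborel {q \<in> W. \<bar>F 0 0 q\<bar> < \<epsilon>} \<le> ennreal (C * \<epsilon> powr (1 / K))"
    using assms(1) unfolding thin_def by blast
  have W: "open W" "W \<subseteq> V" using assms by (auto simp: thin_def)
  have "{q \<in> W. F 0 0 q = 0} = W - (W \<inter> F 0 0 -` (- {0}))" by auto
  moreover have "open (W \<inter> F 0 0 -` (- {0}))"
    using W F_cont by (intro continuous_open_preimage) (auto intro: continuous_on_subset)
  ultimately have meas: "{q \<in> W. F 0 0 q = 0} \<in> sets lborel"
    using W by (simp add: sets.Diff)
  have "((\<lambda>\<epsilon>. C * \<epsilon> powr (1 / K)) \<longlongrightarrow> C * 0 powr (1 / K)) (at_right 0)"
    using \<open>K \<ge> 1\<close> eventually_at_right_less[of "0::real"]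
    by (intro tendsto_intros tendsto_powr') (auto elim: eventually_mono)
  then have lim: "((\<lambda>\<epsilon>. ennreal (C * \<epsilon> powr (1 / K))) \<longlongrightarrow> 0) (at_right 0)"
    using tendsto_ennrealI by fastforce
  have "emeasure lborel {q \<in> W. F 0 0 q = 0} \<le> 0"
  proof (rule tendsto_lowerbound[OF lim])
    have "\<forall>\<^sub>F \<epsilon> in at_right 0. \<epsilon> < e" using \<open>e > 0\<close> by (rule eventually_at_right_real[THEN eventually_mono]) auto
    then show "\<forall>\<^sub>F \<epsilon> in at_right 0. emeasure lborel {q \<in> W. F 0 0 q = 0} \<le> ennreal (C * \<epsilon> powr (1 / K))"
      using eventually_at_right_less[of "0::real"]
    proof eventually_elim
      case (elim \<epsilon>)
      have "emeasure lborel {q \<in> W. F 0 0 q = 0} \<le> emeasure lborel {q \<in> W. \<bar>F 0 0 q\<bar> < \<epsilon>}"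
        using elim open_sublevel_in[OF W] by (intro emeasure_mono) auto
      then show ?case using C(3)[of \<epsilon>] elim by (meson order.trans)
    qed
  qed simp
  then show ?thesis using meas by (simp add: null_setsI)
qed

end

section \<open>Integrals against test functions\<close>

lemma supp_zero: "p \<notin> supp \<phi> \<Longrightarrow> \<phi> p = 0"
  using closure_subset[of "{x. \<phi> x \<noteq> 0}"] unfolding supp_def by blast

lemma continuous_compact_supp_integrable:
  fixes \<phi> :: "real \<times> real \<Rightarrow> real"
  assumes "continuous_on UNIV \<phi>" "compact (supp \<phi>)"
  shows "integrable lborel \<phi>"
proof -
  have eq: "(\<lambda>p. indicator (supp \<phi>) p *\<^sub>R \<phi> p) = \<phi>"
  proof
    fix p show "indicator (supp \<phi>) p *\<^sub>R \<phi> p = \<phi> p"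
      using supp_zero[of p \<phi>] by (cases "p \<in> supp \<phi>") simp_all
  qed
  have "integrable lborel (\<lambda>p. indicator (supp \<phi>) p *\<^sub>R \<phi> p)"
    using assms by (intro borel_integrable_compact) (auto intro: continuous_on_subset)
  then show ?thesis unfolding eq .
qed

lemma continuous_compact_supp_bounded:
  fixes \<phi> :: "real \<times> real \<Rightarrow> real"
  assumes "continuous_on UNIV \<phi>" "compact (supp \<phi>)"
  obtains M where "M > 0" "\<And>p. \<bar>\<phi> p\<bar> \<le> M"
proof -
  have "compact (\<phi> ` supp \<phi>)"
    using assms by (intro compact_continuous_image) (auto intro: continuous_on_subset)
  then have "bounded (\<phi> ` supp \<phi>)" by (rule compact_imp_bounded)
  then obtain M where M: "\<forall>z\<in>\<phi> ` supp \<phi>. \<bar>z\<bar> \<le> M"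
    unfolding bounded_real by (elim exE)
  have "\<bar>\<phi> p\<bar> \<le> max M 1" for p
    using M supp_zero[of p \<phi>] by (cases "p \<in> supp \<phi>") (auto simp: le_max_iff_disj)
  then show ?thesis by (intro that[of "max M 1"]) auto
qed

lemma positive_near_origin:
  fixes \<psi> :: "real \<times> real \<Rightarrow> real"
  assumes "continuous_on UNIV \<psi>" "\<psi> 0 > 0" "R > 0"
  obtains \<rho> where "0 < \<rho>" "\<rho> \<le> R" "\<And>p. norm p < \<rho> \<Longrightarrow> \<psi> p \<ge> \<psi> 0 / 2"
proof -
  have "open (\<psi> -` {\<psi> 0 / 2<..})"
    using assms(1) by (intro open_vimage) auto
  moreover have "0 \<in> \<psi> -` {\<psi> 0 / 2<..}" using assms(2) by simp
  ultimately obtain r where r: "r > 0" "ball 0 r \<subseteq> \<psi> -` {\<psi> 0 / 2<..}"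
    by (rule openE)
  have "\<psi> p \<ge> \<psi> 0 / 2" if "norm p < min r R" for p
  proof -
    have "p \<in> \<psi> -` {\<psi> 0 / 2<..}" by (rule subsetD[OF r(2)]) (use that in simp)
    then show ?thesis by auto
  qed
  then show ?thesis using r assms by (intro that[of "min r R"]) auto
qed

section \<open>From areas of sublevel sets to integrals against test functions\<close>

context jet
begin

lemma zero_in_V [simp]: "0 \<in> V"
  using zero_V by (simp add: zero_prod_def)

definition finite_type :: "nat \<Rightarrow> real \<Rightarrow> bool" where
  "finite_type K R \<longleftrightarrow> K \<ge> 1 \<and> R > 0 \<and>
    (\<forall>p. norm p \<le> R \<longrightarrow> p \<noteq> 0 \<longrightarrow> p \<in> V \<and> (\<exists>k\<le>K. F k 0 p \<noteq> 0 \<or> F 0 k p \<noteq> 0))"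

lemma finite_type_subset: "finite_type K R \<Longrightarrow> norm p \<le> R \<Longrightarrow> p \<in> V"
  unfolding finite_type_def by (metis zero_in_V)

lemma finite_type_thin:
  assumes "finite_type K R" "compact Z" "\<And>p. p \<in> Z \<Longrightarrow> norm p \<le> R" "0 \<notin> Z"
  shows "\<exists>W. Z \<subseteq> W \<and> thin K W"
proof (rule thin_compact_cover[OF assms(2)])
  fix p assume "p \<in> Z"
  then have "p \<in> V" "\<exists>k\<le>K. F k 0 p \<noteq> 0 \<or> F 0 k p \<noteq> 0"
    using assms unfolding finite_type_def by metis+
  then show "\<exists>W. p \<in> W \<and> thin K W"
    using thin_neighbourhood assms(1) unfolding finite_type_def by blast
qed

text \<open>Estimates are available only on compact sets away from the origin, so the punctured ball
  is exhausted by countably many annuli; the origin is a null set by itself.\<close>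

lemma finite_type_zero_set:
  assumes ft: "finite_type K R"
  shows "{p \<in> ball 0 R. F 0 0 p = 0} \<in> null_sets lborel"
proof -
  let ?Z = "\<lambda>n. cball 0 R - ball 0 (inverse (real (Suc n))) :: (real \<times> real) set"
  have "\<exists>W. ?Z n \<subseteq> W \<and> thin K W" for n
    by (rule finite_type_thin[OF ft]) (auto intro: compact_diff)
  then obtain W where W: "\<And>n. ?Z n \<subseteq> W n" "\<And>n. thin K (W n)" by metis
  have "K \<ge> 1" using ft by (simp add: finite_type_def)
  have null: "{0} \<union> (\<Union>n. {q \<in> W n. F 0 0 q = 0}) \<in> null_sets lborel"
    using thin_zero_set[OF W(2) \<open>K \<ge> 1\<close>] by (intro null_sets.Un null_sets_UN) auto
  have "{p \<in> ball 0 R. F 0 0 p = 0} \<subseteq> {0} \<union> (\<Union>n. {q \<in> W n. F 0 0 q = 0})"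
  proof
    fix p assume p: "p \<in> {p \<in> ball 0 R. F 0 0 p = 0}"
    show "p \<in> {0} \<union> (\<Union>n. {q \<in> W n. F 0 0 q = 0})"
    proof (cases "p = 0")
      case False
      then obtain n where "inverse (real (Suc n)) < norm p"
        using reals_Archimedean[of "norm p"] by auto
      then have "p \<in> ?Z n" using p by auto
      then show ?thesis using W(1) p by blast
    qed simp
  qed
  moreover have "{p \<in> ball 0 R. F 0 0 p = 0} \<in> sets lborel"
  proof -
    have "open (ball 0 R \<inter> F 0 0 -` (- {0}))"
      using finite_type_subset[OF ft]
      by (intro continuous_open_preimage continuous_on_subset[OF F_cont]) auto
    moreover have "{p \<in> ball 0 R. F 0 0 p = 0} = ball 0 R - (ball 0 R \<inter> F 0 0 -` (- {0}))" by auto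
    ultimately show ?thesis by (simp add: sets.Diff)
  qed
  ultimately show ?thesis by (intro null_sets_subset[OF null])
qed

text \<open>The two one-sided integrals together miss only the points with S = 0, a null set in the
  ball. Outside the ball \<phi> vanishes, so the values of \<open>F\<close> beyond \<open>V\<close>
  have no influence.\<close>

lemma abs_level_integral_eq:
  assumes ft: "finite_type K R"
    and \<phi>: "continuous_on UNIV \<phi>" "compact (supp \<phi>)" "supp \<phi> \<subseteq> ball 0 R"
  shows "abs_level_integral (F 0 0) \<phi> \<epsilon> = (LINT p|lborel. indicator (sublevel R \<epsilon>) p * \<phi> p)"
proof -
  let ?S = "F 0 0"
  have int: "integrable lborel \<phi>" by (rule continuous_compact_supp_integrable[OF \<phi>(1,2)])
  have ball_V: "ball 0 R \<subseteq> V" using finite_type_subset[OF ft] by auto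
  define P where "P = {p \<in> ball 0 R. 0 < ?S p \<and> ?S p < \<epsilon>}"
  define Q where "Q = {p \<in> ball 0 R. 0 < - ?S p \<and> - ?S p < \<epsilon>}"
  have cont: "continuous_on (ball 0 R) ?S" by (rule continuous_on_subset[OF F_cont ball_V])
  have "P = ball 0 R \<inter> ?S -` {0<..<\<epsilon>}" "Q = ball 0 R \<inter> ?S -` {-\<epsilon><..<0}"
    by (auto simp: P_def Q_def)
  then have "open P" "open Q" using cont by (auto intro!: continuous_open_preimage)
  then have PQ: "P \<in> sets lborel" "Q \<in> sets lborel" by auto
  have outside: "\<phi> p = 0" if "\<not> norm p < R" for p
    using that \<phi>(3) by (intro supp_zero) auto
  have P: "level_integral ?S \<phi> \<epsilon> = (LINT p|lborel. indicator P p * \<phi> p)"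
    unfolding level_integral_def set_lebesgue_integral_def
    by (rule Bochner_Integration.integral_cong) (use outside in \<open>auto simp: P_def indicator_def\<close>)
  have Q: "level_integral (\<lambda>p. - ?S p) \<phi> \<epsilon> = (LINT p|lborel. indicator Q p * \<phi> p)"
    unfolding level_integral_def set_lebesgue_integral_def
    by (rule Bochner_Integration.integral_cong) (use outside in \<open>auto simp: Q_def indicator_def\<close>)
  have int': "integrable lborel (\<lambda>p. indicator A p * \<phi> p)" if "A \<in> sets lborel" for A
    using integrable_mult_indicator[OF that int] by simp
  have "abs_level_integral ?S \<phi> \<epsilon> = (LINT p|lborel. indicator P p * \<phi> p + indicator Q p * \<phi> p)"
    unfolding abs_level_integral_def P Q
    by (rule Bochner_Integration.integral_add[symmetric]) (intro int' PQ)+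
  also have "\<dots> = (LINT p|lborel. indicator (sublevel R \<epsilon>) p * \<phi> p)"
  proof (rule integral_cong_AE)
    have "AE p in lborel. p \<notin> {p \<in> ball 0 R. ?S p = 0}"
      by (rule AE_not_in[OF finite_type_zero_set[OF ft]])
    then show "AE p in lborel. indicator P p * \<phi> p + indicator Q p * \<phi> p = indicator (sublevel R \<epsilon>) p * \<phi> p"
      by eventually_elim
        (use ball_V in \<open>auto simp: P_def Q_def sublevel_def indicator_def abs_less_iff\<close>)
  qed (use int'[OF PQ(1)] int'[OF PQ(2)] int'[OF sublevel_measurable] in \<open>auto dest: borel_measurable_integrable\<close>)
  finally show ?thesis .
qed

lemma sublevel_finite: "emeasure lborel (sublevel \<rho> \<epsilon>) < \<infinity>"
proof -
  have "sublevel \<rho> \<epsilon> \<subseteq> ball 0 \<rho>" by (auto simp: sublevel_def)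
  then have "emeasure lborel (sublevel \<rho> \<epsilon>) \<le> emeasure lborel (ball 0 \<rho> :: (real \<times> real) set)"
    by (rule emeasure_mono) simp
  also have "\<dots> < \<infinity>" by (rule emeasure_lborel_ball_finite)
  finally show ?thesis .
qed

lemma measure_sublevel_ge:
  assumes "ennreal z \<le> emeasure lborel (sublevel \<rho> \<epsilon>)"
  shows "z \<le> measure lborel (sublevel \<rho> \<epsilon>)"
  using assms sublevel_finite[of \<rho> \<epsilon>]
  by (simp add: emeasure_eq_ennreal_measure less_top[symmetric] ennreal_le_iff)

lemma nonneg_level_integral_lower:
  assumes ft: "finite_type K R"
    and \<phi>: "continuous_on UNIV \<phi>" "compact (supp \<phi>)" "supp \<phi> \<subseteq> ball 0 R" "\<phi> 0 \<noteq> 0" "\<And>p. \<phi> p \<ge> 0"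
    and lower: "\<And>\<rho>. \<rho> > 0 \<Longrightarrow> \<exists>A>0. \<forall>\<^sub>F \<epsilon> in at_right 0. ennreal (A * L \<epsilon>) \<le> emeasure lborel (sublevel \<rho> \<epsilon>)"
    and L: "\<forall>\<^sub>F \<epsilon> in at_right 0. L \<epsilon> > 0"
  shows "\<exists>A>0. \<forall>\<^sub>F \<epsilon> in at_right 0. abs_level_integral (F 0 0) \<phi> \<epsilon> > A * L \<epsilon>"
proof -
  have "\<phi> 0 > 0" using \<phi>(4) \<phi>(5)[of 0] by simp
  have "R > 0" using ft by (simp add: finite_type_def)
  obtain \<rho> where \<rho>: "0 < \<rho>" "\<rho> \<le> R" "\<And>p. norm p < \<rho> \<Longrightarrow> \<phi> p \<ge> \<phi> 0 / 2"
    using positive_near_origin[OF \<phi>(1) \<open>\<phi> 0 > 0\<close> \<open>R > 0\<close>] by blast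
  obtain A where A: "A > 0" "\<forall>\<^sub>F \<epsilon> in at_right 0. ennreal (A * L \<epsilon>) \<le> emeasure lborel (sublevel \<rho> \<epsilon>)"
    using lower[OF \<rho>(1)] by blast
  have int: "integrable lborel \<phi>" by (rule continuous_compact_supp_integrable[OF \<phi>(1,2)])
  \<comment> \<open>The argument yields the factor \<phi>(0) / 2; halving it gives the strict
    inequality.\<close>
  have "\<forall>\<^sub>F \<epsilon> in at_right 0. abs_level_integral (F 0 0) \<phi> \<epsilon> > (\<phi> 0 / 4 * A) * L \<epsilon>"
    using A(2) L
  proof eventually_elim
    case (elim \<epsilon>)
    have "\<phi> 0 / 2 * (A * L \<epsilon>) \<le> \<phi> 0 / 2 * measure lborel (sublevel \<rho> \<epsilon>)"
      using measure_sublevel_ge[OF elim(1)] \<open>\<phi> 0 > 0\<close> by (intro mult_left_mono) auto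
    also have "\<dots> = (LINT p|lborel. \<phi> 0 / 2 * indicator (sublevel \<rho> \<epsilon>) p)"
      by simp
    also have "\<dots> \<le> (LINT p|lborel. indicator (sublevel R \<epsilon>) p * \<phi> p)"
    proof (rule integral_mono)
      show "integrable lborel (\<lambda>p. \<phi> 0 / 2 * indicator (sublevel \<rho> \<epsilon>) p)"
        using sublevel_finite[of \<rho> \<epsilon>] by (intro integrable_mult_right integrable_real_indicator) (auto simp: open_sublevel)
      show "integrable lborel (\<lambda>p. indicator (sublevel R \<epsilon>) p * \<phi> p)"
        using integrable_mult_indicator[OF sublevel_measurable int] by simp
      show "\<phi> 0 / 2 * indicator (sublevel \<rho> \<epsilon>) p \<le> indicator (sublevel R \<epsilon>) p * \<phi> p" for p
        using \<rho> \<phi>(5)[of p] by (auto simp: indicator_def sublevel_def)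
    qed
    also have "\<dots> = abs_level_integral (F 0 0) \<phi> \<epsilon>"
      by (rule abs_level_integral_eq[OF ft \<phi>(1-3), symmetric])
    finally have "\<phi> 0 / 2 * (A * L \<epsilon>) \<le> abs_level_integral (F 0 0) \<phi> \<epsilon>" .
    moreover have "\<phi> 0 / 4 * (A * L \<epsilon>) > 0" using \<open>\<phi> 0 > 0\<close> A elim by simp
    ultimately show ?case by (simp add: mult.assoc)
  qed
  then show ?thesis using \<open>\<phi> 0 > 0\<close> A(1) by (intro exI[of _ "\<phi> 0 / 4 * A"]) auto
qed

text \<open>Away from the origin the sublevel set has measure \<open>O(\<epsilon> powr (1 / K))\<close>, so that changes of sign
  of \<open>\<phi>\<close> do no harm.\<close>

lemma level_integral_lower:
  assumes ft: "finite_type K R"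
    and \<phi>: "continuous_on UNIV \<phi>" "compact (supp \<phi>)" "supp \<phi> \<subseteq> ball 0 R" "\<phi> 0 \<noteq> 0"
    and lower: "\<And>\<rho>. \<rho> > 0 \<Longrightarrow> \<exists>A>0. \<forall>\<^sub>F \<epsilon> in at_right 0. ennreal (A * L \<epsilon>) \<le> emeasure lborel (sublevel \<rho> \<epsilon>)"
    and L: "\<forall>\<^sub>F \<epsilon> in at_right 0. L \<epsilon> > 0"
    and small: "\<And>C \<delta>. \<delta> > 0 \<Longrightarrow> \<forall>\<^sub>F \<epsilon> in at_right 0. C * \<epsilon> powr (1 / K) \<le> \<delta> * L \<epsilon>"
  shows "\<exists>A>0. \<forall>\<^sub>F \<epsilon> in at_right 0. sgn (\<phi> 0) * abs_level_integral (F 0 0) \<phi> \<epsilon> > A * L \<epsilon>"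
proof -
  define \<psi> where "\<psi> p = sgn (\<phi> 0) * \<phi> p" for p
  define \<eta> where "\<eta> = \<psi> 0 / 2"
  have "\<psi> 0 > 0" using \<phi>(4) by (simp add: \<psi>_def sgn_mult_self_eq flip: abs_sgn) (simp add: sgn_if)
  then have \<eta>: "\<eta> > 0" by (simp add: \<eta>_def)
  have \<psi>_cont: "continuous_on UNIV \<psi>" unfolding \<psi>_def[abs_def] by (intro continuous_intros \<phi>)
  have "R > 0" using ft by (simp add: finite_type_def)
  obtain \<rho> where \<rho>: "0 < \<rho>" "\<rho> \<le> R" "\<And>p. norm p < \<rho> \<Longrightarrow> \<psi> p \<ge> \<eta>"
    using positive_near_origin[OF \<psi>_cont \<open>\<psi> 0 > 0\<close> \<open>R > 0\<close>] unfolding \<eta>_def by blast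
  obtain A where A: "A > 0" "\<forall>\<^sub>F \<epsilon> in at_right 0. ennreal (A * L \<epsilon>) \<le> emeasure lborel (sublevel \<rho> \<epsilon>)"
    using lower[OF \<rho>(1)] by blast
  obtain M where M: "M > 0" "\<And>p. \<bar>\<phi> p\<bar> \<le> M"
    using continuous_compact_supp_bounded[OF \<phi>(1,2)] by blast
  have \<psi>M: "- M \<le> \<psi> p" for p using M(2)[of p] M(1) by (auto simp: \<psi>_def sgn_if abs_le_iff)
  have int: "integrable lborel \<phi>" by (rule continuous_compact_supp_integrable[OF \<phi>(1,2)])
  then have int\<psi>: "integrable lborel \<psi>" unfolding \<psi>_def[abs_def] by simp
  have "\<exists>W. supp \<phi> - ball 0 \<rho> \<subseteq> W \<and> thin K W"
    by (rule finite_type_thin[OF ft]) (use \<phi>(2,3) \<rho> in \<open>auto intro: compact_diff simp: subset_iff less_imp_le\<close>)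
  then obtain W where W: "supp \<phi> - ball 0 \<rho> \<subseteq> W" "thin K W" by blast
  then obtain C e where C: "C \<ge> 0" "e > 0" "\<And>\<epsilon>. 0 < \<epsilon> \<Longrightarrow> \<epsilon> < e \<Longrightarrow>
     emeasure lborel {q \<in> W. \<bar>F 0 0 q\<bar> < \<epsilon>} \<le> ennreal (C * \<epsilon> powr (1 / K))"
    unfolding thin_def by blast
  have W': "open W" "W \<subseteq> V" using W(2) by (auto simp: thin_def)
  \<comment> \<open>The outer part will cost at most a quarter of the main term \<eta> A L, and the
    remaining three quarters exceed the asserted one quarter strictly.\<close>
  have \<delta>: "\<eta> * A / 4 > 0" using \<eta> A by simp
  have "\<forall>\<^sub>F \<epsilon> in at_right 0. \<epsilon> < e" using \<open>e > 0\<close> by (rule eventually_at_right_real[THEN eventually_mono]) auto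
  then have "\<forall>\<^sub>F \<epsilon> in at_right 0. sgn (\<phi> 0) * abs_level_integral (F 0 0) \<phi> \<epsilon> > (\<eta> * A / 4) * L \<epsilon>"
    using A(2) L small[OF \<delta>, of "M * C"] eventually_at_right_less[of "0::real"]
  proof eventually_elim
    case (elim \<epsilon>)
    let ?D = "{q \<in> W. \<bar>F 0 0 q\<bar> < \<epsilon>}"
    have D: "?D \<in> sets lborel" using open_sublevel_in[OF W'] by simp
    have D_le: "emeasure lborel ?D \<le> ennreal (C * \<epsilon> powr (1 / K))" using C(3) elim by blast
    then have D_fin: "emeasure lborel ?D < \<infinity>"
      using order.strict_trans1[OF D_le ennreal_less_top] by simp
    have "measure lborel ?D \<le> C * \<epsilon> powr (1 / K)"
      unfolding measure_def using D_le C(1) by (intro enn2real_leI) auto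
    then have MD: "M * measure lborel ?D \<le> M * (C * \<epsilon> powr (1 / K))"
      using M(1) by (intro mult_left_mono) auto
    have "\<eta> * (A * L \<epsilon>) - M * measure lborel ?D \<le> \<eta> * measure lborel (sublevel \<rho> \<epsilon>) - M * measure lborel ?D"
      using measure_sublevel_ge[OF elim(2)] \<eta> by (intro diff_right_mono mult_left_mono) auto
    also have "\<dots> = (LINT p|lborel. \<eta> * indicator (sublevel \<rho> \<epsilon>) p - M * indicator ?D p)"
      using sublevel_finite[of \<rho> \<epsilon>] D D_fin
      by (subst Bochner_Integration.integral_diff)
        (auto intro!: integrable_mult_right integrable_real_indicator simp: open_sublevel)
    also have "\<dots> \<le> (LINT p|lborel. indicator (sublevel R \<epsilon>) p * \<psi> p)"
    proof (rule integral_mono)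
      show "integrable lborel (\<lambda>p. \<eta> * indicator (sublevel \<rho> \<epsilon>) p - M * indicator ?D p :: real)"
        using sublevel_finite[of \<rho> \<epsilon>] D D_fin
        by (intro Bochner_Integration.integrable_diff integrable_mult_right integrable_real_indicator) (auto simp: open_sublevel)
      show "integrable lborel (\<lambda>p. indicator (sublevel R \<epsilon>) p * \<psi> p)"
        using integrable_mult_indicator[OF sublevel_measurable int\<psi>] by simp
      fix p :: "real \<times> real"
      \<comment> \<open>Near the origin \<psi> is at least \<eta>. On the rest of the support it is
        at least -M, and such points lie in the thin set \<open>W\<close>. Elsewhere the right side
        is 0.\<close>
      consider "p \<in> sublevel \<rho> \<epsilon>" | "p \<notin> sublevel \<rho> \<epsilon>" "p \<in> sublevel R \<epsilon>" "p \<in> supp \<phi>"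
        | "p \<notin> sublevel \<rho> \<epsilon>" "p \<notin> sublevel R \<epsilon> \<or> p \<notin> supp \<phi>" by blast
      then show "\<eta> * indicator (sublevel \<rho> \<epsilon>) p - M * indicator ?D p \<le> indicator (sublevel R \<epsilon>) p * \<psi> p"
      proof cases
        case 1
        then have "p \<in> sublevel R \<epsilon>" "\<psi> p \<ge> \<eta>" using \<rho> by (auto simp: sublevel_def)
        then show ?thesis using 1 M(1) by (auto simp: indicator_def)
      next
        case 2
        then have "p \<in> W" using W(1) by (auto simp: sublevel_def)
        then show ?thesis using 2 \<psi>M[of p] by (auto simp: indicator_def sublevel_def)
      next
        case 3
        then have "indicator (sublevel R \<epsilon>) p * \<psi> p = 0"
          using supp_zero[of p \<phi>] by (auto simp: \<psi>_def)
        then show ?thesis using 3 M(1) by (auto simp: indicator_def)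
      qed
    qed
    also have "\<dots> = (LINT p|lborel. sgn (\<phi> 0) * (indicator (sublevel R \<epsilon>) p * \<phi> p))"
      by (simp add: \<psi>_def mult.left_commute)
    also have "\<dots> = sgn (\<phi> 0) * abs_level_integral (F 0 0) \<phi> \<epsilon>"
      unfolding abs_level_integral_eq[OF ft \<phi>(1-3)] by (rule integral_mult_right_zero)
    finally have "\<eta> * (A * L \<epsilon>) - M * (C * \<epsilon> powr (1 / K)) \<le> sgn (\<phi> 0) * abs_level_integral (F 0 0) \<phi> \<epsilon>"
      using MD by linarith
    moreover have "M * (C * \<epsilon> powr (1 / K)) \<le> \<eta> * (A * L \<epsilon>) / 4"
      using elim by (simp add: mult.assoc)
    moreover have "\<eta> * (A * L \<epsilon>) > 0" using \<eta> A elim by simp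
    ultimately have "\<eta> * (A * L \<epsilon>) / 4 < sgn (\<phi> 0) * abs_level_integral (F 0 0) \<phi> \<epsilon>"
      by linarith
    then show ?case by (simp add: mult.assoc)
  qed
  then show ?thesis using \<delta> by blast
qed

end

section \<open>Nondegeneracy of the leading part\<close>

text \<open>Passing to \<open>pderiv p\<close> lowers the order of a root by exactly one; a nonzero
  polynomial with a root is not constant, so its derivative is again nonzero.\<close>

lemma order_ge_if_derivatives_vanish:
  fixes p :: "real poly"
  assumes "p \<noteq> 0" "\<And>k. k \<le> K \<Longrightarrow> poly ((pderiv ^^ k) p) y = 0"
  shows "order y p \<ge> Suc K"
  using assms
proof (induction K arbitrary: p)
  case 0
  then have "poly p y = 0" by force
  then show ?case using 0(1) order_root[of p y] by simp
next
  case (Suc K)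
  have root: "poly p y = 0" using Suc.prems(2)[of 0] by simp
  have "pderiv p \<noteq> 0"
  proof
    assume "pderiv p = 0"
    then obtain h where "p = [:h:]" using pderiv_iszero by blast
    with root Suc.prems(1) show False by simp
  qed
  moreover have "poly ((pderiv ^^ k) (pderiv p)) y = 0" if "k \<le> K" for k
    using Suc.prems(2)[of "Suc k"] that by (simp add: funpow_Suc_right del: funpow.simps)
  ultimately have "order y (pderiv p) \<ge> Suc K" by (rule Suc.IH)
  then show ?case using order_pderiv[OF Suc.prems(1) root] by simp
qed

lemma sum_single:
  fixes f :: "nat \<Rightarrow> real"
  assumes "k < N" "\<And>n. n \<noteq> k \<Longrightarrow> f n = 0"
  shows "(\<Sum>n<N. f n) = f k"
proof -
  have "(\<Sum>n<N. f n) = (\<Sum>n<N. if n = k then f k else 0)"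
    by (intro sum.cong) (auto simp: assms(2))
  then show ?thesis using assms(1) by simp
qed

context jet
begin

context
  fixes \<alpha> \<beta> :: real and N :: nat
  assumes \<alpha>\<beta>: "\<alpha> > 0" "\<beta> > 0" and N: "N * \<alpha> > 1" "N * \<beta> > 1"
begin

lemma leading_zero: "leading \<alpha> \<beta> a b = 0" if "N \<le> a \<or> N \<le> b"
proof -
  have "real a * \<alpha> + real b * \<beta> \<noteq> 1"
  proof (cases "N \<le> a")
    case True
    then have "real N * \<alpha> \<le> real a * \<alpha>" "0 \<le> real b * \<beta>" using \<alpha>\<beta> by auto
    with N show ?thesis by linarith
  next
    case False
    then have "real N * \<beta> \<le> real b * \<beta>" "0 \<le> real a * \<alpha>" using \<alpha>\<beta> that by auto
    with N show ?thesis by linarith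
  qed
  then show ?thesis by (simp add: leading_def)
qed

lemma on_line_less: "real a * \<alpha> + real b * \<beta> = 1 \<Longrightarrow> a < N \<and> b < N"
proof -
  assume *: "real a * \<alpha> + real b * \<beta> = 1"
  have "0 \<le> real a * \<alpha>" "0 \<le> real b * \<beta>" using \<alpha>\<beta> by auto
  then have "real a * \<alpha> < real N * \<alpha>" "real b * \<beta> < real N * \<beta>" using * N by linarith+
  then show ?thesis using \<alpha>\<beta> by simp
qed

text \<open>On the axis v = 0 only terms with exponent B in v survive B differentiations, and the
  line meets the row b = B in the single point (A, B).\<close>

lemma qhom_at_v0:
  assumes "leading \<alpha> \<beta> A B \<noteq> 0"
  shows "qhom \<alpha> \<beta> N 0 B u 0 = leading \<alpha> \<beta> A B / fact A * u ^ A"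
proof -
  have line: "real A * \<alpha> + real B * \<beta> = 1" using assms by (simp add: leading_def split: if_splits)
  then have less: "A < N" "0 < N" using on_line_less[of A B] by auto
  have other: "leading \<alpha> \<beta> a B = 0" if "a \<noteq> A" for a
  proof -
    have "real a * \<alpha> \<noteq> real A * \<alpha>" using that \<alpha>\<beta> by simp
    then have "real a * \<alpha> + real B * \<beta> \<noteq> 1" using line by linarith
    then show ?thesis by (simp add: leading_def)
  qed
  have "qhom \<alpha> \<beta> N 0 B u 0 = (\<Sum>a<N. leading \<alpha> \<beta> a B / fact a * u ^ a)"
    unfolding qhom_def by (subst sum_single[OF less(2)]) (auto simp: power_0_left)
  also have "\<dots> = leading \<alpha> \<beta> A B / fact A * u ^ A"
    by (rule sum_single[OF less(1)]) (simp add: other)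
  finally show ?thesis .
qed

lemma qhom_at_u0:
  assumes "leading \<alpha> \<beta> A B \<noteq> 0"
  shows "qhom \<alpha> \<beta> N A 0 0 v = leading \<alpha> \<beta> A B / fact B * v ^ B"
proof -
  have line: "real A * \<alpha> + real B * \<beta> = 1" using assms by (simp add: leading_def split: if_splits)
  then have less: "B < N" "0 < N" using on_line_less[of A B] by auto
  have other: "leading \<alpha> \<beta> A b = 0" if "b \<noteq> B" for b
  proof -
    have "real b * \<beta> \<noteq> real B * \<beta>" using that \<alpha>\<beta> by simp
    then have "real A * \<alpha> + real b * \<beta> \<noteq> 1" using line by linarith
    then show ?thesis by (simp add: leading_def)
  qed
  have "qhom \<alpha> \<beta> N A 0 0 v = (\<Sum>b<N. leading \<alpha> \<beta> A b / fact b * v ^ b)"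
    unfolding qhom_def by (intro sum.cong refl, subst sum_single[OF less(2)]) (auto simp: power_0_left)
  also have "\<dots> = leading \<alpha> \<beta> A B / fact B * v ^ B"
    by (rule sum_single[OF less(1)]) (simp add: other)
  finally show ?thesis .
qed

text \<open>The leading part is one monomial: nonzero off the axes, and on an axis made nonzero by
  differentiating away the variable that vanishes there.\<close>

lemma nondegenerate_vertex:
  assumes AB: "coef A B \<noteq> 0" "A * \<alpha> + B * \<beta> = 1" "A \<le> K" "B \<le> K"
    and strict: "\<And>a b. coef a b \<noteq> 0 \<Longrightarrow> (a, b) \<noteq> (A, B) \<Longrightarrow> a * \<alpha> + b * \<beta> \<noteq> 1"
    and uv: "(u, v) \<noteq> (0, 0)"
  shows "\<exists>k\<le>K. qhom \<alpha> \<beta> N k 0 u v \<noteq> 0 \<or> qhom \<alpha> \<beta> N 0 k u v \<noteq> 0"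
proof -
  have lead: "leading \<alpha> \<beta> A B \<noteq> 0" using AB by (simp add: leading_def)
  have zero: "leading \<alpha> \<beta> a b = 0" if "(a, b) \<noteq> (A, B)" for a b
    using strict[of a b] that by (auto simp: leading_def)
  have less: "A < N" "B < N" using on_line_less AB by auto
  consider "u = 0" "v \<noteq> 0" | "v = 0" "u \<noteq> 0" | "u \<noteq> 0" "v \<noteq> 0" using uv by auto
  then show ?thesis
  proof cases
    case 1
    then have "qhom \<alpha> \<beta> N A 0 u v \<noteq> 0" using qhom_at_u0[OF lead] lead by simp
    then show ?thesis using AB by blast
  next
    case 2
    then have "qhom \<alpha> \<beta> N 0 B u v \<noteq> 0" using qhom_at_v0[OF lead] lead by simp
    then show ?thesis using AB by blast
  next
    case 3
    have "qhom \<alpha> \<beta> N 0 0 u v = (\<Sum>a<N. leading \<alpha> \<beta> a B / (fact a * fact B) * u ^ a * v ^ B)"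
      unfolding qhom_def by (subst sum_single[OF less(2)]) (auto simp: zero)
    also have "\<dots> = leading \<alpha> \<beta> A B / (fact A * fact B) * u ^ A * v ^ B"
      by (rule sum_single[OF less(1)]) (simp add: zero)
    finally have "qhom \<alpha> \<beta> N 0 0 u v \<noteq> 0" using 3 lead by simp
    then show ?thesis by blast
  qed
qed

text \<open>Quasihomogeneity with dilation factor |u|^(1/\<alpha>): differentiating k times in v
  lowers the weighted degree from 1 to 1 - k \<beta>. It moves any point with u \<noteq> 0 to u = 1
  or u = -1, the two lines on which superadaptedness is formulated.\<close>

lemma qhom_scaling:
  assumes "u \<noteq> 0"
  shows "qhom \<alpha> \<beta> N 0 k u v =
    \<bar>u\<bar> powr ((1 - k * \<beta>) / \<alpha>) * qhom \<alpha> \<beta> N 0 k (sgn u) (v / \<bar>u\<bar> powr (\<beta> / \<alpha>))"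
proof -
  have "leading \<alpha> \<beta> a (k + b) / (fact a * fact b) * u ^ a * v ^ b =
    \<bar>u\<bar> powr ((1 - k * \<beta>) / \<alpha>) * (leading \<alpha> \<beta> a (k + b) / (fact a * fact b) * sgn u ^ a *
      (v / \<bar>u\<bar> powr (\<beta> / \<alpha>)) ^ b)" for a b
  proof (cases "real a * \<alpha> + real (k + b) * \<beta> = 1")
    case True
    then have "1 - k * \<beta> - real b * \<beta> = real a * \<alpha>" by (simp add: algebra_simps)
    then have "(1 - k * \<beta> - real b * \<beta>) / \<alpha> = real a" using \<alpha>\<beta> by simp
    then have "(1 - k * \<beta>) / \<alpha> - real b * (\<beta> / \<alpha>) = real a"
      by (simp add: diff_divide_distrib)
    then have "\<bar>u\<bar> powr real a = \<bar>u\<bar> powr ((1 - k * \<beta>) / \<alpha>) / \<bar>u\<bar> powr (real b * (\<beta> / \<alpha>))"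
      by (simp only: powr_diff[symmetric])
    moreover have "\<bar>u\<bar> powr (real b * (\<beta> / \<alpha>)) = (\<bar>u\<bar> powr (\<beta> / \<alpha>)) ^ b"
      using assms by (subst powr_realpow[symmetric]) (simp_all add: powr_powr mult.commute)
    ultimately have "\<bar>u\<bar> ^ a = \<bar>u\<bar> powr ((1 - k * \<beta>) / \<alpha>) / (\<bar>u\<bar> powr (\<beta> / \<alpha>)) ^ b"
      using assms by (simp add: powr_realpow)
    moreover have "u ^ a = sgn u ^ a * \<bar>u\<bar> ^ a"
      by (metis mult_sgn_abs power_mult_distrib)
    ultimately show ?thesis by (simp add: power_divide)
  qed (simp add: leading_def)
  then show ?thesis by (simp only: qhom_def sum_distrib_left add_0_left)
qed

lemma qhom_has_derivative:
  "((\<lambda>v. qhom \<alpha> \<beta> N 0 k u v) has_real_derivative qhom \<alpha> \<beta> N 0 (Suc k) u v) (at v)"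
proof -
  define g where "g j = (\<Sum>a<N. leading \<alpha> \<beta> a j / fact a * u ^ a)" for j
  have g0: "g j = 0" if "j \<ge> N" for j using that by (simp add: g_def leading_zero)
  have q: "qhom \<alpha> \<beta> N 0 k u v = (\<Sum>b<N. g (k + b) / fact b * v ^ b)" for k v
    by (simp add: qhom_def g_def sum_divide_distrib sum_distrib_left sum_distrib_right mult_ac)
  obtain M where M: "N = Suc M" using N by (cases N) auto
  have "((\<lambda>v. \<Sum>b<N. g (k + b) / fact b * v ^ b) has_real_derivative
      (\<Sum>b<N. g (k + b) / fact b * (real b * v ^ (b - 1)))) (at v)"
    by (auto intro!: derivative_eq_intros sum.cong)
  also have "(\<Sum>b<N. g (k + b) / fact b * (real b * v ^ (b - 1))) = (\<Sum>b<M. g (Suc k + b) / fact b * v ^ b)"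
    unfolding M sum.lessThan_Suc_shift by (simp add: divide_simps)
  \<comment> \<open>Differentiation shortens the sum by one term; the term added back has index at
    least \<open>N\<close>, where the leading coefficients vanish.\<close>
  also have "\<dots> = (\<Sum>b<N. g (Suc k + b) / fact b * v ^ b)"
    unfolding M using g0[of "Suc k + M"] M by simp
  finally show ?thesis unfolding q .
qed

lemma poly_pderiv_funpow_eq_qhom:
  assumes "\<And>y. poly p y = qhom \<alpha> \<beta> N 0 0 x y"
  shows "poly ((pderiv ^^ k) p) y = qhom \<alpha> \<beta> N 0 k x y"
proof (induction k arbitrary: y)
  case (Suc k)
  have "poly ((pderiv ^^ k) p) = (\<lambda>y. qhom \<alpha> \<beta> N 0 k x y)" using Suc by auto
  then have "(poly ((pderiv ^^ k) p) has_real_derivative qhom \<alpha> \<beta> N 0 (Suc k) x y) (at y)"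
    using qhom_has_derivative by simp
  from DERIV_unique[OF poly_DERIV this] show ?case by simp
qed (use assms in simp)

lemma poly_edge_poly_eq_qhom:
  assumes e: "\<And>a b. (real a, real b) \<in> e \<Longrightarrow> a * \<alpha> + b * \<beta> = 1"
    "\<And>a b. coef a b \<noteq> 0 \<Longrightarrow> a * \<alpha> + b * \<beta> = 1 \<Longrightarrow> (real a, real b) \<in> e"
  shows "poly (edge_poly (F 0 0) e x) y = qhom \<alpha> \<beta> N 0 0 x y"
proof -
  let ?X = "{(a, b). (real a, real b) \<in> e}"
  let ?g = "\<lambda>(a, b). leading \<alpha> \<beta> a b / (fact a * fact b) * x ^ a * y ^ b"
  have X: "?X \<subseteq> {..<N} \<times> {..<N}" using e(1) on_line_less by blast
  have "poly (edge_poly (F 0 0) e x) y = sum ?g ?X"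
    unfolding poly_edge_poly edge_part_def
    by (intro sum.cong) (auto simp: taylor_coeff_eq leading_def coef_def e(1))
  also have "\<dots> = sum ?g ({..<N} \<times> {..<N})"
    by (rule sum.mono_neutral_left[OF _ X]) (auto simp: leading_def e(2) split: if_splits)
  also have "\<dots> = (\<Sum>a<N. \<Sum>b<N. leading \<alpha> \<beta> a b / (fact a * fact b) * x ^ a * y ^ b)"
    by (simp add: sum.cartesian_product)
  also have "\<dots> = qhom \<alpha> \<beta> N 0 0 x y"
    unfolding qhom_def by (subst sum.swap) simp
  finally show ?thesis .
qed

text \<open>On the axes the two given monomials provide nonzero derivatives of order at most
  \<open>K\<close>. Off the axes, scaling leads to u = \<plusminus>1, where the vanishing of all
  v-derivatives up to order \<open>K\<close> would give the edge polynomial a root of order above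
  \<open>K\<close>.\<close>

lemma nondegenerate_edge:
  assumes e: "\<And>a b. (real a, real b) \<in> e \<Longrightarrow> a * \<alpha> + b * \<beta> = 1"
    "\<And>a b. coef a b \<noteq> 0 \<Longrightarrow> a * \<alpha> + b * \<beta> = 1 \<Longrightarrow> (real a, real b) \<in> e"
    and low: "coef A B \<noteq> 0" "A * \<alpha> + B * \<beta> = 1" "B \<le> K"
    and up: "coef A' B' \<noteq> 0" "A' * \<alpha> + B' * \<beta> = 1" "A' \<le> K"
    and order: "\<And>x y. \<lbrakk>x \<in> {1, -1}; y \<noteq> 0; poly (edge_poly (F 0 0) e x) y = 0\<rbrakk> \<Longrightarrow>
      order y (edge_poly (F 0 0) e x) \<le> K"
    and uv: "(u, v) \<noteq> (0, 0)"
  shows "\<exists>k\<le>K. qhom \<alpha> \<beta> N k 0 u v \<noteq> 0 \<or> qhom \<alpha> \<beta> N 0 k u v \<noteq> 0"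
proof -
  have lead: "leading \<alpha> \<beta> A B \<noteq> 0" "leading \<alpha> \<beta> A' B' \<noteq> 0" using low up by (simp_all add: leading_def)
  consider "u = 0" "v \<noteq> 0" | "v = 0" "u \<noteq> 0" | "u \<noteq> 0" "v \<noteq> 0" using uv by auto
  then show ?thesis
  proof cases
    case 1
    then have "qhom \<alpha> \<beta> N A' 0 u v \<noteq> 0" using qhom_at_u0[OF lead(2)] lead by simp
    then show ?thesis using up by blast
  next
    case 2
    then have "qhom \<alpha> \<beta> N 0 B u v \<noteq> 0" using qhom_at_v0[OF lead(1)] lead by simp
    then show ?thesis using low by blast
  next
    case 3
    define x where "x = sgn u"
    define y where "y = v / \<bar>u\<bar> powr (\<beta> / \<alpha>)"
    let ?p = "edge_poly (F 0 0) e x"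
    have x: "x \<in> {1, -1}" and y: "y \<noteq> 0" using 3 by (auto simp: x_def y_def sgn_if)
    have p: "poly ((pderiv ^^ k) ?p) z = qhom \<alpha> \<beta> N 0 k x z" for k z
      by (rule poly_pderiv_funpow_eq_qhom[OF poly_edge_poly_eq_qhom[OF e]])
    have "\<exists>k\<le>K. qhom \<alpha> \<beta> N 0 k x y \<noteq> 0"
    proof (rule ccontr)
      assume "\<not> ?thesis"
      then have vanish: "poly ((pderiv ^^ k) ?p) y = 0" if "k \<le> K" for k using p that by auto
      \<comment> \<open>Multiplicities are informative only for a nonzero polynomial; the monomial
        (A, B) contributes to its coefficient of y^B.\<close>
      have "?p \<noteq> 0"
      proof
        assume "?p = 0"
        then have "qhom \<alpha> \<beta> N 0 B x 0 = 0" using p[of B 0] by (induction B) auto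
        then show False using qhom_at_v0[OF lead(1), of x] lead x by auto
      qed
      from order_ge_if_derivatives_vanish[OF this vanish, of K] have "Suc K \<le> order y ?p" by simp
      with order[OF x y] vanish[of 0] show False by simp
    qed
    then obtain k where "k \<le> K" "qhom \<alpha> \<beta> N 0 k x y \<noteq> 0" by blast
    then show ?thesis using qhom_scaling[OF \<open>u \<noteq> 0\<close>, of k v] 3 by (auto simp: x_def y_def)
  qed
qed

end

end

section \<open>Geometry of the Newton polygon\<close>

lemma mem_open_segment_between:
  fixes D w :: "'a::real_vector"
  assumes "s > 0" "t > 0" "w \<noteq> 0"
  shows "D \<in> open_segment (D + s *\<^sub>R w) (D - t *\<^sub>R w)"
proof -
  define u where "u = s / (s + t)"
  have u: "0 < u" "u < 1" using assms by (auto simp: u_def)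
  have "(1 - u) * s = u * t" using assms by (simp add: u_def field_simps)
  moreover have "(1 - u) *\<^sub>R (D + s *\<^sub>R w) + u *\<^sub>R (D - t *\<^sub>R w) = D + ((1 - u) * s - u * t) *\<^sub>R w"
    by (simp add: algebra_simps)
  ultimately have "D = (1 - u) *\<^sub>R (D + s *\<^sub>R w) + u *\<^sub>R (D - t *\<^sub>R w)" by simp
  moreover have "D + s *\<^sub>R w \<noteq> D - t *\<^sub>R w"
  proof
    assume "D + s *\<^sub>R w = D - t *\<^sub>R w"
    then have "(s + t) *\<^sub>R w = 0" by (simp add: algebra_simps)
    with assms show False by simp
  qed
  ultimately show ?thesis using u unfolding in_segment by blast
qed

text \<open>A lexicographic half-space: an open half-space together with a half of its boundary. It
  can contain a convex hull while excluding a point of the supporting line, which no closed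
  half-space touching the hull along that line achieves.\<close>

lemma convex_lex_halfspace:
  fixes a b :: "'a::real_inner"
  shows "convex {p. r < a \<bullet> p \<or> (a \<bullet> p = r \<and> s \<le> b \<bullet> p)}"
proof (rule convexI)
  fix p q and u v :: real
  assume p: "p \<in> {p. r < a \<bullet> p \<or> (a \<bullet> p = r \<and> s \<le> b \<bullet> p)}"
    and q: "q \<in> {p. r < a \<bullet> p \<or> (a \<bullet> p = r \<and> s \<le> b \<bullet> p)}"
    and uv: "0 \<le> u" "0 \<le> v" "u + v = 1"
  consider "u = 0" | "v = 0" | "u > 0" "v > 0" using uv by linarith
  then show "u *\<^sub>R p + v *\<^sub>R q \<in> {p. r < a \<bullet> p \<or> (a \<bullet> p = r \<and> s \<le> b \<bullet> p)}"
  proof cases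
    case 3
    have r: "u * r + v * r = r" and s: "u * s + v * s = s"
      using uv by (simp_all flip: distrib_right)
    have le: "u * r \<le> u * (a \<bullet> p)" "v * r \<le> v * (a \<bullet> q)"
      using p q uv by (auto intro!: mult_left_mono)
    show ?thesis
    proof (cases "r < a \<bullet> p \<or> r < a \<bullet> q")
      case True
      then have "u * r < u * (a \<bullet> p) \<or> v * r < v * (a \<bullet> q)" using 3 by auto
      then have "r < u * (a \<bullet> p) + v * (a \<bullet> q)" using le r by linarith
      then show ?thesis by (simp add: inner_add_right)
    next
      case False
      then have eq: "a \<bullet> p = r" "a \<bullet> q = r" "s \<le> b \<bullet> p" "s \<le> b \<bullet> q" using p q by auto
      then have "u * s \<le> u * (b \<bullet> p)" "v * s \<le> v * (b \<bullet> q)" using uv by (auto intro!: mult_left_mono)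
      then have "s \<le> u * (b \<bullet> p) + v * (b \<bullet> q)" using s by linarith
      then show ?thesis using eq r by (simp add: inner_add_right)
    qed
  qed (use p q uv in auto)
qed

lemma newton_polygon_quadrant:
  assumes "taylor_coeff S a b \<noteq> 0" "real a \<le> x" "real b \<le> y"
  shows "(x, y) \<in> newton_polygon S"
  unfolding newton_polygon_def using assms by (intro hull_inc) auto

lemma newton_polygon_subset:
  assumes "convex C"
    and "\<And>a b x y. \<lbrakk>taylor_coeff S a b \<noteq> 0; real a \<le> x; real b \<le> y\<rbrakk> \<Longrightarrow> (x, y) \<in> C"
  shows "newton_polygon S \<subseteq> C"
  unfolding newton_polygon_def using assms by (intro hull_minimal) auto

lemma convex_newton_polygon: "convex (newton_polygon S)"
  by (simp add: newton_polygon_def)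

text \<open>The points whose translate by \<open>z\<close> lies in N(S) form a convex set containing
  all the generating quadrants, hence the hull.\<close>

lemma newton_polygon_upward:
  assumes "(x, y) \<in> newton_polygon S" "x \<le> x'" "y \<le> y'"
  shows "(x', y') \<in> newton_polygon S"
proof -
  define z where "z = (x' - x, y' - y)"
  have "newton_polygon S \<subseteq> {p. p + z \<in> newton_polygon S}"
  proof (rule newton_polygon_subset)
    show "convex {p. p + z \<in> newton_polygon S}"
    proof (rule convexI)
      fix p q and u v :: real
      assume *: "p \<in> {p. p + z \<in> newton_polygon S}" "q \<in> {p. p + z \<in> newton_polygon S}"
        "0 \<le> u" "0 \<le> v" "u + v = 1"
      have "u *\<^sub>R (p + z) + v *\<^sub>R (q + z) \<in> newton_polygon S"
        using * convexD[OF convex_newton_polygon] by blast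
      moreover have "u *\<^sub>R (p + z) + v *\<^sub>R (q + z) = u *\<^sub>R p + v *\<^sub>R q + z"
        using \<open>u + v = 1\<close> by (simp add: algebra_simps flip: scaleR_left_distrib)
      ultimately show "u *\<^sub>R p + v *\<^sub>R q \<in> {p. p + z \<in> newton_polygon S}" by simp
    qed
    fix a b :: nat and s t :: real
    assume "taylor_coeff S a b \<noteq> 0" "real a \<le> s" "real b \<le> t"
    then show "(s, t) \<in> {p. p + z \<in> newton_polygon S}"
      using assms by (auto simp: z_def intro!: newton_polygon_quadrant)
  qed
  with assms(1) show ?thesis by (auto simp: z_def)
qed

lemma newton_polygon_nonneg:
  assumes "(x, y) \<in> newton_polygon S"
  shows "0 \<le> x" "0 \<le> y"
proof -
  have "newton_polygon S \<subseteq> {0..} \<times> {0..}"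
    by (rule newton_polygon_subset) (auto intro: convex_Times)
  with assms show "0 \<le> x" "0 \<le> y" by auto
qed

lemma newton_distance_le_max:
  assumes "(x, y) \<in> newton_polygon S"
  shows "newton_distance S \<le> max x y"
proof -
  have "(max x y, max x y) \<in> newton_polygon S"
    by (rule newton_polygon_upward[OF assms]) auto
  then show ?thesis
    unfolding newton_distance_def
    by (intro cInf_lower bdd_belowI[of _ 0]) (auto dest: newton_polygon_nonneg)
qed

text \<open>By the choice of d the open quadrant below (d, d) misses N(S), so the two convex sets
  can be separated. As the quadrant is unbounded in both negative directions, both components of the
  normal are nonnegative.\<close>

lemma supporting_line:
  fixes S :: "real \<times> real \<Rightarrow> real"
  defines "d \<equiv> newton_distance S"
  assumes D: "(d, d) \<in> newton_polygon S"
  obtains \<alpha> \<beta> :: real where "\<alpha> \<ge> 0" "\<beta> \<ge> 0" "\<alpha> + \<beta> > 0"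
    "\<And>x y. (x, y) \<in> newton_polygon S \<Longrightarrow> (\<alpha> + \<beta>) * d \<le> \<alpha> * x + \<beta> * y"
proof -
  let ?T = "{..<d} \<times> {..<d}"
  have "?T \<inter> newton_polygon S = {}"
    using newton_distance_le_max[of _ _ S] unfolding d_def[symmetric] by fastforce
  moreover have "(d - 1, d - 1) \<in> ?T" by simp
  then have "?T \<noteq> {}" by blast
  ultimately obtain n r where n: "n \<noteq> 0" "\<forall>p\<in>?T. n \<bullet> p \<le> r" "\<forall>p\<in>newton_polygon S. r \<le> n \<bullet> p"
    using separating_hyperplane_sets[of ?T "newton_polygon S"] D convex_newton_polygon
    by (metis convex_Times convex_real_interval(4) empty_iff)
  obtain \<alpha> \<beta> where n_eq: "n = (\<alpha>, \<beta>)" by fastforce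
  have T: "\<alpha> * (d - h) + \<beta> * (d - k) \<le> r" if "h > 0" "k > 0" for h k
    using n(2)[rule_format, of "(d - h, d - k)"] that by (simp add: n_eq)
  have N: "r \<le> \<alpha> * x + \<beta> * y" if "(x, y) \<in> newton_polygon S" for x y
    using n(3) that by (auto simp: n_eq)
  have hk: "\<alpha> * h + \<beta> * k \<ge> 0" if "h > 0" "k > 0" for h k
    using T[OF that] N[OF D] by (simp add: algebra_simps)
  have nonneg: "x \<ge> 0" if "\<And>h k. h > 0 \<Longrightarrow> k > 0 \<Longrightarrow> x * h + y * k \<ge> 0" for x y :: real
  proof (rule ccontr)
    assume "\<not> 0 \<le> x"
    then have "(\<bar>y\<bar> + 1) / (- x) > 0" by (intro divide_pos_pos) auto
    then have "0 \<le> x * ((\<bar>y\<bar> + 1) / (- x)) + y * 1" by (intro that) auto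
    moreover have "x * ((\<bar>y\<bar> + 1) / (- x)) = - (\<bar>y\<bar> + 1)" using \<open>\<not> 0 \<le> x\<close> by (simp add: field_simps)
    ultimately show False by simp
  qed
  have "\<alpha> \<ge> 0" using hk by (rule nonneg)
  moreover have "\<beta> \<ge> 0" using hk by (intro nonneg[of \<beta> \<alpha>]) (simp add: add.commute)
  moreover have "\<alpha> \<noteq> 0 \<or> \<beta> \<noteq> 0" using n(1) by (auto simp: n_eq zero_prod_def)
  ultimately have pos: "\<alpha> \<ge> 0" "\<beta> \<ge> 0" "\<alpha> + \<beta> > 0" by auto
  have "(\<alpha> + \<beta>) * d \<le> r"
  proof (rule field_le_epsilon)
    fix e :: real assume "e > 0"
    define q where "q = e / (\<alpha> + \<beta>)"
    have "q > 0" using \<open>e > 0\<close> pos by (simp add: q_def)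
    then have "\<alpha> * (d - q) + \<beta> * (d - q) \<le> r" by (intro T)
    moreover have "\<alpha> * (d - q) + \<beta> * (d - q) = (\<alpha> + \<beta>) * d - (\<alpha> + \<beta>) * q"
      by (simp add: algebra_simps)
    moreover have "(\<alpha> + \<beta>) * q = e" using pos by (simp add: q_def)
    ultimately show "(\<alpha> + \<beta>) * d \<le> r + e" by linarith
  qed
  then show ?thesis using N pos by (intro that[of \<alpha> \<beta>]) (auto intro: order.trans)
qed

text \<open>The last two points lie on either side of \<open>(d, d)\<close> in the direction \<open>(\<beta>, -\<alpha>)\<close> of the supporting line.\<close>

lemma edge_through_bisectrix:
  fixes S :: "real \<times> real \<Rightarrow> real"
  defines "d \<equiv> newton_distance S"
  assumes e: "e edge_of newton_polygon S" and D: "(d, d) \<in> rel_interior e"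
  obtains \<alpha> \<beta> s t :: real where "\<alpha> \<ge> 0" "\<beta> \<ge> 0" "\<alpha> + \<beta> > 0" "s > 0" "t > 0"
    "\<And>x y. (x, y) \<in> newton_polygon S \<Longrightarrow> (\<alpha> + \<beta>) * d \<le> \<alpha> * x + \<beta> * y"
    "\<And>x y. (x, y) \<in> e \<Longrightarrow> \<alpha> * x + \<beta> * y = (\<alpha> + \<beta>) * d"
    "(d, d) \<in> e" "(d + s * \<beta>, d - s * \<alpha>) \<in> e" "(d - t * \<beta>, d + t * \<alpha>) \<in> e"
proof -
  have face: "e face_of newton_polygon S" and dim: "aff_dim e = 1"
    using e by (auto simp: edge_of_def)
  have eN: "e \<subseteq> newton_polygon S" and conv: "convex e"
    using face by (auto simp: face_of_def)
  have De: "(d, d) \<in> e" using D rel_interior_subset by blast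
  have DN: "(newton_distance S, newton_distance S) \<in> newton_polygon S"
    using De eN unfolding d_def by blast
  obtain \<alpha> \<beta> :: real where pos: "\<alpha> \<ge> 0" "\<beta> \<ge> 0" "\<alpha> + \<beta> > 0"
    and N: "\<And>x y. (x, y) \<in> newton_polygon S \<Longrightarrow> (\<alpha> + \<beta>) * d \<le> \<alpha> * x + \<beta> * y"
    using supporting_line[OF DN] unfolding d_def[symmetric] by blast
  \<comment> \<open>A point of the relative interior can be overshot: segments of \<open>e\<close>
    ending at (d, d) extend a little beyond it.\<close>
  have prolong: "\<exists>\<mu>>1. (d - (\<mu> - 1) * (x - d), d - (\<mu> - 1) * (y - d)) \<in> e" if xy: "(x, y) \<in> e" for x y
  proof -
    obtain \<mu> where "\<mu> > 1" "(1 - \<mu>) *\<^sub>R (x, y) + \<mu> *\<^sub>R (d, d) \<in> e"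
      using convex_rel_interior_if2[OF conv D] hull_inc[OF xy] by blast
    moreover have "(1 - \<mu>) *\<^sub>R (x, y) + \<mu> *\<^sub>R (d, d) = (d - (\<mu> - 1) * (x - d), d - (\<mu> - 1) * (y - d))"
      by (simp add: algebra_simps)
    ultimately show ?thesis by (intro exI[of _ \<mu>]) simp
  qed
  \<comment> \<open>The supporting functional minus its value at (d, d) changes sign at the overshot
    point; being nonnegative at both points, it is zero.\<close>
  have line: "\<alpha> * x + \<beta> * y = (\<alpha> + \<beta>) * d" if xy: "(x, y) \<in> e" for x y
  proof -
    obtain \<mu> where \<mu>: "\<mu> > 1" "(d - (\<mu> - 1) * (x - d), d - (\<mu> - 1) * (y - d)) \<in> e"
      using prolong[OF xy] by blast
    then have "(\<alpha> + \<beta>) * d \<le> \<alpha> * (d - (\<mu> - 1) * (x - d)) + \<beta> * (d - (\<mu> - 1) * (y - d))"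
      using eN by (intro N) auto
    then have "(\<mu> - 1) * (\<alpha> * x + \<beta> * y - (\<alpha> + \<beta>) * d) \<le> 0"
      by (simp add: algebra_simps)
    then have "\<alpha> * x + \<beta> * y \<le> (\<alpha> + \<beta>) * d"
      using \<mu>(1) by (simp add: mult_le_0_iff)
    moreover have "(\<alpha> + \<beta>) * d \<le> \<alpha> * x + \<beta> * y" using N eN xy by blast
    ultimately show ?thesis by simp
  qed
  have "e \<noteq> {(d, d)}" using dim aff_dim_sing[of "(d, d)"] by auto
  then obtain x y where xy: "(x, y) \<in> e" "(x, y) \<noteq> (d, d)" using De by fastforce
  obtain \<mu> where \<mu>: "\<mu> > 1" "(d - (\<mu> - 1) * (x - d), d - (\<mu> - 1) * (y - d)) \<in> e"
    using prolong[OF xy(1)] by blast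
  define r where "r = (if \<beta> = 0 then - (y - d) / \<alpha> else (x - d) / \<beta>)"
  have off: "\<alpha> * (x - d) + \<beta> * (y - d) = 0" using line[OF xy(1)] by (simp add: algebra_simps)
  have x: "x = d + r * \<beta>" and y: "y = d - r * \<alpha>"
    using off pos by (auto simp: r_def field_simps)
  have r0: "r \<noteq> 0" using xy(2) x y by auto
  have e1: "(d + r * \<beta>, d - r * \<alpha>) \<in> e" using xy(1) x y by simp
  have e2: "(d - (\<mu> - 1) * r * \<beta>, d + (\<mu> - 1) * r * \<alpha>) \<in> e"
    using \<mu>(2) by (simp add: x y mult.assoc)
  show ?thesis
  proof (cases "r > 0")
    case True
    show ?thesis
      by (rule that[of \<alpha> \<beta> r "(\<mu> - 1) * r"]) (use pos N line De e1 e2 True \<mu> in auto)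
  next
    case False
    then have "- r > 0" using r0 by simp
    moreover from this have "(\<mu> - 1) * (- r) > 0" using \<mu>(1) by (intro mult_pos_pos) auto
    ultimately show ?thesis
      by (intro that[of \<alpha> \<beta> "(\<mu> - 1) * (- r)" "- r"]) (use pos N line De e1 e2 in auto)
  qed
qed

text \<open>The new point and one of the two given points lie on opposite sides of (d, d), so the
  defining property of a face puts both into \<open>e\<close>.\<close>

lemma edge_contains:
  fixes S :: "real \<times> real \<Rightarrow> real"
  defines "d \<equiv> newton_distance S"
  assumes face: "e face_of newton_polygon S" and D: "(d, d) \<in> e"
    and st: "s > 0" "t > 0" "(d + s * \<beta>, d - s * \<alpha>) \<in> e" "(d - t * \<beta>, d + t * \<alpha>) \<in> e"
    and nz: "(\<beta>, \<alpha>) \<noteq> (0, 0)"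
    and z: "(d + r * \<beta>, d - r * \<alpha>) \<in> newton_polygon S"
  shows "(d + r * \<beta>, d - r * \<alpha>) \<in> e"
proof -
  have eN: "e \<subseteq> newton_polygon S" using face by (simp add: face_of_def)
  have closed: "a \<in> e \<and> b \<in> e" if "a \<in> newton_polygon S" "b \<in> newton_polygon S" "(d, d) \<in> open_segment a b" for a b
    using face D that unfolding face_of_def by blast
  have w: "(\<beta>, - \<alpha>) \<noteq> 0" using nz by (auto simp: zero_prod_def)
  consider "r = 0" | "r > 0" | "r < 0" by linarith
  then show ?thesis
  proof cases
    case 1
    then show ?thesis using D by simp
  next
    case 2
    have "(d, d) \<in> open_segment ((d, d) + r *\<^sub>R (\<beta>, - \<alpha>)) ((d, d) - t *\<^sub>R (\<beta>, - \<alpha>))"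
      by (rule mem_open_segment_between) (use 2 st w in auto)
    then have "(d, d) \<in> open_segment (d + r * \<beta>, d - r * \<alpha>) (d - t * \<beta>, d + t * \<alpha>)" by simp
    then show ?thesis using closed z st eN by blast
  next
    case 3
    have "(d, d) \<in> open_segment ((d, d) + s *\<^sub>R (\<beta>, - \<alpha>)) ((d, d) - (- r) *\<^sub>R (\<beta>, - \<alpha>))"
      by (rule mem_open_segment_between) (use 3 st w in auto)
    then have "(d, d) \<in> open_segment (d + s * \<beta>, d - s * \<alpha>) (d + r * \<beta>, d - r * \<alpha>)" by simp
    then show ?thesis using closed z st eN by blast
  qed
qed

text \<open>If a weight vanished, the line would be parallel to an axis. N(S) is closed under moving
  up or right, so \<open>e\<close> would then contain an unbounded ray.\<close>

lemma compact_edge_slope: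
  fixes S :: "real \<times> real \<Rightarrow> real"
  defines "d \<equiv> newton_distance S"
  assumes face: "e face_of newton_polygon S" and "bounded e" and D: "(d, d) \<in> e"
    and st: "s > 0" "t > 0" "(d + s * \<beta>, d - s * \<alpha>) \<in> e" "(d - t * \<beta>, d + t * \<alpha>) \<in> e"
    and pos: "\<alpha> \<ge> 0" "\<beta> \<ge> 0" "\<alpha> + \<beta> > 0"
  shows "\<alpha> > 0 \<and> \<beta> > 0"
proof (rule ccontr)
  assume "\<not> ?thesis"
  then have one: "\<alpha> = 0 \<and> \<beta> > 0 \<or> \<beta> = 0 \<and> \<alpha> > 0" using pos by auto
  obtain B where B: "\<And>p. p \<in> e \<Longrightarrow> norm p \<le> B" using \<open>bounded e\<close> bounded_iff by blast
  have DN: "(d, d) \<in> newton_polygon S" using face D by (auto simp: face_of_def)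
  then have d0: "d \<ge> 0" by (rule newton_polygon_nonneg)
  have B0: "B \<ge> 0" using B[OF D] norm_ge_zero order.trans by blast
  from one show False
  proof
    assume *: "\<alpha> = 0 \<and> \<beta> > 0"
    let ?r = "(B + 1) / \<beta>"
    have "(d + ?r * \<beta>, d - ?r * \<alpha>) \<in> newton_polygon S"
      using * B0 by (intro newton_polygon_upward[OF DN]) auto
    then have "(d + ?r * \<beta>, d - ?r * \<alpha>) \<in> e"
      unfolding d_def by (intro edge_contains[OF face D[unfolded d_def] st[unfolded d_def]]) (use * in auto)
    then have "norm (d + (B + 1), d) \<le> B" using B * by simp
    then have "\<bar>d + (B + 1)\<bar> \<le> B" using norm_fst_le[of "d + (B + 1)" d] by simp
    then show False using d0 B0 by simp
  next
    assume *: "\<beta> = 0 \<and> \<alpha> > 0"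
    let ?r = "- ((B + 1) / \<alpha>)"
    have "(d + ?r * \<beta>, d - ?r * \<alpha>) \<in> newton_polygon S"
      using * B0 by (intro newton_polygon_upward[OF DN]) auto
    then have "(d + ?r * \<beta>, d - ?r * \<alpha>) \<in> e"
      unfolding d_def by (intro edge_contains[OF face D[unfolded d_def] st[unfolded d_def]]) (use * in auto)
    moreover have "(d + ?r * \<beta>, d - ?r * \<alpha>) = (d, d + (B + 1))" using * by simp
    ultimately have "norm (d, d + (B + 1)) \<le> B" using B by metis
    then have "\<bar>d + (B + 1)\<bar> \<le> B" using norm_snd_le[of "d + (B + 1)" d] by simp
    then show False using d0 B0 by simp
  qed
qed

text \<open>Transfers a linear inequality from a point of the supporting line to a monomial on it.
  Otherwise all generators, hence N(S), would lie in a lexicographic half-space that excludes the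
  point. This replaces any discussion of the endpoints of an edge.\<close>

lemma monomial_on_supporting_line:
  fixes \<alpha> \<beta> c s :: real and b1 b2 :: real
  assumes pos: "\<alpha> > 0" "\<beta> > 0"
    and supp: "\<And>a b. taylor_coeff S a b \<noteq> 0 \<Longrightarrow> c \<le> \<alpha> * a + \<beta> * b"
    and z: "(x, y) \<in> newton_polygon S" "\<alpha> * x + \<beta> * y = c" "b1 * x + b2 * y < s"
  shows "\<exists>a b. taylor_coeff S a b \<noteq> 0 \<and> \<alpha> * a + \<beta> * b = c \<and> b1 * a + b2 * b < s"
proof (rule ccontr)
  assume contr: "\<not> ?thesis"
  have "newton_polygon S \<subseteq> {p. c < (\<alpha>, \<beta>) \<bullet> p \<or> ((\<alpha>, \<beta>) \<bullet> p = c \<and> s \<le> (b1, b2) \<bullet> p)}"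
  proof (rule newton_polygon_subset[OF convex_lex_halfspace])
    fix a b :: nat and x y :: real
    assume ab: "taylor_coeff S a b \<noteq> 0" "real a \<le> x" "real b \<le> y"
    have le: "\<alpha> * a \<le> \<alpha> * x" "\<beta> * b \<le> \<beta> * y" using ab pos by auto
    show "(x, y) \<in> {p. c < (\<alpha>, \<beta>) \<bullet> p \<or> ((\<alpha>, \<beta>) \<bullet> p = c \<and> s \<le> (b1, b2) \<bullet> p)}"
    proof (cases "c < \<alpha> * x + \<beta> * y")
      case False
      then have "\<alpha> * a = \<alpha> * x" "\<beta> * b = \<beta> * y" "\<alpha> * a + \<beta> * b = c"
        using le supp[OF ab(1)] by linarith+
      moreover from this have "x = a" "y = b" using pos by auto
      ultimately show ?thesis using contr ab(1) by (auto simp: not_less)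
    qed simp
  qed
  with z show False by auto
qed

section \<open>The bisectrix inside a compact edge\<close>

lemma nat_ceiling_less:
  fixes d :: real
  assumes "d > 1"
  obtains K :: nat where "K \<ge> 1" "real K < d" "\<And>n :: nat. real n < d \<Longrightarrow> n \<le> K"
proof -
  define K where "K = nat \<lceil>d\<rceil> - 1"
  have "nat \<lceil>d\<rceil> \<ge> 2" using assms by linarith
  then have "real K = real_of_int \<lceil>d\<rceil> - 1" using assms by (simp add: K_def of_nat_diff)
  then have "real K < d" "d \<le> real K + 1" by linarith+
  moreover have "K \<ge> 1" using \<open>nat \<lceil>d\<rceil> \<ge> 2\<close> by (simp add: K_def)
  moreover have "n \<le> K" if "real n < d" for n
    using that \<open>d \<le> real K + 1\<close> by linarith
  ultimately show ?thesis by (intro that[of K])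
qed

text \<open>\<open>X\<close> may be infinite, but all its denominators divide k!. Multiplied by k!
  the fractions are natural numbers, which are well-ordered.\<close>

lemma fractions_attain_minimum:
  fixes X :: "(nat \<times> nat) set"
  assumes "X \<noteq> {}" "\<And>p q. (p, q) \<in> X \<Longrightarrow> 1 \<le> q \<and> q \<le> k"
  obtains p q where "(p, q) \<in> X" "\<And>p' q'. (p', q') \<in> X \<Longrightarrow> real p / real q \<le> real p' / real q'"
proof -
  let ?f = "\<lambda>(p, q). p * (fact k div q) :: nat"
  obtain z where z: "z \<in> X" "\<And>z'. z' \<in> X \<Longrightarrow> ?f z \<le> ?f z'"
    using assms(1) ex_has_least_nat[of "\<lambda>z. z \<in> X" _ ?f] by blast
  have f: "real (?f (p, q)) = real p / real q * fact k" if "(p, q) \<in> X" for p q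
  proof -
    have "q dvd fact k" using assms(2)[OF that] by (intro dvd_fact) auto
    then show ?thesis by (simp add: real_of_nat_div)
  qed
  obtain p q where pq: "z = (p, q)" by fastforce
  show ?thesis
  proof (rule that[of p q])
    show "(p, q) \<in> X" using z pq by simp
    fix p' q' assume X: "(p', q') \<in> X"
    have "real (?f (p, q)) \<le> real (?f (p', q'))" using z(2)[OF X] pq by (simp only: of_nat_le_iff)
    then have "real p / real q * fact k \<le> real p' / real q' * fact k"
      using f[OF X] f[of p q] z(1) pq by simp
    then show "real p / real q \<le> real p' / real q'" by (rule mult_right_le_imp_le) simp
  qed
qed

lemma ev_powr_little_o:
  fixes C \<delta> :: real
  assumes "q < p" "\<delta> > 0"
  shows "\<forall>\<^sub>F \<epsilon> in at_right 0. C * \<epsilon> powr p \<le> \<delta> * \<epsilon> powr q"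
proof -
  have "((\<lambda>\<epsilon>::real. C * \<epsilon> powr (p - q)) \<longlongrightarrow> C * 0 powr (p - q)) (at_right 0)"
    using assms eventually_at_right_less[of "0::real"]
    by (intro tendsto_intros tendsto_powr') (auto elim: eventually_mono)
  then have "\<forall>\<^sub>F \<epsilon> in at_right 0. C * \<epsilon> powr (p - q) < \<delta>"
    using assms by (intro order_tendstoD(2)) auto
  then show ?thesis
    using eventually_at_right_less[of "0::real"]
  proof eventually_elim
    case (elim \<epsilon>)
    then have "C * \<epsilon> powr (p - q) * \<epsilon> powr q \<le> \<delta> * \<epsilon> powr q"
      by (intro mult_right_mono) auto
    moreover have "\<epsilon> powr (p - q) * \<epsilon> powr q = \<epsilon> powr p" by (simp flip: powr_add)
    ultimately show ?case by (simp add: mult.assoc)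
  qed
qed

lemma ev_abs_ln_ge: "\<forall>\<^sub>F \<epsilon>::real in at_right 0. \<bar>ln \<epsilon>\<bar> \<ge> X"
proof -
  have "filterlim (\<lambda>\<epsilon>::real. ln \<epsilon>) at_bot (at_right 0)" by (rule ln_at_0)
  then have "\<forall>\<^sub>F \<epsilon> in at_right 0. ln \<epsilon> \<le> - X" by (simp add: filterlim_at_bot)
  then show ?thesis by eventually_elim linarith
qed

context jet
begin

lemma taylor_nonzero_iff: "taylor_coeff (F 0 0) a b \<noteq> 0 \<longleftrightarrow> coef a b \<noteq> 0"
  by (simp add: taylor_coeff_eq coef_def)

abbreviation "NP \<equiv> newton_polygon (F 0 0)"
abbreviation "nd \<equiv> newton_distance (F 0 0)"

lemma coef_in_NP: "coef a b \<noteq> 0 \<Longrightarrow> (real a, real b) \<in> NP"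
  by (rule newton_polygon_quadrant) (auto simp: taylor_nonzero_iff)

lemma finite_type_from_qhom:
  fixes \<alpha> \<beta> :: real
  assumes "\<alpha> > 0" "\<beta> > 0" "K \<ge> 1"
    and supp: "\<And>a b. coef a b \<noteq> 0 \<Longrightarrow> a * \<alpha> + b * \<beta> \<ge> 1"
    and nz: "\<And>N u v. \<lbrakk>real N * \<alpha> > 1; real N * \<beta> > 1; (u, v) \<noteq> (0, 0)\<rbrakk> \<Longrightarrow>
      \<exists>k\<le>K. qhom \<alpha> \<beta> N k 0 u v \<noteq> 0 \<or> qhom \<alpha> \<beta> N 0 k u v \<noteq> 0"
  shows "\<exists>R. finite_type K R"
proof -
  obtain N :: nat where N: "real N > 1 / \<alpha> + 1 / \<beta>" using reals_Archimedean2 by blast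
  have "1 / \<alpha> > 0" "1 / \<beta> > 0" using assms by auto
  then have "1 / \<alpha> < N" "1 / \<beta> < N" using N by linarith+
  then have N: "real N * \<alpha> > 1" "real N * \<beta> > 1" using assms by (auto simp: field_simps)
  from derivatives_nonvanishing_near_0[OF assms(1,2) N supp nz[OF N]] show ?thesis
    using \<open>K \<ge> 1\<close> unfolding finite_type_def by blast
qed

lemma case_compact_edge:
  assumes sa: "superadapted (F 0 0)" and d1: "nd > 1" and bis: "bisectrix_in_compact_edge (F 0 0)"
  obtains K R where "finite_type K R" "real K < nd"
    "\<And>\<rho>. \<rho> > 0 \<Longrightarrow> \<exists>A>0. \<forall>\<^sub>F \<epsilon> in at_right 0.
      ennreal (A * \<epsilon> powr (1 / nd)) \<le> emeasure lborel (sublevel \<rho> \<epsilon>)"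
proof -
  obtain e where e: "e edge_of NP" "compact e" and D: "(nd, nd) \<in> rel_interior e"
    using bis unfolding bisectrix_in_compact_edge_def compact_edge_def bisectrix_point_def by blast
  obtain \<alpha>0 \<beta>0 s t :: real where pos: "\<alpha>0 \<ge> 0" "\<beta>0 \<ge> 0" "\<alpha>0 + \<beta>0 > 0" and st: "s > 0" "t > 0"
    and N: "\<And>x y. (x, y) \<in> NP \<Longrightarrow> (\<alpha>0 + \<beta>0) * nd \<le> \<alpha>0 * x + \<beta>0 * y"
    and line: "\<And>x y. (x, y) \<in> e \<Longrightarrow> \<alpha>0 * x + \<beta>0 * y = (\<alpha>0 + \<beta>0) * nd"
    and De: "(nd, nd) \<in> e" and ends: "(nd + s * \<beta>0, nd - s * \<alpha>0) \<in> e" "(nd - t * \<beta>0, nd + t * \<alpha>0) \<in> e"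
    using edge_through_bisectrix[OF e(1) D] by blast
  have face: "e face_of NP" using e by (simp add: edge_of_def)
  have eN: "e \<subseteq> NP" using face by (simp add: face_of_def)
  have pos': "\<alpha>0 > 0" "\<beta>0 > 0"
    using compact_edge_slope[OF face compact_imp_bounded[OF e(2)] De st ends pos] by auto
  \<comment> \<open>Dividing by the value at (nd, nd) makes the supporting line \<alpha> a + \<beta>
    b = 1; as it passes through that point, \<alpha> + \<beta> = 1 / nd.\<close>
  define c0 where "c0 = (\<alpha>0 + \<beta>0) * nd"
  have c0: "c0 > 0" using pos d1 by (simp add: c0_def)
  define \<alpha> where "\<alpha> = \<alpha>0 / c0"
  define \<beta> where "\<beta> = \<beta>0 / c0"
  have \<alpha>\<beta>: "\<alpha> > 0" "\<beta> > 0" using pos' c0 by (auto simp: \<alpha>_def \<beta>_def)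
  have scale: "x * \<alpha> + y * \<beta> = (\<alpha>0 * x + \<beta>0 * y) / c0" for x y
    by (simp add: \<alpha>_def \<beta>_def add_divide_distrib mult.commute)
  have sum: "\<alpha> + \<beta> = 1 / nd"
    using pos d1 by (simp add: \<alpha>_def \<beta>_def c0_def flip: add_divide_distrib)
  have supp: "a * \<alpha> + b * \<beta> \<ge> 1" if "coef a b \<noteq> 0" for a b :: nat
    using N[OF coef_in_NP[OF that]] c0 unfolding scale by (simp add: c0_def)
  have e1: "a * \<alpha> + b * \<beta> = 1" if "(real a, real b) \<in> e" for a b
    using line[OF that, folded c0_def] c0 unfolding scale by simp
  have e2: "(real a, real b) \<in> e" if ab: "coef a b \<noteq> 0" "a * \<alpha> + b * \<beta> = 1" for a b
  proof -
    have "\<alpha>0 * a + \<beta>0 * b = c0" using ab(2) c0 unfolding scale by simp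
    then have on: "\<alpha>0 * a + \<beta>0 * b = (\<alpha>0 + \<beta>0) * nd" by (simp only: c0_def)
    define r where "r = (a - nd) / \<beta>0"
    have a: "nd + r * \<beta>0 = a" using pos' by (simp add: r_def)
    have r: "r * \<beta>0 = a - nd" using pos' by (simp add: r_def)
    have "\<beta>0 * (nd - r * \<alpha>0) = \<beta>0 * nd - \<alpha>0 * (r * \<beta>0)" by (simp add: algebra_simps)
    then have "\<beta>0 * (nd - r * \<alpha>0) = \<beta>0 * b" using on unfolding r by (simp add: algebra_simps)
    then have b: "nd - r * \<alpha>0 = b" using pos' by simp
    have "(nd + r * \<beta>0, nd - r * \<alpha>0) \<in> e"
      by (rule edge_contains[OF face De st ends]) (use pos' coef_in_NP[OF ab(1)] a b in auto)
    then show ?thesis unfolding a b .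
  qed
  obtain K where K: "K \<ge> 1" "real K < nd" "\<And>n :: nat. real n < nd \<Longrightarrow> n \<le> K"
    using nat_ceiling_less[OF d1] by blast
  have supp0: "c0 \<le> \<alpha>0 * a + \<beta>0 * b" if "taylor_coeff (F 0 0) a b \<noteq> 0" for a b
    unfolding c0_def by (rule N) (use that coef_in_NP taylor_nonzero_iff in auto)
  \<comment> \<open>The edge extends strictly below the bisectrix point, which yields a monomial on
    the line with b < nd; the other direction yields one with a < nd. Being integers, these
    exponents are at most \<open>K\<close>.\<close>
  have "\<exists>a b. taylor_coeff (F 0 0) a b \<noteq> 0 \<and> \<alpha>0 * a + \<beta>0 * b = c0 \<and> 0 * real a + 1 * real b < nd"
    by (rule monomial_on_supporting_line[OF pos' supp0, where x = "nd + s * \<beta>0" and y = "nd - s * \<alpha>0"])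
       (use ends eN line[OF ends(1)] st pos' in \<open>auto simp: c0_def\<close>)
  then obtain A B where AB: "coef A B \<noteq> 0" "A * \<alpha> + B * \<beta> = 1" "real B < nd"
    using c0 unfolding scale taylor_nonzero_iff by auto
  have "\<exists>a b. taylor_coeff (F 0 0) a b \<noteq> 0 \<and> \<alpha>0 * a + \<beta>0 * b = c0 \<and> 1 * real a + 0 * real b < nd"
    by (rule monomial_on_supporting_line[OF pos' supp0, where x = "nd - t * \<beta>0" and y = "nd + t * \<alpha>0"])
       (use ends eN line[OF ends(2)] st pos' in \<open>auto simp: c0_def\<close>)
  then obtain A' B' where AB': "coef A' B' \<noteq> 0" "A' * \<alpha> + B' * \<beta> = 1" "real A' < nd"
    using c0 unfolding scale taylor_nonzero_iff by auto
  have order: "order y (edge_poly (F 0 0) e x) \<le> K"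
    if "x \<in> {1, -1}" "y \<noteq> 0" "poly (edge_poly (F 0 0) e x) y = 0" for x y
  proof (rule K(3))
    have "compact_edge (F 0 0) e" "bisectrix_point (F 0 0) \<in> e"
      using e De by (auto simp: compact_edge_def bisectrix_point_def)
    then have "\<forall>x\<in>{1, -1}. \<not> (\<exists>y. y \<noteq> 0 \<and> poly (edge_poly (F 0 0) e x) y = 0 \<and>
        real (order y (edge_poly (F 0 0) e x)) \<ge> nd)"
      using sa unfolding superadapted_def by blast
    then show "real (order y (edge_poly (F 0 0) e x)) < nd"
      using that by (meson not_less)
  qed
  have "\<exists>R. finite_type K R"
  proof (rule finite_type_from_qhom[OF \<alpha>\<beta> K(1)])
    show "1 \<le> a * \<alpha> + b * \<beta>" if "coef a b \<noteq> 0" for a b using supp[OF that] .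
    show "\<exists>k\<le>K. qhom \<alpha> \<beta> N k 0 u v \<noteq> 0 \<or> qhom \<alpha> \<beta> N 0 k u v \<noteq> 0"
      if "1 < real N * \<alpha>" "1 < real N * \<beta>" "(u, v) \<noteq> (0, 0)" for N u v
      by (rule nondegenerate_edge[OF \<alpha>\<beta>, where e = e and A = A and B = B and A' = A' and B' = B'])
        (fact that e1 e2 AB AB' K(3)[OF AB(3)] K(3)[OF AB'(3)] order)+
  qed
  moreover have "\<exists>A>0. \<forall>\<^sub>F \<epsilon> in at_right 0.
      ennreal (A * \<epsilon> powr (1 / nd)) \<le> emeasure lborel (sublevel \<rho> \<epsilon>)" if "\<rho> > 0" for \<rho>
    unfolding sum[symmetric] by (rule rectangle_lower_bound[OF \<alpha>\<beta> _ that]) (rule supp)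
  ultimately show ?thesis using K(2) that by blast
qed

end

section \<open>The bisectrix at a vertex\<close>

context jet
begin

text \<open>A weight m supports N(S) at (k, k) if it is at most (a - k) / (k - b) for monomials
  below and to the right, and at least (k - a) / (b - k) for those above and to the left.
  Extremality makes each lower bound strictly smaller than each upper bound; since the extreme
  bounds are attained, an interval of positive length remains.\<close>

lemma vertex_weights:
  assumes vertex: "bisectrix_at_vertex (F 0 0)"
  obtains k :: nat and m2 m1 :: real where "nd = real k" "coef k k \<noteq> 0" "0 < m2" "m2 < m1"
    "\<And>a b m. coef a b \<noteq> 0 \<Longrightarrow> m2 \<le> m \<Longrightarrow> m \<le> m1 \<Longrightarrow> 0 \<le> (real a - nd) + m * (real b - nd)"
    "\<And>a b. \<lbrakk>coef a b \<noteq> 0; real a \<le> nd; real b \<le> nd\<rbrakk> \<Longrightarrow> a = k \<and> b = k"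
proof -
  define D where "D = (nd, nd)"
  have ext: "D extreme_point_of NP"
    using vertex by (simp add: bisectrix_at_vertex_def bisectrix_point_def D_def)
  then have DN: "D \<in> NP" and noseg: "\<And>p q. p \<in> NP \<Longrightarrow> q \<in> NP \<Longrightarrow> D \<notin> open_segment p q"
    by (auto simp: extreme_point_of_def)
  have below: "x = nd \<and> y = nd" if xy: "(x, y) \<in> NP" "x \<le> nd" "y \<le> nd" for x y
  proof (rule ccontr)
    assume "\<not> (x = nd \<and> y = nd)"
    then have w: "(nd - x, nd - y) \<noteq> 0" by (auto simp: zero_prod_def)
    have "D \<in> open_segment (D + 1 *\<^sub>R (nd - x, nd - y)) (D - 1 *\<^sub>R (nd - x, nd - y))"
      using w by (intro mem_open_segment_between) auto
    moreover have "D - 1 *\<^sub>R (nd - x, nd - y) \<in> NP" using xy by (simp add: D_def)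
    moreover have "D + 1 *\<^sub>R (nd - x, nd - y) \<in> NP"
      using newton_polygon_upward[OF DN[unfolded D_def], of "nd + (nd - x)" "nd + (nd - y)"] xy
      by (simp add: D_def)
    ultimately show False using noseg by blast
  qed
  \<comment> \<open>An extreme point of a hull belongs to the generating set, here to some quadrant;
    by \<open>below\<close> it must be the corner of that quadrant, so it is a lattice
    point.\<close>
  have "D \<in> (\<Union>(a, b) \<in> {(a, b). taylor_coeff (F 0 0) a b \<noteq> 0}. {(t1, t2). t1 \<ge> real a \<and> t2 \<ge> real b})"
    by (rule extreme_point_of_convex_hull) (use ext in \<open>simp add: newton_polygon_def\<close>)
  then obtain k l where kl: "coef k l \<noteq> 0" "real k \<le> nd" "real l \<le> nd"
    by (auto simp: D_def taylor_nonzero_iff)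
  then have k: "nd = real k" "l = k" using below[OF coef_in_NP[OF kl(1)]] by auto
  have only: "a = k \<and> b = k" if "coef a b \<noteq> 0" "real a \<le> nd" "real b \<le> nd" for a b
    using below[OF coef_in_NP[OF that(1)] that(2,3)] k by simp
  text \<open>Pairs \<open>(p, q)\<close> stand for the fractions \<open>p / q\<close>: the admissible weights \<open>m\<close> are bounded above
    by those in \<open>P\<close> and below by the reciprocals of those in \<open>Q\<close>.\<close>
  define P where "P = {(a - k, k - b) | a b. coef a b \<noteq> 0 \<and> b < k}"
  define Q where "Q = {(b - k, k - a) | a b. coef a b \<noteq> 0 \<and> a < k}"
  \<comment> \<open>Otherwise the monomial would lie to the lower left of (k, k). Hence the natural
    number subtractions in \<open>P\<close> and \<open>Q\<close> never truncate.\<close>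
  have Pa: "k < a" if "coef a b \<noteq> 0" "b < k" for a b
    using only[OF that(1)] that(2) k by (metis leI less_imp_le of_nat_le_iff less_irrefl)
  have Qb: "k < b" if "coef a b \<noteq> 0" "a < k" for a b
    using only[OF that(1)] that(2) k by (metis leI less_imp_le of_nat_le_iff less_irrefl)
  have cross: "(real k - a') * (real k - b) < (real a - k) * (real b' - k)"
    if P: "coef a b \<noteq> 0" "b < k" and Q: "coef a' b' \<noteq> 0" "a' < k" for a b a' b'
  proof (rule ccontr)
    assume le: "\<not> ?thesis"
    have a: "k < a" and b': "k < b'" using Pa[OF P] Qb[OF Q] by auto
    define u where "u = (real k - b) / (real b' - b)"
    have u: "0 < u" "u < 1" using P b' by (auto simp: u_def)
    \<comment> \<open>The point of the segment joining the two monomials at height k. If the strict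
      inequality failed, x would be at most k, hence equal to k, and (k, k) would be interior to the
      segment.\<close>
    define x where "x = (1 - u) * a + u * a'"
    have ub: "(real b' - b) * u = real k - b" using P b' by (simp add: u_def)
    have "(1 - u) * b + u * b' = b + (real b' - b) * u" by (simp add: algebra_simps)
    then have y: "(1 - u) * b + u * b' = k" unfolding ub by simp
    have "(real b' - b) * (x - k) = (real a - k) * (real b' - k) - (real k - a') * (real k - b)"
    proof -
      have "(real b' - b) * (x - k) = (real b' - b) * (real a - real k) - ((real b' - b) * u) * (real a - a')"
        by (simp add: x_def algebra_simps)
      then show ?thesis unfolding ub by (simp add: algebra_simps)
    qed
    then have "(real b' - b) * (x - k) \<le> 0" using le by simp
    moreover have "real b' - b > 0" using P b' by simp
    ultimately have x: "x \<le> k" by (simp add: mult_le_0_iff)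
    have seg: "(1 - u) *\<^sub>R (real a, real b) + u *\<^sub>R (real a', real b') = (x, real k)"
      using y by (simp add: x_def)
    have "(1 - u) *\<^sub>R (real a, real b) + u *\<^sub>R (real a', real b') \<in> NP"
      by (rule convexD[OF convex_newton_polygon]) (use u P Q coef_in_NP in auto)
    then have "x = k" using below[of x "real k"] x k unfolding seg by simp
    then have "D = (1 - u) *\<^sub>R (real a, real b) + u *\<^sub>R (real a', real b')"
      using seg k by (simp add: D_def)
    moreover have "(real a, real b) \<noteq> (real a', real b')" using P b' by auto
    ultimately have "D \<in> open_segment (real a, real b) (real a', real b')"
      using u unfolding in_segment by blast
    then show False using noseg coef_in_NP P Q by blast
  qed
  have sides: "0 \<le> (real a - nd) + m * (real b - nd)"
    if m: "m > 0" and ab: "coef a b \<noteq> 0"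
      and Pm: "\<And>p q. (p, q) \<in> P \<Longrightarrow> m \<le> real p / real q"
      and Qm: "\<And>p q. (p, q) \<in> Q \<Longrightarrow> 1 / m \<le> real p / real q" for m a b
  proof -
    consider "b < k" | "a < k" "k < b" | "k \<le> a" "k \<le> b" using Qb[OF ab] by linarith
    then show ?thesis
    proof cases
      case 1
      then have "m \<le> real (a - k) / real (k - b)" using ab by (intro Pm) (auto simp: P_def)
      then show ?thesis using 1 Pa[OF ab 1] k by (simp add: of_nat_diff field_simps)
    next
      case 2
      then have "1 / m \<le> real (b - k) / real (k - a)" using ab by (intro Qm) (auto simp: Q_def)
      then show ?thesis using 2 m k by (simp add: of_nat_diff field_simps)
    next
      case 3
      then show ?thesis using m k by simp
    qed
  qed
  have Pq: "1 \<le> q \<and> q \<le> k" "0 < p" if "(p, q) \<in> P" for p q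
    using that Pa by (auto simp: P_def)
  have Qq: "1 \<le> q \<and> q \<le> k" "0 < p" if "(p, q) \<in> Q" for p q
    using that Qb by (auto simp: Q_def)
  have PQ: "real q' / real p' < real p / real q" if pq: "(p, q) \<in> P" "(p', q') \<in> Q" for p q p' q'
  proof -
    obtain a b where ab: "p = a - k" "q = k - b" "coef a b \<noteq> 0" "b < k" using pq(1) unfolding P_def by blast
    obtain a' b' where ab': "p' = b' - k" "q' = k - a'" "coef a' b' \<noteq> 0" "a' < k" using pq(2) unfolding Q_def by blast
    have "real q' * real q < real p * real p'"
      using cross[OF ab(3,4) ab'(3,4)] ab ab' Pa[OF ab(3,4)] Qb[OF ab'(3,4)] by (simp add: of_nat_diff)
    then show ?thesis using Pq[OF pq(1)] Qq[OF pq(2)] by (simp add: field_simps)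
  qed
  obtain m1 m2 where m: "0 < m2" "m2 < m1"
    and Pm: "\<And>p q. (p, q) \<in> P \<Longrightarrow> m1 \<le> real p / real q"
    and Qm: "\<And>p q. (p, q) \<in> Q \<Longrightarrow> 1 / m2 \<le> real p / real q"
  proof (cases "P = {}")
    case True
    show ?thesis
    proof (cases "Q = {}")
      case True
      \<comment> \<open>A missing bound is replaced by an arbitrary value: 1 and 2 here, twice or
        half the existing bound in the next cases.\<close>
      with \<open>P = {}\<close> show ?thesis by (intro that[of 1 2]) auto
    next
      case False
      obtain p q where pq: "(p, q) \<in> Q" "\<And>p' q'. (p', q') \<in> Q \<Longrightarrow> real p / real q \<le> real p' / real q'"
        by (rule fractions_attain_minimum[OF False, of k]) (erule Qq(1), blast)
      define l where "l = real q / real p"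
      have "l > 0" "1 / l = real p / real q" using Qq[OF pq(1)] by (auto simp: l_def)
      then show ?thesis
        by (intro that[of l "2 * l"]) (use \<open>P = {}\<close> pq(2) in auto)
    qed
  next
    case False
    obtain p q where pq: "(p, q) \<in> P" "\<And>p' q'. (p', q') \<in> P \<Longrightarrow> real p / real q \<le> real p' / real q'"
      by (rule fractions_attain_minimum[OF False, of k]) (erule Pq(1), blast)
    show ?thesis
    proof (cases "Q = {}")
      case True
      define r where "r = real p / real q"
      have "r > 0" using Pq[OF pq(1)] by (auto simp: r_def)
      then show ?thesis
        by (intro that[of "r / 2" r]) (use True pq(2) in \<open>auto simp: r_def\<close>)
    next
      case False
      obtain p' q' where pq': "(p', q') \<in> Q" "\<And>p q. (p, q) \<in> Q \<Longrightarrow> real p' / real q' \<le> real p / real q"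
        by (rule fractions_attain_minimum[OF False, of k]) (erule Qq(1), blast)
      show ?thesis
        by (rule that[of "real q' / real p'" "real p / real q"])
          (use Qq[OF pq'(1)] PQ[OF pq(1) pq'(1)] pq(2) pq'(2) in auto)
    qed
  qed
  have between: "0 \<le> (real a - nd) + m * (real b - nd)" if "coef a b \<noteq> 0" "m2 \<le> m" "m \<le> m1" for a b m
  proof (rule sides)
    show "m \<le> real p / real q" if "(p, q) \<in> P" for p q using Pm[OF that] \<open>m \<le> m1\<close> by simp
    show "1 / m \<le> real p / real q" if "(p, q) \<in> Q" for p q
    proof -
      have "1 / m \<le> 1 / m2" using m \<open>m2 \<le> m\<close> by (simp add: frac_le)
      then show ?thesis using Qm[OF that] by simp
    qed
  qed (use that m in auto)
  show ?thesis
    by (rule that[of k m2 m1]) (fact k(1) kl(1)[unfolded k(2)] m between only)+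
qed

lemma case_vertex:
  assumes d1: "nd > 1" and vertex: "bisectrix_at_vertex (F 0 0)"
  obtains K R where "finite_type K R" "nd = real K"
    "\<And>\<rho>. \<rho> > 0 \<Longrightarrow> \<exists>A>0. \<forall>\<^sub>F \<epsilon> in at_right 0.
      ennreal (A * (\<bar>ln \<epsilon>\<bar> * \<epsilon> powr (1 / nd))) \<le> emeasure lborel (sublevel \<rho> \<epsilon>)"
proof -
  obtain k :: nat and m2 m1 :: real where k: "nd = real k" "coef k k \<noteq> 0" and m: "0 < m2" "m2 < m1"
    and supp: "\<And>a b m. coef a b \<noteq> 0 \<Longrightarrow> m2 \<le> m \<Longrightarrow> m \<le> m1 \<Longrightarrow> 0 \<le> (real a - nd) + m * (real b - nd)"
    and only: "\<And>a b. \<lbrakk>coef a b \<noteq> 0; real a \<le> nd; real b \<le> nd\<rbrakk> \<Longrightarrow> a = k \<and> b = k"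
  proof (rule vertex_weights[OF vertex], goal_cases)
    case (1 k m2 m1)
    from 1(2-) show ?case by (rule 1(1))
  qed
  \<comment> \<open>The ends of the interval serve the area bound. The midpoint gives a line that
    touches the support at (k, k) only, which makes the leading part a single monomial.\<close>
  define m where "m = (m1 + m2) / 2"
  have m12: "m2 < m" "m < m1" "m > 0" using m by (auto simp: m_def)
  define c0 where "c0 = nd * (1 + m)"
  have c0: "c0 > 0" using d1 m12 by (simp add: c0_def)
  define \<alpha> where "\<alpha> = 1 / c0"
  define \<beta> where "\<beta> = m / c0"
  have \<alpha>\<beta>: "\<alpha> > 0" "\<beta> > 0" using c0 m12 by (auto simp: \<alpha>_def \<beta>_def)
  have scale: "x * \<alpha> + y * \<beta> = (x + m * y) / c0" for x y
    by (simp add: \<alpha>_def \<beta>_def add_divide_distrib mult.commute)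
  have supp1: "a * \<alpha> + b * \<beta> \<ge> 1" if "coef a b \<noteq> 0" for a b :: nat
    using supp[OF that, of m] m12 c0 unfolding scale by (simp add: c0_def algebra_simps)
  have on: "k * \<alpha> + k * \<beta> = 1" using c0 unfolding scale c0_def k by (simp add: algebra_simps)
  have strict: "a * \<alpha> + b * \<beta> \<noteq> 1" if ab: "coef a b \<noteq> 0" "(a, b) \<noteq> (k, k)" for a b :: nat
  proof
    assume "a * \<alpha> + b * \<beta> = 1"
    then have "a + m * b = c0" using c0 unfolding scale by simp
    then have eq: "(real a - nd) + m * (real b - nd) = 0" by (simp add: c0_def algebra_simps)
    have "0 \<le> (real a - nd) + m1 * (real b - nd)" "0 \<le> (real a - nd) + m2 * (real b - nd)"
      using supp[OF ab(1)] m by auto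
    \<comment> \<open>An affine function of the weight that is nonnegative at both ends and zero in
      between is constant, so b = nd.\<close>
    then have "0 \<le> (m1 - m) * (real b - nd)" "(m - m2) * (real b - nd) \<le> 0"
      using eq by (auto simp: algebra_simps)
    then have "real b = nd" using m12 by (simp add: zero_le_mult_iff mult_le_0_iff)
    moreover from this have "real a = nd" using eq by simp
    ultimately show False using ab only by simp
  qed
  have "k \<ge> 1" using d1 k by simp
  have "\<exists>R. finite_type k R"
  proof (rule finite_type_from_qhom[OF \<alpha>\<beta> \<open>k \<ge> 1\<close>])
    show "1 \<le> a * \<alpha> + b * \<beta>" if "coef a b \<noteq> 0" for a b using supp1[OF that] .
    show "\<exists>i\<le>k. qhom \<alpha> \<beta> N i 0 u v \<noteq> 0 \<or> qhom \<alpha> \<beta> N 0 i u v \<noteq> 0"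
      if "1 < real N * \<alpha>" "1 < real N * \<beta>" "(u, v) \<noteq> (0, 0)" for N u v
      by (rule nondegenerate_vertex[OF \<alpha>\<beta>, where A = k and B = k])
        (fact that k(2) on order.refl strict)+
  qed
  moreover have "\<exists>A>0. \<forall>\<^sub>F \<epsilon> in at_right 0.
      ennreal (A * (\<bar>ln \<epsilon>\<bar> * \<epsilon> powr (1 / nd))) \<le> emeasure lborel (sublevel \<rho> \<epsilon>)" if "\<rho> > 0" for \<rho>
  proof (rule vertex_lower_bound[OF _ m])
    show "nd * (1 + m1) \<le> a + m1 * b" if "coef a b \<noteq> 0" for a b
      using supp[OF that, of m1] m by (simp add: algebra_simps)
    show "nd * (1 + m2) \<le> a + m2 * b" if "coef a b \<noteq> 0" for a b
      using supp[OF that, of m2] m by (simp add: algebra_simps)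
  qed (use d1 that in auto)
  ultimately show ?thesis using that k by blast
qed

end

section \<open>The bisectrix inside an unbounded ray\<close>

context jet
begin

text \<open>Used for rays, where (A, B) is the vertex at which the ray starts. The weights are
  unrelated to the bisectrix, and \<open>max A B\<close> may be larger than d.\<close>

lemma finite_type_strict_vertex:
  fixes m1 m2 :: real
  assumes m: "m1 > 0" "m2 > 0" and AB: "coef A B \<noteq> 0" "1 \<le> max A B"
    and strict: "\<And>a b. coef a b \<noteq> 0 \<Longrightarrow> (a, b) \<noteq> (A, B) \<Longrightarrow> m1 * A + m2 * B < m1 * a + m2 * b"
  shows "\<exists>R. finite_type (max A B) R"
proof -
  define c0 where "c0 = m1 * A + m2 * B"
  have "m1 * A \<ge> 0" "m2 * B \<ge> 0" using m by auto
  moreover have "A \<ge> 1 \<or> B \<ge> 1" using AB(2) by (simp add: le_max_iff_disj)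
  then have "m1 * A > 0 \<or> m2 * B > 0" using m by auto
  ultimately have c0: "c0 > 0" unfolding c0_def by linarith
  have pos: "m1 / c0 > 0" "m2 / c0 > 0" using m c0 by auto
  have scale: "x * (m1 / c0) + y * (m2 / c0) = (m1 * x + m2 * y) / c0" for x y
    by (simp add: add_divide_distrib mult.commute)
  have on: "A * (m1 / c0) + B * (m2 / c0) = 1" using c0 unfolding scale c0_def[symmetric] by simp
  have gt: "1 < a * (m1 / c0) + b * (m2 / c0)" if "coef a b \<noteq> 0" "(a, b) \<noteq> (A, B)" for a b :: nat
    using strict[OF that] c0 unfolding scale c0_def[symmetric] by simp
  show ?thesis
  proof (rule finite_type_from_qhom[OF pos AB(2)])
    show "1 \<le> a * (m1 / c0) + b * (m2 / c0)" if "coef a b \<noteq> 0" for a b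
      using gt[OF that] on by (cases "(a, b) = (A, B)") auto
    show "\<exists>i\<le>max A B. qhom (m1 / c0) (m2 / c0) N i 0 u v \<noteq> 0 \<or> qhom (m1 / c0) (m2 / c0) N 0 i u v \<noteq> 0"
      if "1 < real N * (m1 / c0)" "1 < real N * (m2 / c0)" "(u, v) \<noteq> (0, 0)" for N u v
    proof (rule nondegenerate_vertex[OF pos that(1,2) AB(1) on max.cobounded1 max.cobounded2 _ that(3)])
      show "a * (m1 / c0) + b * (m2 / c0) \<noteq> 1" if "coef a b \<noteq> 0" "(a, b) \<noteq> (A, B)" for a b
        using gt[OF that] by simp
    qed
  qed
qed

lemma case_unbounded_ray:
  assumes d1: "nd > 1" and bis: "bisectrix_in_unbounded_ray (F 0 0)"
  shows "\<exists>K R. finite_type K R \<and> (\<forall>\<rho>>0. \<forall>\<delta>>0. \<exists>A>0. \<forall>\<^sub>F \<epsilon> in at_right 0.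
      ennreal (A * \<epsilon> powr (1 / nd + \<delta>)) \<le> emeasure lborel (sublevel \<rho> \<epsilon>))"
proof -
  obtain e where e: "e edge_of NP" "\<not> bounded e" and D: "(nd, nd) \<in> rel_interior e"
    using bis unfolding bisectrix_in_unbounded_ray_def unbounded_ray_def bisectrix_point_def by blast
  obtain \<alpha> \<beta> :: real where pos: "\<alpha> \<ge> 0" "\<beta> \<ge> 0" "\<alpha> + \<beta> > 0"
    and N: "\<And>x y. (x, y) \<in> NP \<Longrightarrow> (\<alpha> + \<beta>) * nd \<le> \<alpha> * x + \<beta> * y"
    and line: "\<And>x y. (x, y) \<in> e \<Longrightarrow> \<alpha> * x + \<beta> * y = (\<alpha> + \<beta>) * nd"
    and De: "(nd, nd) \<in> e"
  proof (rule edge_through_bisectrix[OF e(1) D], goal_cases)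
    case (1 \<alpha> \<beta> s t)
    show ?case by (rule 1(1)[OF 1(2-4,7-9)])
  qed
  have eN: "e \<subseteq> NP" using e(1) by (rule edge_of_imp_subset)
  have DN: "(nd, nd) \<in> NP" using De eN by blast
  have "\<alpha> = 0 \<or> \<beta> = 0"
  proof (rule ccontr)
    assume "\<not> ?thesis"
    then have ab: "\<alpha> > 0" "\<beta> > 0" using pos by auto
    have "e \<subseteq> {0..(\<alpha> + \<beta>) * nd / \<alpha>} \<times> {0..(\<alpha> + \<beta>) * nd / \<beta>}"
    proof clarify
      fix x y assume xy: "(x, y) \<in> e"
      then have nn: "0 \<le> x" "0 \<le> y" using newton_polygon_nonneg[of x y "F 0 0"] eN by auto
      have "\<alpha> * x \<ge> 0" "\<beta> * y \<ge> 0" using ab nn by auto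
      then have "\<alpha> * x \<le> (\<alpha> + \<beta>) * nd" "\<beta> * y \<le> (\<alpha> + \<beta>) * nd" using line[OF xy] by linarith+
      then show "x \<in> {0..(\<alpha> + \<beta>) * nd / \<alpha>} \<and> y \<in> {0..(\<alpha> + \<beta>) * nd / \<beta>}"
        using nn ab by (simp add: pos_le_divide_eq mult.commute)
    qed
    then have "bounded e" by (rule bounded_subset[rotated]) (intro bounded_Times bounded_closed_interval)
    with e(2) show False by simp
  qed
  then show ?thesis
  proof
    assume a0: "\<alpha> = 0"
    have y_ge: "nd \<le> y" if "(x, y) \<in> NP" for x y using N[OF that] pos a0 by simp
    \<comment> \<open>If all monomials were strictly above height nd, so would be their hull, and
      (nd, nd) would not belong to it. Hence nd is an integer.\<close>
    have "\<exists>a b. coef a b \<noteq> 0 \<and> real b \<le> nd"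
    proof (rule ccontr)
      assume contr: "\<not> ?thesis"
      have "NP \<subseteq> {p. nd < (0, 1) \<bullet> p}"
        by (rule newton_polygon_subset[OF convex_halfspace_gt])
          (use contr taylor_nonzero_iff in \<open>fastforce simp: not_le\<close>)
      with DN show False by auto
    qed
    then obtain a1 k where k: "coef a1 k \<noteq> 0" "real k \<le> nd" by blast
    then have nd: "nd = k" using y_ge[OF coef_in_NP] by force
    define a0 where "a0 = (LEAST a. coef a k \<noteq> 0)"
    have a0: "coef a0 k \<noteq> 0" unfolding a0_def by (rule LeastI[of "\<lambda>a. coef a k \<noteq> 0", OF k(1)])
    have a0_le: "a0 \<le> a" if "coef a k \<noteq> 0" for a unfolding a0_def by (rule Least_le[of "\<lambda>a. coef a k \<noteq> 0", OF that])
    have kb: "k \<le> b" if "coef a b \<noteq> 0" for a b using y_ge[OF coef_in_NP[OF that]] nd by simp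
    have "\<exists>R. finite_type (max a0 k) R"
    \<comment> \<open>With weight 1 + a0 on the rows, moving up one row costs more than the a0 that
      could be saved horizontally.\<close>
    proof (rule finite_type_strict_vertex[of 1 "1 + real a0"])
      fix a b assume ab: "coef a b \<noteq> 0" "(a, b) \<noteq> (a0, k)"
      show "1 * real a0 + (1 + real a0) * real k < 1 * real a + (1 + real a0) * real b"
      proof (cases "b = k")
        case True
        then show ?thesis using a0_le[of a] ab by force
      next
        case False
        then have "real k + 1 \<le> real b" using kb[OF ab(1)] by linarith
        then have "(1 + real a0) * (real k + 1) \<le> (1 + real a0) * real b" by (intro mult_left_mono) auto
        then show ?thesis by (simp add: algebra_simps)
      qed
    qed (use a0 nd d1 in auto)
    moreover have "\<exists>A>0. \<forall>\<^sub>F \<epsilon> in at_right 0.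
        ennreal (A * \<epsilon> powr (1 / nd + \<delta>)) \<le> emeasure lborel (sublevel \<rho> \<epsilon>)"
      if "\<rho> > 0" "\<delta> > 0" for \<rho> \<delta>
    proof -
      have "1 \<le> a * \<delta> + b * (1 / nd)" if "coef a b \<noteq> 0" for a b
      proof -
        have "1 \<le> b * (1 / nd)" using kb[OF that] nd d1 by simp
        moreover have "0 \<le> a * \<delta>" using \<open>\<delta> > 0\<close> by simp
        ultimately show ?thesis by linarith
      qed
      from rectangle_lower_bound[OF that(2) _ this that(1)] show ?thesis
        using d1 by (simp add: add.commute)
    qed
    ultimately show ?thesis by blast
  next
    assume b0: "\<beta> = 0"
    have x_ge: "nd \<le> x" if "(x, y) \<in> NP" for x y using N[OF that] pos b0 by simp
    have "\<exists>a b. coef a b \<noteq> 0 \<and> real a \<le> nd"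
    proof (rule ccontr)
      assume contr: "\<not> ?thesis"
      have "NP \<subseteq> {p. nd < (1, 0) \<bullet> p}"
        by (rule newton_polygon_subset[OF convex_halfspace_gt])
          (use contr taylor_nonzero_iff in \<open>fastforce simp: not_le\<close>)
      with DN show False by auto
    qed
    then obtain k b1 where k: "coef k b1 \<noteq> 0" "real k \<le> nd" by blast
    then have nd: "nd = k" using x_ge[OF coef_in_NP] by force
    define b0 where "b0 = (LEAST b. coef k b \<noteq> 0)"
    have b0: "coef k b0 \<noteq> 0" unfolding b0_def by (rule LeastI[of "\<lambda>b. coef k b \<noteq> 0", OF k(1)])
    have b0_le: "b0 \<le> b" if "coef k b \<noteq> 0" for b unfolding b0_def by (rule Least_le[of "\<lambda>b. coef k b \<noteq> 0", OF that])
    have ka: "k \<le> a" if "coef a b \<noteq> 0" for a b using x_ge[OF coef_in_NP[OF that]] nd by simp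
    have "\<exists>R. finite_type (max k b0) R"
    proof (rule finite_type_strict_vertex[of "1 + real b0" 1])
      fix a b assume ab: "coef a b \<noteq> 0" "(a, b) \<noteq> (k, b0)"
      show "(1 + real b0) * real k + 1 * real b0 < (1 + real b0) * real a + 1 * real b"
      proof (cases "a = k")
        case True
        then show ?thesis using b0_le[of b] ab by force
      next
        case False
        then have "real k + 1 \<le> real a" using ka[OF ab(1)] by linarith
        then have "(1 + real b0) * (real k + 1) \<le> (1 + real b0) * real a" by (intro mult_left_mono) auto
        then show ?thesis by (simp add: algebra_simps)
      qed
    qed (use b0 nd d1 in auto)
    moreover have "\<exists>A>0. \<forall>\<^sub>F \<epsilon> in at_right 0.
        ennreal (A * \<epsilon> powr (1 / nd + \<delta>)) \<le> emeasure lborel (sublevel \<rho> \<epsilon>)"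
      if "\<rho> > 0" "\<delta> > 0" for \<rho> \<delta>
    proof -
      have "1 \<le> a * (1 / nd) + b * \<delta>" if "coef a b \<noteq> 0" for a b
      proof -
        have "1 \<le> a * (1 / nd)" using ka[OF that] nd d1 by simp
        moreover have "0 \<le> b * \<delta>" using \<open>\<delta> > 0\<close> by simp
        ultimately show ?thesis by linarith
      qed
      from rectangle_lower_bound[OF _ that(2) this that(1)] show ?thesis
        using d1 by simp
    qed
    ultimately show ?thesis by blast
  qed
qed

section \<open>Conclusion of the three cases and choice of the neighbourhood\<close>

definition bump :: "real \<Rightarrow> (real \<times> real \<Rightarrow> real) \<Rightarrow> bool" where
  "bump R \<phi> \<longleftrightarrow> continuous_on UNIV \<phi> \<and> compact (supp \<phi>) \<and> supp \<phi> \<subseteq> ball 0 R \<and> \<phi> 0 \<noteq> 0"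

lemma bump_mono: "bump R \<phi> \<Longrightarrow> R \<le> R' \<Longrightarrow> bump R' \<phi>"
  unfolding bump_def using subset_ball by blast

lemma level_integral_compact_edge:
  assumes "superadapted (F 0 0)" "nd > 1" "bisectrix_in_compact_edge (F 0 0)"
  shows "\<exists>R>0. \<forall>\<phi>. bump R \<phi> \<longrightarrow> (\<exists>A>0. \<forall>\<^sub>F \<epsilon> in at_right 0.
    sgn (\<phi> 0) * abs_level_integral (F 0 0) \<phi> \<epsilon> > A * \<epsilon> powr (1 / nd))"
proof -
  obtain K R where ft: "finite_type K R" and K: "real K < nd"
    and lower: "\<And>\<rho>. \<rho> > 0 \<Longrightarrow> \<exists>A>0. \<forall>\<^sub>F \<epsilon> in at_right 0.
      ennreal (A * \<epsilon> powr (1 / nd)) \<le> emeasure lborel (sublevel \<rho> \<epsilon>)"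
  proof (rule case_compact_edge[OF assms], goal_cases)
    case (1 K R)
    from 1(2-) show ?case by (rule 1(1))
  qed
  have R: "R > 0" "K \<ge> 1" using ft by (auto simp: finite_type_def)
  have L: "\<forall>\<^sub>F \<epsilon>::real in at_right 0. \<epsilon> powr (1 / nd) > 0"
    using eventually_at_right_less[of "0::real"] by eventually_elim simp
  have "1 / nd < 1 / real K" using K R by (intro divide_strict_left_mono) auto
  note small = ev_powr_little_o[OF this]
  have "\<exists>A>0. \<forall>\<^sub>F \<epsilon> in at_right 0. sgn (\<phi> 0) * abs_level_integral (F 0 0) \<phi> \<epsilon> > A * \<epsilon> powr (1 / nd)"
    if "bump R \<phi>" for \<phi>
    by (rule level_integral_lower[OF ft _ _ _ _ lower L small]) (use that in \<open>simp_all add: bump_def\<close>)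
  then show ?thesis using R by blast
qed

lemma level_integral_vertex:
  assumes "nd > 1" "bisectrix_at_vertex (F 0 0)"
  shows "\<exists>R>0. \<forall>\<phi>. bump R \<phi> \<longrightarrow> (\<exists>A>0. \<forall>\<^sub>F \<epsilon> in at_right 0.
    sgn (\<phi> 0) * abs_level_integral (F 0 0) \<phi> \<epsilon> > A * (\<bar>ln \<epsilon>\<bar> * \<epsilon> powr (1 / nd)))"
proof -
  obtain K R where ft: "finite_type K R" and K: "nd = real K"
    and lower: "\<And>\<rho>. \<rho> > 0 \<Longrightarrow> \<exists>A>0. \<forall>\<^sub>F \<epsilon> in at_right 0.
      ennreal (A * (\<bar>ln \<epsilon>\<bar> * \<epsilon> powr (1 / nd))) \<le> emeasure lborel (sublevel \<rho> \<epsilon>)"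
  proof (rule case_vertex[OF assms], goal_cases)
    case (1 K R)
    from 1(2-) show ?case by (rule 1(1))
  qed
  have R: "R > 0" using ft by (simp add: finite_type_def)
  have L: "\<forall>\<^sub>F \<epsilon>::real in at_right 0. \<bar>ln \<epsilon>\<bar> * \<epsilon> powr (1 / nd) > 0"
    using eventually_at_right_less[of "0::real"] ev_abs_ln_ge[of 1]
  proof eventually_elim
    case (elim \<epsilon>)
    then have "\<bar>ln \<epsilon>\<bar> > 0" by linarith
    with elim show ?case by simp
  qed
  \<comment> \<open>Both powers of \<epsilon> have exponent 1 / nd here; the growth of |ln
    \<epsilon>| alone makes the outer part smaller.\<close>
  have small: "\<forall>\<^sub>F \<epsilon>::real in at_right 0. C * \<epsilon> powr (1 / real K) \<le> \<delta> * (\<bar>ln \<epsilon>\<bar> * \<epsilon> powr (1 / nd))"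
    if "\<delta> > 0" for C \<delta> :: real
    using ev_abs_ln_ge[of "C / \<delta>"]
  proof eventually_elim
    case (elim \<epsilon>)
    then have "C \<le> \<delta> * \<bar>ln \<epsilon>\<bar>" using that by (simp add: pos_divide_le_eq mult.commute)
    then have "C * \<epsilon> powr (1 / nd) \<le> \<delta> * \<bar>ln \<epsilon>\<bar> * \<epsilon> powr (1 / nd)" by (rule mult_right_mono) simp
    then show ?case by (simp add: K mult.assoc)
  qed
  show ?thesis
    by (intro exI[of _ R] conjI allI impI R level_integral_lower[OF ft _ _ _ _ lower L small])
      (auto simp: bump_def)
qed

lemma level_integral_unbounded_ray:
  assumes "nd > 1" "bisectrix_in_unbounded_ray (F 0 0)"
  shows "\<exists>R>0. \<forall>\<phi>. bump R \<phi> \<longrightarrow> (\<forall>p. \<phi> p \<ge> 0) \<longrightarrow> (\<forall>\<delta>>0. \<exists>A>0. \<forall>\<^sub>F \<epsilon> in at_right 0.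
    abs_level_integral (F 0 0) \<phi> \<epsilon> > A * \<epsilon> powr (1 / nd + \<delta>))"
proof -
  obtain K R where ft: "finite_type K R"
    and lower: "\<And>\<rho> \<delta>. \<rho> > 0 \<Longrightarrow> \<delta> > 0 \<Longrightarrow> \<exists>A>0. \<forall>\<^sub>F \<epsilon> in at_right 0.
      ennreal (A * \<epsilon> powr (1 / nd + \<delta>)) \<le> emeasure lborel (sublevel \<rho> \<epsilon>)"
    using case_unbounded_ray[OF assms] by blast
  have R: "R > 0" using ft by (simp add: finite_type_def)
  have L: "\<forall>\<^sub>F \<epsilon>::real in at_right 0. \<epsilon> powr (1 / nd + \<delta>) > 0" for \<delta>
    using eventually_at_right_less[of "0::real"] by eventually_elim simp
  have "\<exists>A>0. \<forall>\<^sub>F \<epsilon> in at_right 0. abs_level_integral (F 0 0) \<phi> \<epsilon> > A * \<epsilon> powr (1 / nd + \<delta>)"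
    if "bump R \<phi>" "\<forall>p. \<phi> p \<ge> 0" "\<delta> > 0" for \<phi> \<delta>
    by (rule nonneg_level_integral_lower[OF ft _ _ _ _ _ lower[OF _ that(3)] L])
      (use that in \<open>auto simp: bump_def\<close>)
  then show ?thesis using R by blast
qed

end

text \<open>The factor \<open>sgn (\<phi> (0, 0))\<close> makes the bounds meaningful for negative
  \<phi>(0,0), when the integral itself is negative for small \<epsilon>. The neighbourhood
  \<open>U\<close> is chosen before \<phi>, whereas \<open>A\<close> may depend on \<phi> and, for a
  ray, on \<delta>.\<close>

theorem theorem1:
  fixes S :: "real \<times> real \<Rightarrow> real" and V :: "(real \<times> real) set"
  assumes "open V" and "(0, 0) \<in> V" and "smooth_on V S"
    and "S (0, 0) = 0" and "GDERIV S (0, 0) :> 0"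
    and "\<exists>a b. taylor_coeff S a b \<noteq> 0"
    and "superadapted S" and "newton_distance S > 1"
  shows "\<exists>U. open U \<and> (0, 0) \<in> U \<and> U \<subseteq> V \<and>
    (\<forall>\<phi> :: real \<times> real \<Rightarrow> real.
       smooth_on UNIV \<phi> \<and> compact (supp \<phi>) \<and> supp \<phi> \<subseteq> U \<and> \<phi> (0, 0) \<noteq> 0 \<longrightarrow>
         (bisectrix_in_compact_edge S \<longrightarrow>
            (\<exists>A>0. \<forall>\<^sub>F \<epsilon> in at_right 0.
               sgn (\<phi> (0, 0)) * abs_level_integral S \<phi> \<epsilon>
                 > A * \<epsilon> powr (1 / newton_distance S))) \<and>
         (bisectrix_at_vertex S \<longrightarrow>
            (\<exists>A>0. \<forall>\<^sub>F \<epsilon> in at_right 0.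
               sgn (\<phi> (0, 0)) * abs_level_integral S \<phi> \<epsilon>
                 > A * \<bar>ln \<epsilon>\<bar> * \<epsilon> powr (1 / newton_distance S))) \<and>
         (bisectrix_in_unbounded_ray S \<and> (\<forall>p. \<phi> p \<ge> 0) \<longrightarrow>
            (\<forall>\<delta>>0. \<exists>A>0. \<forall>\<^sub>F \<epsilon> in at_right 0.
               abs_level_integral S \<phi> \<epsilon>
                 > A * \<epsilon> powr (1 / newton_distance S + \<delta>))))"
proof -
  define F where "F i j = (Dx ^^ i) ((Dy ^^ j) S)" for i j
  have S: "F 0 0 = S" by (simp add: F_def)
  interpret jet V F
    unfolding F_def by (rule jet_smooth_on[OF assms(1-3)])
  \<comment> \<open>Each case supplies a radius only under its own hypothesis; otherwise radius 1
    serves vacuously, so that one minimum covers all three cases.\<close>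
  have guard: "\<exists>R>0. B \<longrightarrow> P R" if "B \<Longrightarrow> \<exists>R>0. P R" for B and P :: "real \<Rightarrow> bool"
    using that zero_less_one by blast
  obtain R0 where R0: "R0 > 0" "ball 0 R0 \<subseteq> V"
    using openE[OF open_V zero_in_V] .
  define P1 where "P1 R \<longleftrightarrow> (\<forall>\<phi>. bump R \<phi> \<longrightarrow> (\<exists>A>0. \<forall>\<^sub>F \<epsilon> in at_right 0.
    sgn (\<phi> (0, 0)) * abs_level_integral S \<phi> \<epsilon> > A * \<epsilon> powr (1 / newton_distance S)))" for R
  define P2 where "P2 R \<longleftrightarrow> (\<forall>\<phi>. bump R \<phi> \<longrightarrow> (\<exists>A>0. \<forall>\<^sub>F \<epsilon> in at_right 0.
    sgn (\<phi> (0, 0)) * abs_level_integral S \<phi> \<epsilon> > A * (\<bar>ln \<epsilon>\<bar> * \<epsilon> powr (1 / newton_distance S))))" for R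
  define P3 where "P3 R \<longleftrightarrow> (\<forall>\<phi>. bump R \<phi> \<longrightarrow> (\<forall>p. \<phi> p \<ge> 0) \<longrightarrow> (\<forall>\<delta>>0. \<exists>A>0. \<forall>\<^sub>F \<epsilon> in at_right 0.
    abs_level_integral S \<phi> \<epsilon> > A * \<epsilon> powr (1 / newton_distance S + \<delta>)))" for R
  have "\<exists>R>0. bisectrix_in_compact_edge S \<longrightarrow> P1 R"
    unfolding P1_def by (rule guard) (rule level_integral_compact_edge[unfolded S zero_prod_def, OF assms(7,8)])
  then obtain R1 where R1: "R1 > 0" "bisectrix_in_compact_edge S \<longrightarrow> P1 R1" by blast
  have "\<exists>R>0. bisectrix_at_vertex S \<longrightarrow> P2 R"
    unfolding P2_def by (rule guard) (rule level_integral_vertex[unfolded S zero_prod_def, OF assms(8)])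
  then obtain R2 where R2: "R2 > 0" "bisectrix_at_vertex S \<longrightarrow> P2 R2" by blast
  have "\<exists>R>0. bisectrix_in_unbounded_ray S \<longrightarrow> P3 R"
    unfolding P3_def by (rule guard) (rule level_integral_unbounded_ray[unfolded S, OF assms(8)])
  then obtain R3 where R3: "R3 > 0" "bisectrix_in_unbounded_ray S \<longrightarrow> P3 R3" by blast
  define R where "R = min (min R0 R1) (min R2 R3)"
  have R: "R > 0" "R \<le> R0" "R \<le> R1" "R \<le> R2" "R \<le> R3"
    using R0 R1 R2 R3 by (auto simp: R_def)
  have b: "bump R1 \<phi>" "bump R2 \<phi>" "bump R3 \<phi>"
    if "smooth_on UNIV \<phi>" "compact (supp \<phi>)" "supp \<phi> \<subseteq> ball 0 R" "\<phi> (0, 0) \<noteq> 0" for \<phi>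
  proof -
    have "bump R \<phi>"
      unfolding bump_def using that smooth_on_continuous[OF that(1)] by (simp add: zero_prod_def)
    then show "bump R1 \<phi>" "bump R2 \<phi>" "bump R3 \<phi>" using R bump_mono by blast+
  qed
  show ?thesis
  proof (intro exI[of _ "ball 0 R"] conjI allI impI, goal_cases)
    case 2
    then show ?case using R by (simp flip: zero_prod_def)
  next
    case 3
    then show ?case using R0(2) R(2) subset_ball by blast
  next
    case (4 \<phi>)
    then have "bump R1 \<phi>" by (intro b) auto
    then show ?case using R1(2) 4(2) unfolding P1_def by blast
  next
    case (5 \<phi>)
    then have "bump R2 \<phi>" by (intro b) auto
    then show ?case using R2(2) 5(2) unfolding P2_def mult.assoc by blast
  next
    case (6 \<phi> \<delta>)
    then have "bump R3 \<phi>" by (intro b) auto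
    then show ?case using R3(2) 6(2,3) unfolding P3_def by blast
  qed simp
qed

end
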